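(* Let $p_1,p_2$ be primes with $p_1\equiv p_2\equiv 1\pmod 4$ such that at least two of $\left(\frac{p_1}{p_2}\right),\left(\frac{2}{p_1}\right),\left(\frac{2}{p_2}\right)$ equal $-1$, let $k=\mathbb{Q}(\sqrt{2p_1p_2},i)$ and let $k^{*}=\mathbb{Q}(\sqrt2,\sqrt{p_1},\sqrt{p_2},i)$ be the genus field of $k$. Then every class of $\mathbf{C}_{k,2}$ capitulates in $k^{*}$, i.e. $\ker j_{k^*}=\mathbf{C}_{k,2}$.
   Context: $\mathbf{C}_{k,2}$ is the $2$-Sylow subgroup of the class group of $k$. For an unramified extension $K/k$, $j_K:\mathbf{C}_{k,2}\to\mathbf{C}_{K,2}$ is the homomorphism induced by extension of ideals $\mathfrak a\mapsto \mathfrak a\mathcal O_K$; a class capitulates in $K$ if it lies in $\ker j_K$. *)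

theory Defs
  imports "HOL-Computational_Algebra.Computational_Algebra" "HOL-Number_Theory.Number_Theory"
begin

definition subfield_C :: "complex set \<Rightarrow> bool" where
  "subfield_C S \<longleftrightarrow> 0 \<in> S \<and> 1 \<in> S \<and> (\<forall>x\<in>S. \<forall>y\<in>S. x + y \<in> S \<and> x - y \<in> S \<and> x * y \<in> S)
     \<and> (\<forall>x\<in>S. x \<noteq> 0 \<longrightarrow> inverse x \<in> S)"

definition gen_field :: "complex set \<Rightarrow> complex set" where
  "gen_field A = \<Inter>{S. subfield_C S \<and> A \<subseteq> S}"

definition ring_of_integers :: "complex set \<Rightarrow> complex set" where
  "ring_of_integers K = {x \<in> K. algebraic_int x}"

definition is_ideal :: "complex set \<Rightarrow> complex set \<Rightarrow> bool" where
  "is_ideal R I \<longleftrightarrow> I \<subseteq> R \<and> 0 \<in> I \<and> (\<forall>x\<in>I. \<forall>y\<in>I. x + y \<in> I)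
     \<and> (\<forall>r\<in>R. \<forall>x\<in>I. r * x \<in> I)"

definition nz_ideals :: "complex set \<Rightarrow> complex set set" where
  "nz_ideals R = {I. is_ideal R I \<and> I \<noteq> {0}}"

definition ideal_gen :: "complex set \<Rightarrow> complex set \<Rightarrow> complex set" where
  "ideal_gen R S = \<Inter>{J. is_ideal R J \<and> S \<subseteq> J}"

definition ideal_mult :: "complex set \<Rightarrow> complex set \<Rightarrow> complex set \<Rightarrow> complex set" where
  "ideal_mult R I J = ideal_gen R {a * b | a b. a \<in> I \<and> b \<in> J}"

primrec ideal_pow :: "complex set \<Rightarrow> complex set \<Rightarrow> nat \<Rightarrow> complex set" where
  "ideal_pow R I 0 = R"
| "ideal_pow R I (Suc n) = ideal_mult R I (ideal_pow R I n)"

definition ideal_equiv :: "complex set \<Rightarrow> complex set \<Rightarrow> complex set \<Rightarrow> bool" where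
  "ideal_equiv R I J \<longleftrightarrow> (\<exists>\<alpha>\<in>R - {0}. \<exists>\<beta>\<in>R - {0}. (\<lambda>x. \<alpha> * x) ` I = (\<lambda>x. \<beta> * x) ` J)"

definition ideal_class :: "complex set \<Rightarrow> complex set \<Rightarrow> complex set set" where
  "ideal_class R I = {J \<in> nz_ideals R. ideal_equiv R I J}"

definition class_group :: "complex set \<Rightarrow> complex set set set" where
  "class_group R = ideal_class R ` nz_ideals R"

definition class_rep :: "complex set set \<Rightarrow> complex set" where
  "class_rep c = (SOME I. I \<in> c)"

definition class_group_2 :: "complex set \<Rightarrow> complex set set set" where
  "class_group_2 R = {c \<in> class_group R.
      \<exists>m. ideal_class R (ideal_pow R (class_rep c) (2 ^ m)) = ideal_class R R}"

definition j_map :: "complex set \<Rightarrow> complex set \<Rightarrow> complex set set \<Rightarrow> complex set set" where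
  "j_map Ok OK c = ideal_class OK (ideal_gen OK (class_rep c))"

definition capitulation_kernel :: "complex set \<Rightarrow> complex set \<Rightarrow> complex set set set" where
  "capitulation_kernel k K =
     {c \<in> class_group_2 (ring_of_integers k).
        j_map (ring_of_integers k) (ring_of_integers K) c = ideal_class (ring_of_integers K) (ring_of_integers K)}"

end

theory Submission
  imports Defs "Jordan_Normal_Form.Char_Poly"
begin

text \<open>Over the principal ideal domain of Gaussian integers, k is a quadratic extension, generated by the
  square root \<eta> of D = 2 p1 p2, with conjugation \<sigma>. By Hilbert 90, an ideal whose square is principal
  lies in the class of an ambiguous ideal J, and J squared is generated by a squarefree Gaussian
  integer d dividing 2 D. In the genus field such a d is a unit times a square: for 1 + i this is seen
  with an 8th root of unity, and for a Gaussian prime above p with a unit of norm -1 of the field of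
  the square root of p. Hence the extension of J is principal.

  It remains to see that the 2-part of the class group has exponent 2. If the square of a class has
  order at most 2, it contains an ambiguous J for which d is a relative norm. Legendre symbols at p1
  and p2 exclude every d except those for which J is principal; one of these principal ideals comes
  from a unit of norm -1 in the field of the square root of D, which exists because the same
  symbols exclude the other outcomes of the descent on the minimal solution of the Pell equation.

  If p1 = p2, then k is the 8th cyclotomic field and the same argument applies with D = 2.\<close>

section \<open>Algebraic integers\<close>

lemma algebraic_int_eigenvalue:
  fixes v :: "nat \<Rightarrow> complex" and M :: "nat \<Rightarrow> nat \<Rightarrow> int"
  assumes eq: "\<And>i. i < n \<Longrightarrow> x * v i = (\<Sum>j<n. of_int (M i j) * v j)"
    and nz: "i0 < n" "v i0 \<noteq> 0"
  shows "algebraic_int x"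
proof -
  let ?N = "mat n n (\<lambda>(i, j). M i j)"
  let ?A = "map_mat of_int ?N :: complex mat"
  have A: "?A \<in> carrier_mat n n" by simp
  have "eigenvector ?A (vec n v) x"
    unfolding eigenvector_def
  proof (intro conjI)
    show "vec n v \<noteq> 0\<^sub>v (dim_row ?A)"
      using nz by (metis index_vec index_zero_vec(1) dim_row_mat(1) index_map_mat(2))
    show "?A *\<^sub>v vec n v = x \<cdot>\<^sub>v vec n v"
      by (rule eq_vecI) (auto simp: scalar_prod_def eq lessThan_atLeast0)
  qed auto
  hence "eigenvalue ?A x" unfolding eigenvalue_def by blast
  hence "poly (char_poly ?A) x = 0" using eigenvalue_root_char_poly[OF A] by simp
  moreover have "char_poly ?A = map_poly of_int (char_poly ?N)"
    by (rule of_int_hom.char_poly_hom) auto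
  moreover have "lead_coeff (char_poly ?N) = 1"
    using degree_monic_char_poly[of ?N n] by auto
  ultimately show ?thesis
    using algebraic_int_altdef_ipoly by metis
qed

definition zspan :: "complex set \<Rightarrow> complex set" where
  "zspan B = {z. \<exists>c :: complex \<Rightarrow> int. z = (\<Sum>b\<in>B. of_int (c b) * b)}"

lemma zspan_0: "0 \<in> zspan B"
  unfolding zspan_def by (auto intro!: exI[of _ "\<lambda>_. 0"])

lemma zspan_base: "finite B \<Longrightarrow> b \<in> B \<Longrightarrow> b \<in> zspan B"
proof -
  assume "finite B" "b \<in> B"
  hence "b = (\<Sum>a\<in>B. if a = b then a else 0)" by simp
  also have "\<dots> = (\<Sum>a\<in>B. of_int (if a = b then 1 else 0) * a)"
    by (rule sum.cong) auto
  finally show ?thesis unfolding zspan_def by (intro CollectI exI[of _ "\<lambda>a. if a = b then 1 else 0"])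
qed

lemma zspan_add: "u \<in> zspan B \<Longrightarrow> v \<in> zspan B \<Longrightarrow> u + v \<in> zspan B"
proof -
  assume "u \<in> zspan B" "v \<in> zspan B"
  then obtain c d :: "complex \<Rightarrow> int" where
    "u = (\<Sum>b\<in>B. of_int (c b) * b)" "v = (\<Sum>b\<in>B. of_int (d b) * b)"
    unfolding zspan_def by auto
  hence "u + v = (\<Sum>b\<in>B. of_int (c b + d b) * b)"
    by (simp add: sum.distrib algebra_simps)
  thus ?thesis unfolding zspan_def by (auto intro!: exI[of _ "\<lambda>b. c b + d b"])
qed

lemma zspan_scale: "u \<in> zspan B \<Longrightarrow> of_int m * u \<in> zspan B"
proof -
  assume "u \<in> zspan B"
  then obtain c :: "complex \<Rightarrow> int" where "u = (\<Sum>b\<in>B. of_int (c b) * b)"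
    unfolding zspan_def by auto
  hence "of_int m * u = (\<Sum>b\<in>B. of_int (m * c b) * b)"
    by (simp add: sum_distrib_left algebra_simps)
  thus ?thesis unfolding zspan_def by (auto intro!: exI[of _ "\<lambda>b. m * c b"])
qed

lemma zspan_sum: "(\<And>i. i \<in> S \<Longrightarrow> f i \<in> zspan B) \<Longrightarrow> sum f S \<in> zspan B"
  by (induction S rule: infinite_finite_induct) (auto intro: zspan_0 zspan_add)

lemma algebraic_int_zspan:
  assumes fin: "finite B" and nz: "b0 \<in> B" "b0 \<noteq> 0"
    and st: "\<And>b. b \<in> B \<Longrightarrow> x * b \<in> zspan B"
  shows "algebraic_int x"
proof -
  obtain v where v: "bij_betw v {..<card B} B"
    using ex_bij_betw_nat_finite[OF fin] by (auto simp: lessThan_atLeast0)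
  have "\<forall>b\<in>B. \<exists>c :: complex \<Rightarrow> int. x * b = (\<Sum>b'\<in>B. of_int (c b') * b')"
    using st unfolding zspan_def by auto
  then obtain C :: "complex \<Rightarrow> complex \<Rightarrow> int" where
    C: "\<And>b. b \<in> B \<Longrightarrow> x * b = (\<Sum>b'\<in>B. of_int (C b b') * b')" by metis
  obtain i0 where i0: "i0 < card B" "v i0 = b0"
    using v nz unfolding bij_betw_def by (metis imageE lessThan_iff)
  show ?thesis
  proof (rule algebraic_int_eigenvalue[of "card B" x v "\<lambda>i j. C (v i) (v j)" i0])
    fix i assume "i < card B"
    hence "v i \<in> B" using v unfolding bij_betw_def by auto
    thus "x * v i = (\<Sum>j<card B. of_int (C (v i) (v j)) * v j)"
      using C[of "v i"] sum.reindex_bij_betw[OF v, of "\<lambda>b'. of_int (C (v i) b') * b'"] by simp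
  qed (use i0 nz in auto)
qed

lemma algebraic_int_power_relation:
  fixes x :: complex
  assumes "algebraic_int x"
  obtains m :: nat and c :: "nat \<Rightarrow> int" where "m > 0" "x ^ m = (\<Sum>i<m. of_int (c i) * x ^ i)"
proof -
  obtain p where p: "poly (map_poly of_int p) x = 0" "lead_coeff p = 1"
    using assms unfolding algebraic_int_altdef_ipoly by auto
  have "degree p > 0"
  proof (rule ccontr)
    assume "\<not> degree p > 0"
    then obtain c where "p = [:c:]" by (auto elim: degree_eq_zeroE)
    thus False using p by auto
  qed
  moreover have "0 = (\<Sum>i\<le>degree p. of_int (poly.coeff p i) * x ^ i)"
    using p(1) by (simp add: poly_altdef coeff_map_poly degree_map_poly)
  hence "0 = (\<Sum>i<degree p. of_int (poly.coeff p i) * x ^ i) + x ^ degree p"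
    using p(2) by (simp flip: lessThan_Suc_atMost)
  hence "x ^ degree p = (\<Sum>i<degree p. of_int (- poly.coeff p i) * x ^ i)"
    by (simp add: sum_negf eq_neg_iff_add_eq_0 add.commute)
  ultimately show ?thesis by (intro that[of "degree p" "\<lambda>i. - poly.coeff p i"])
qed

lemma algebraic_int_plus_times:
  fixes x y :: complex
  assumes "algebraic_int x" "algebraic_int y"
  shows "algebraic_int (x + y)" "algebraic_int (x * y)"
proof -
  obtain m c where m: "m > 0" "x ^ m = (\<Sum>i<m. of_int (c i) * x ^ i)"
    using algebraic_int_power_relation[OF assms(1)] by blast
  obtain n d where n: "n > 0" "y ^ n = (\<Sum>i<n. of_int (d i) * y ^ i)"
    using algebraic_int_power_relation[OF assms(2)] by blast
  define B where "B = (\<lambda>(i, j). x ^ i * y ^ j) ` ({..<m} \<times> {..<n})"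
  have fin: "finite B" by (simp add: B_def)
  have BE: "\<exists>i j. i < m \<and> j < n \<and> b = x ^ i * y ^ j" if "b \<in> B" for b
    using that unfolding B_def by auto
  have BI: "x ^ i * y ^ j \<in> B" if "i < m" "j < n" for i j
    using that unfolding B_def by force
  have base: "x ^ i * y ^ j \<in> zspan B" if "i < m" "j < n" for i j
    by (rule zspan_base[OF fin BI[OF that]])
  have X: "x ^ i * y ^ j \<in> zspan B" if "i \<le> m" "j < n" for i j
  proof (cases "i = m")
    case True
    have "x ^ i * y ^ j = (\<Sum>i<m. of_int (c i) * (x ^ i * y ^ j))"
      unfolding True m(2) by (simp add: sum_distrib_right mult.assoc)
    also have "\<dots> \<in> zspan B" by (intro zspan_sum zspan_scale base) (use that in auto)
    finally show ?thesis .
  qed (use that base in auto)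
  have Y: "x ^ i * y ^ j \<in> zspan B" if "i < m" "j \<le> n" for i j
  proof (cases "j = n")
    case True
    have "x ^ i * y ^ j = (\<Sum>j<n. of_int (d j) * (x ^ i * y ^ j))"
      unfolding True n(2) by (simp add: sum_distrib_left mult.assoc mult.left_commute)
    also have "\<dots> \<in> zspan B" by (intro zspan_sum zspan_scale base) (use that in auto)
    finally show ?thesis .
  qed (use that base in auto)
  have xb: "x * b \<in> zspan B" if b: "b \<in> B" for b
  proof -
    obtain i j where "i < m" "j < n" "b = x ^ i * y ^ j" using BE[OF b] by auto
    thus ?thesis using X[of "Suc i" j] by (simp add: mult.assoc)
  qed
  have yb: "y * b \<in> zspan B" if b: "b \<in> B" for b
  proof -
    obtain i j where "i < m" "j < n" "b = x ^ i * y ^ j" using BE[OF b] by auto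
    thus ?thesis using Y[of i "Suc j"] by (simp add: mult.left_commute)
  qed
  have one: "1 \<in> B" using BI[of 0 0] m(1) n(1) by simp
  show "algebraic_int (x + y)"
    by (rule algebraic_int_zspan[OF fin one]) (auto simp: distrib_right intro!: zspan_add xb yb)
  show "algebraic_int (x * y)"
  proof (rule algebraic_int_zspan[OF fin one])
    fix b assume "b \<in> B"
    then obtain i j where ij: "i < m" "j < n" "b = x ^ i * y ^ j" using BE by blast
    show "x * y * b \<in> zspan B"
    proof (cases "Suc j < n")
      case True
      thus ?thesis using ij X[of "Suc i" "Suc j"] by (simp add: algebra_simps)
    next
      case False
      hence "Suc j = n" using ij by simp
      hence "x * y * b = (\<Sum>j<n. of_int (d j) * (x ^ Suc i * y ^ j))"
      proof -
        have "x * y * b = x ^ Suc i * y ^ Suc j" using ij by (simp add: algebra_simps)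
        also have "\<dots> = x ^ Suc i * (\<Sum>j<n. of_int (d j) * y ^ j)"
          unfolding \<open>Suc j = n\<close> by (subst n(2)) (rule refl)
        finally show ?thesis by (simp add: sum_distrib_left algebra_simps)
      qed
      also have "\<dots> \<in> zspan B" by (intro zspan_sum zspan_scale X) (use ij in auto)
      finally show ?thesis .
    qed
  qed simp
qed

lemma algebraic_int_diff: "algebraic_int x \<Longrightarrow> algebraic_int y \<Longrightarrow> algebraic_int (x - y :: complex)"
  using algebraic_int_plus_times(1)[of x "- y"] by simp

lemma algebraic_int_of_square: "algebraic_int (x\<^sup>2) \<Longrightarrow> algebraic_int (x :: complex)"
  by (rule algebraic_int_root[of "x\<^sup>2" "Polynomial.monom 1 2"]) (auto simp: poly_monom degree_monom_eq)

section \<open>Gaussian integers\<close>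

definition gauss :: "complex set" where
  "gauss = {z. Re z \<in> \<int> \<and> Im z \<in> \<int>}"

definition gauss_rat :: "complex set" where
  "gauss_rat = {z. Re z \<in> \<rat> \<and> Im z \<in> \<rat>}"

definition gnorm :: "complex \<Rightarrow> int" where
  "gnorm z = \<lfloor>(cmod z)\<^sup>2\<rfloor>"

definition gdvd :: "complex \<Rightarrow> complex \<Rightarrow> bool" where
  "gdvd a b \<longleftrightarrow> (\<exists>c\<in>gauss. b = a * c)"

lemma gauss_of_int [simp, intro]: "of_int n \<in> gauss"
  and gauss_0 [simp, intro]: "0 \<in> gauss"
  and gauss_1 [simp, intro]: "1 \<in> gauss"
  and gauss_ii [simp, intro]: "\<i> \<in> gauss"
  and gauss_numeral [simp, intro]: "numeral k \<in> gauss"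
  by (simp_all add: gauss_def)

lemma gauss_add [intro]: "x \<in> gauss \<Longrightarrow> y \<in> gauss \<Longrightarrow> x + y \<in> gauss"
  and gauss_diff [intro]: "x \<in> gauss \<Longrightarrow> y \<in> gauss \<Longrightarrow> x - y \<in> gauss"
  and gauss_minus [intro]: "x \<in> gauss \<Longrightarrow> - x \<in> gauss"
  and gauss_mult [intro]: "x \<in> gauss \<Longrightarrow> y \<in> gauss \<Longrightarrow> x * y \<in> gauss"
  and gauss_cnj [intro]: "x \<in> gauss \<Longrightarrow> cnj x \<in> gauss"
  by (simp_all add: gauss_def)

lemma gauss_power [intro]: "x \<in> gauss \<Longrightarrow> x ^ n \<in> gauss"
  by (induction n) auto

lemma gauss_cases:
  assumes "z \<in> gauss"
  obtains a b where "z = of_int a + \<i> * of_int b"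
proof -
  from assms obtain a b where "Re z = of_int a" "Im z = of_int b"
    by (auto simp: gauss_def elim!: Ints_cases)
  hence "z = of_int a + \<i> * of_int b" by (simp add: complex_eq_iff)
  thus ?thesis using that by blast
qed

lemma gnorm_eq: "z \<in> gauss \<Longrightarrow> of_int (gnorm z) = (cmod z)\<^sup>2"
proof -
  assume "z \<in> gauss"
  then obtain a b where "z = of_int a + \<i> * of_int b" by (rule gauss_cases)
  hence "(cmod z)\<^sup>2 = of_int (a\<^sup>2 + b\<^sup>2)" by (simp add: cmod_power2)
  thus ?thesis unfolding gnorm_def by (metis floor_of_int)
qed

lemma gnorm_cnj_mult: "z \<in> gauss \<Longrightarrow> of_int (gnorm z) = z * cnj z"
  using gnorm_eq[of z] complex_norm_square[of z] by (metis of_real_of_int_eq)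

lemma gnorm_mult: "x \<in> gauss \<Longrightarrow> y \<in> gauss \<Longrightarrow> gnorm (x * y) = gnorm x * gnorm y"
proof -
  assume a: "x \<in> gauss" "y \<in> gauss"
  hence "real_of_int (gnorm (x * y)) = real_of_int (gnorm x * gnorm y)"
    by (simp add: gnorm_eq gauss_mult norm_mult power_mult_distrib)
  thus ?thesis by (simp only: of_int_eq_iff)
qed

lemma gnorm_nonneg: "gnorm z \<ge> 0"
  unfolding gnorm_def by simp

lemma gnorm_eq_0_iff: "z \<in> gauss \<Longrightarrow> gnorm z = 0 \<longleftrightarrow> z = 0"
  using gnorm_eq[of z] by auto

lemma gnorm_pos: "z \<in> gauss \<Longrightarrow> z \<noteq> 0 \<Longrightarrow> gnorm z > 0"
  using gnorm_nonneg[of z] gnorm_eq_0_iff[of z] by linarith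

lemma gnorm_of_int [simp]: "gnorm (of_int n) = n\<^sup>2"
  unfolding gnorm_def by (simp flip: of_int_power of_int_abs)

lemma gnorm_1 [simp]: "gnorm 1 = 1"
  using gnorm_of_int[of 1] by simp

lemma gnorm_power: "x \<in> gauss \<Longrightarrow> gnorm (x ^ n) = gnorm x ^ n"
  by (induction n) (auto simp: gnorm_mult gauss_power)

lemma gnorm_cnj [simp]: "gnorm (cnj z) = gnorm z"
  by (simp add: gnorm_def)

lemma gnorm_1_cases:
  assumes "z \<in> gauss" "gnorm z = 1"
  shows "z \<in> {1, -1, \<i>, -\<i>}"
proof -
  obtain a b where z: "z = of_int a + \<i> * of_int b" using assms(1) by (rule gauss_cases)
  hence "(cmod z)\<^sup>2 = of_int (a\<^sup>2 + b\<^sup>2)" by (simp add: cmod_power2)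
  hence ab: "a\<^sup>2 + b\<^sup>2 = 1" using assms by (metis gnorm_eq of_int_eq_iff)
  hence "a\<^sup>2 \<le> 1" "b\<^sup>2 \<le> 1" by (smt (verit) zero_le_power2)+
  hence "\<bar>a\<bar> \<le> 1" "\<bar>b\<bar> \<le> 1" by (simp_all add: abs_square_le_1)
  hence "a \<in> {-1, 0, 1}" "b \<in> {-1, 0, 1}" by auto
  thus ?thesis using ab z by auto
qed

lemma gauss_unit_cases:
  assumes "u \<in> gauss" "v \<in> gauss" "u * v = 1"
  shows "u \<in> {1, -1, \<i>, -\<i>}"
proof (rule gnorm_1_cases)
  have "gnorm u * gnorm v = 1" using assms gnorm_mult[of u v] by simp
  thus "gnorm u = 1" using gnorm_nonneg[of u] by (simp add: zmult_eq_1_iff)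
qed fact

lemma gnorm_1_inverse:
  assumes "u \<in> gauss" "gnorm u = 1"
  shows "cnj u * u = 1" "u \<noteq> 0"
  using gnorm_cnj_mult[OF assms(1)] assms(2) by (auto simp: mult.commute)

lemma gauss_euclid:
  assumes "x \<in> gauss" "y \<in> gauss" "y \<noteq> 0"
  shows "\<exists>q\<in>gauss. gnorm (x - q * y) < gnorm y"
proof -
  define w where "w = x / y"
  define q where "q = Complex (of_int (round (Re w))) (of_int (round (Im w)))"
  have q: "q \<in> gauss" by (simp add: q_def gauss_def)
  have r: "\<bar>Re (w - q)\<bar> \<le> 1/2" "\<bar>Im (w - q)\<bar> \<le> 1/2"
    using of_int_round_abs_le[of "Re w"] of_int_round_abs_le[of "Im w"]
    by (simp_all add: q_def abs_minus_commute)
  have "(cmod (w - q))\<^sup>2 = \<bar>Re (w - q)\<bar>\<^sup>2 + \<bar>Im (w - q)\<bar>\<^sup>2" by (simp add: cmod_power2)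
  also have "\<dots> \<le> (1/2)\<^sup>2 + (1/2)\<^sup>2" by (intro add_mono power_mono r) auto
  finally have le: "(cmod (w - q))\<^sup>2 < 1" by (simp add: power2_eq_square)
  have "x - q * y = (w - q) * y" using assms(3) by (simp add: w_def field_simps)
  hence "(cmod (x - q * y))\<^sup>2 = (cmod (w - q))\<^sup>2 * (cmod y)\<^sup>2"
    by (simp add: norm_mult power_mult_distrib)
  also have "\<dots> < 1 * (cmod y)\<^sup>2" using le assms(3) by (intro mult_strict_right_mono) auto
  finally have "real_of_int (gnorm (x - q * y)) < real_of_int (gnorm y)"
    using assms q by (simp add: gnorm_eq gauss_diff gauss_mult)
  thus ?thesis using q by auto
qed

lemma gauss_pid:
  assumes sub: "S \<subseteq> gauss" and nz: "x0 \<in> S" "x0 \<noteq> 0"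
    and diff: "\<And>x y. x \<in> S \<Longrightarrow> y \<in> S \<Longrightarrow> x - y \<in> S"
    and mult: "\<And>r x. r \<in> gauss \<Longrightarrow> x \<in> S \<Longrightarrow> r * x \<in> S"
  obtains g where "g \<in> S" "g \<noteq> 0" "\<And>x. x \<in> S \<Longrightarrow> gdvd g x"
proof -
  define P where "P x \<longleftrightarrow> x \<in> S \<and> x \<noteq> 0" for x
  obtain g where g: "P g" and min: "\<And>y. P y \<Longrightarrow> nat (gnorm g) \<le> nat (gnorm y)"
    using ex_has_least_nat[of P x0 "\<lambda>x. nat (gnorm x)"] nz unfolding P_def by auto
  have "gdvd g x" if x: "x \<in> S" for x
  proof -
    obtain q where q: "q \<in> gauss" "gnorm (x - q * g) < gnorm g"
      using gauss_euclid[of x g] x g sub unfolding P_def by auto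
    have "x - q * g \<in> S" using x g q diff mult unfolding P_def by auto
    hence "x - q * g = 0"
      using min[of "x - q * g"] q(2) gnorm_nonneg[of "x - q * g"] unfolding P_def by fastforce
    thus ?thesis unfolding gdvd_def using q(1) by (intro bexI[of _ q]) (auto simp: mult.commute)
  qed
  thus ?thesis using that g unfolding P_def by blast
qed

lemma gauss_bezout:
  assumes "a \<in> gauss" "b \<in> gauss" "a \<noteq> 0"
  obtains g a' b' u v where "g \<in> gauss" "a' \<in> gauss" "b' \<in> gauss" "u \<in> gauss" "v \<in> gauss"
    "g \<noteq> 0" "a = g * a'" "b = g * b'" "u * a' + v * b' = 1"
proof -
  define S where "S = {u * a + v * b |u v. u \<in> gauss \<and> v \<in> gauss}"
  have 1: "x - y \<in> S" if "x \<in> S" "y \<in> S" for x y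
  proof -
    from that obtain u v u' v' where "u \<in> gauss" "v \<in> gauss" "u' \<in> gauss" "v' \<in> gauss"
      "x = u * a + v * b" "y = u' * a + v' * b" unfolding S_def by auto
    hence "x - y = (u - u') * a + (v - v') * b \<and> u - u' \<in> gauss \<and> v - v' \<in> gauss"
      by (auto simp: algebra_simps)
    thus ?thesis unfolding S_def by blast
  qed
  have 2: "r * x \<in> S" if "r \<in> gauss" "x \<in> S" for r x
  proof -
    from that obtain u v where "u \<in> gauss" "v \<in> gauss" "x = u * a + v * b" unfolding S_def by auto
    hence "r * x = (r * u) * a + (r * v) * b \<and> r * u \<in> gauss \<and> r * v \<in> gauss"
      using that by (auto simp: algebra_simps)
    thus ?thesis unfolding S_def by blast
  qed
  have "a = 1 * a + 0 * b" "b = 0 * a + 1 * b" by simp_all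
  hence aS: "a \<in> S" and bS: "b \<in> S" unfolding S_def using gauss_0 gauss_1 by blast+
  have "S \<subseteq> gauss" unfolding S_def using assms by auto
  then obtain g where g: "g \<in> S" "g \<noteq> 0" "\<And>x. x \<in> S \<Longrightarrow> gdvd g x"
    using gauss_pid[of S a] aS assms(3) 1 2 by blast
  obtain a' b' where ab: "a' \<in> gauss" "a = g * a'" "b' \<in> gauss" "b = g * b'"
    using g(3)[OF aS] g(3)[OF bS] unfolding gdvd_def by auto
  obtain u v where uv: "u \<in> gauss" "v \<in> gauss" "g = u * a + v * b" using g(1) unfolding S_def by auto
  have "g * (u * a' + v * b') = g" using uv ab by (simp add: algebra_simps)
  hence "u * a' + v * b' = 1" using g(2) by simp
  moreover have "g \<in> gauss" using uv assms by auto
  ultimately show ?thesis using that ab uv g(2) by blast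
qed

lemma gdvd_mult_left: "gdvd a b \<Longrightarrow> c \<in> gauss \<Longrightarrow> gdvd a (c * b)"
  unfolding gdvd_def by (metis gauss_mult mult.left_commute)

lemma gdvd_add: "gdvd a b \<Longrightarrow> gdvd a c \<Longrightarrow> gdvd a (b + c)"
  unfolding gdvd_def by (metis gauss_add distrib_left)

lemma gdvd_diff: "gdvd a b \<Longrightarrow> gdvd a c \<Longrightarrow> gdvd a (b - c)"
  unfolding gdvd_def by (metis gauss_diff right_diff_distrib)

lemma gdvd_gnorm: "gdvd a b \<Longrightarrow> a \<in> gauss \<Longrightarrow> gnorm a dvd gnorm b"
  unfolding gdvd_def by (auto simp: gnorm_mult)

definition gprime :: "complex \<Rightarrow> bool" where
  "gprime \<pi> \<longleftrightarrow> \<pi> \<in> gauss \<and> prime (gnorm \<pi>)"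

lemma gprime_nonzero: "gprime \<pi> \<Longrightarrow> \<pi> \<noteq> 0"
  unfolding gprime_def using gnorm_of_int[of 0] by auto

lemma prime_int_mult_cases:
  assumes "prime (a * b :: int)" "a \<ge> 0" "b \<ge> 0"
  shows "a = 1 \<or> b = 1"
  using irreducibleD[OF prime_elem_imp_irreducible[OF prime_imp_prime_elem[OF assms(1)]], of a b]
    assms(2,3) by fastforce

lemma gprime_dvd_multD:
  assumes pi: "gprime \<pi>" and ab: "a \<in> gauss" "b \<in> gauss" "gdvd \<pi> (a * b)"
  shows "gdvd \<pi> a \<or> gdvd \<pi> b"
proof -
  have pg: "\<pi> \<in> gauss" "prime (gnorm \<pi>)" using pi unfolding gprime_def by auto
  obtain g p' a' u v where g: "g \<in> gauss" "p' \<in> gauss" "a' \<in> gauss" "u \<in> gauss" "v \<in> gauss"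
    "g \<noteq> 0" "\<pi> = g * p'" "a = g * a'" "u * p' + v * a' = 1"
    using gauss_bezout[OF pg(1) ab(1) gprime_nonzero[OF pi]] by blast
  have "gnorm \<pi> = gnorm g * gnorm p'" using g gnorm_mult by simp
  hence "gnorm g = 1 \<or> gnorm p' = 1"
    using prime_int_mult_cases[of "gnorm g" "gnorm p'"] pg(2) gnorm_nonneg by simp
  thus ?thesis
  proof
    assume g1: "gnorm g = 1"
    have "b = b * (u * p' + v * a') * (cnj g * g)"
      unfolding g(9) gnorm_1_inverse(1)[OF g(1) g1] by simp
    also have "\<dots> = (b * u * cnj g) * \<pi> + (v * cnj g) * (a * b)" by (simp add: g(7,8) algebra_simps)
    finally have eq: "b = (b * u * cnj g) * \<pi> + (v * cnj g) * (a * b)" . have "gdvd \<pi> ((b * u * cnj g) * \<pi>)" unfolding gdvd_def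
      using g ab by (intro bexI[of _ "b * u * cnj g"]) auto
    moreover have "v * cnj g \<in> gauss" using g by auto
    hence "gdvd \<pi> ((v * cnj g) * (a * b))" by (intro gdvd_mult_left[OF ab(3)])
    ultimately have "gdvd \<pi> b" by (subst eq) (rule gdvd_add)
    thus ?thesis ..
  next
    assume p1: "gnorm p' = 1"
    have "a = \<pi> * (cnj p' * a')" using g(7,8) gnorm_1_inverse[OF g(2) p1] by (simp add: mult_ac)
    moreover have "cnj p' * a' \<in> gauss" using g by auto
    ultimately show ?thesis unfolding gdvd_def by blast
  qed
qed

lemma gprime_dvd_power2D: "gprime \<pi> \<Longrightarrow> a \<in> gauss \<Longrightarrow> gdvd \<pi> (a\<^sup>2) \<Longrightarrow> gdvd \<pi> a"
  using gprime_dvd_multD[of \<pi> a a] by (auto simp: power2_eq_square)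

lemma gdvd_gprime_mult_cases:
  assumes "gprime \<pi>" "d \<in> gauss" "c \<in> gauss" "gdvd d (\<pi> * c)"
  shows "gdvd d c \<or> (\<exists>d'\<in>gauss. d = \<pi> * d' \<and> gdvd d' c)"
proof -
  obtain e where e: "e \<in> gauss" "\<pi> * c = d * e" using assms(4) unfolding gdvd_def by auto
  show ?thesis
  proof (cases "gdvd \<pi> d")
    case True
    then obtain d' where d': "d' \<in> gauss" "d = \<pi> * d'" unfolding gdvd_def by auto
    hence "c = d' * e" using e gprime_nonzero[OF assms(1)] by simp
    thus ?thesis using d' e unfolding gdvd_def by auto
  next
    case False
    have "gdvd \<pi> (d * e)" unfolding e(2)[symmetric] gdvd_def using assms(3) by blast
    hence "gdvd \<pi> e" using False assms e gprime_dvd_multD by blast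
    then obtain e' where "e' \<in> gauss" "e = \<pi> * e'" unfolding gdvd_def by auto
    hence "c = d * e'" using e gprime_nonzero[OF assms(1)] by simp
    thus ?thesis using \<open>e' \<in> gauss\<close> unfolding gdvd_def by auto
  qed
qed

definition gsquarefree :: "complex \<Rightarrow> bool" where
  "gsquarefree d \<longleftrightarrow> d \<in> gauss \<and> d \<noteq> 0 \<and> (\<forall>q\<in>gauss. gdvd (q\<^sup>2) d \<longrightarrow> gnorm q = 1)"

lemma gsquarefree_decomp:
  assumes "n \<in> gauss" "n \<noteq> 0"
  obtains m d where "m \<in> gauss" "m \<noteq> 0" "gsquarefree d" "n = m\<^sup>2 * d"
proof -
  have "\<exists>m d. m \<in> gauss \<and> m \<noteq> 0 \<and> gsquarefree d \<and> n = m\<^sup>2 * d"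
    using assms
  proof (induction "nat (gnorm n)" arbitrary: n rule: less_induct)
    case less
    show ?case
    proof (cases "gsquarefree n")
      case True
      thus ?thesis by (intro exI[of _ 1] exI[of _ n]) auto
    next
      case False
      then obtain q c where q: "q \<in> gauss" "gnorm q \<noteq> 1" "c \<in> gauss" "n = q\<^sup>2 * c"
        using less.prems unfolding gsquarefree_def gdvd_def by auto
      have nz: "q \<noteq> 0" "c \<noteq> 0" using q less.prems by auto
      have "gnorm q > 1" "gnorm c > 0" using q gnorm_pos nz by (smt (verit))+
      moreover have "gnorm n = (gnorm q)\<^sup>2 * gnorm c"
        using q by (simp add: gnorm_mult gnorm_power gauss_power)
      ultimately have "gnorm c < gnorm n" by (simp add: one_less_power)
      hence "nat (gnorm c) < nat (gnorm n)" using \<open>gnorm c > 0\<close> by simp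
      then obtain m d where "m \<in> gauss" "m \<noteq> 0" "gsquarefree d" "c = m\<^sup>2 * d"
        using less.hyps[of c] q nz by auto
      thus ?thesis using q nz
        by (intro exI[of _ "q * m"] exI[of _ d]) (auto simp: power_mult_distrib)
    qed
  qed
  thus ?thesis using that by blast
qed

lemma gsquarefree_dvd_power2D:
  assumes "gsquarefree d" "y \<in> gauss" "gdvd d (y\<^sup>2)"
  shows "gdvd d y"
proof -
  have d: "d \<in> gauss" "d \<noteq> 0" using assms unfolding gsquarefree_def by auto
  obtain g d' y' u v where g: "g \<in> gauss" "d' \<in> gauss" "y' \<in> gauss" "u \<in> gauss" "v \<in> gauss"
    "g \<noteq> 0" "d = g * d'" "y = g * y'" "u * d' + v * y' = 1"
    using gauss_bezout[OF d(1) assms(2) d(2)] by blast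
  obtain c where c: "c \<in> gauss" "y\<^sup>2 = d * c" using assms(3) unfolding gdvd_def by auto
  have gy: "g * y'\<^sup>2 = d' * c" using c g by (simp add: power2_eq_square mult_ac)
  have "g = g * (u * d' + v * y')\<^sup>2" using g by simp
  also have "\<dots> = d' * (g * (u\<^sup>2 * d' + 2 * u * v * y')) + v\<^sup>2 * (g * y'\<^sup>2)"
    by (simp add: power2_eq_square algebra_simps)
  also have "\<dots> = d' * (g * (u\<^sup>2 * d' + 2 * u * v * y') + v\<^sup>2 * c)"
    unfolding gy by (simp add: algebra_simps)
  finally have "gdvd d' g" unfolding gdvd_def
    using g c by (intro bexI[of _ "g * (u\<^sup>2 * d' + 2 * u * v * y') + v\<^sup>2 * c"]
        gauss_add gauss_mult gauss_power) auto
  then obtain h where "h \<in> gauss" "g = d' * h" unfolding gdvd_def by auto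
  hence "d = d'\<^sup>2 * h" using g(7) by (simp add: power2_eq_square)
  hence "gnorm d' = 1" using assms(1) g(2) \<open>h \<in> gauss\<close> unfolding gsquarefree_def gdvd_def by auto
  hence "y = d * (cnj d' * y')" using g gnorm_1_inverse[OF g(2)] by (simp add: algebra_simps)
  thus ?thesis unfolding gdvd_def using g(2,3) by (intro bexI[of _ "cnj d' * y'"] gauss_mult gauss_cnj)
qed

lemma gauss_algebraic_int: "z \<in> gauss \<Longrightarrow> algebraic_int z"
  by (erule gauss_cases) (auto intro!: algebraic_int_plus_times)

lemma square_mod_4: "a\<^sup>2 mod 4 = (if even a then 0 else 1 :: int)"
proof (cases "even a")
  case True
  thus ?thesis by (auto elim!: evenE simp: power_mult_distrib)
next
  case False
  then obtain k where "a = 2 * k + 1" by (auto elim: oddE)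
  hence "a\<^sup>2 = 4 * (k\<^sup>2 + k) + 1" by (simp add: power2_eq_square algebra_simps)
  thus ?thesis using False by presburger
qed

lemma algebraic_int_gauss_rat:
  assumes "z \<in> gauss_rat" "algebraic_int z"
  shows "z \<in> gauss"
proof -
  have "algebraic_int (z + cnj z)" "algebraic_int (- \<i> * (z - cnj z))" "algebraic_int (z * cnj z)"
    using assms by (auto intro!: algebraic_int_plus_times algebraic_int_diff)
  hence a: "algebraic_int (of_real (2 * Re z) :: complex)" "algebraic_int (of_real (2 * Im z) :: complex)"
    "algebraic_int (of_real ((Re z)\<^sup>2 + (Im z)\<^sup>2) :: complex)"
    by (simp_all add: complex_add_cnj complex_diff_cnj complex_mult_cnj mult_ac)
  have "2 * Re z \<in> \<int>" "2 * Im z \<in> \<int>" "(Re z)\<^sup>2 + (Im z)\<^sup>2 \<in> \<int>"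
    using a assms(1) unfolding algebraic_int_of_real_iff gauss_rat_def
    by (auto intro!: rational_algebraic_int_is_int)
  then obtain a b c where abc: "2 * Re z = of_int a" "2 * Im z = of_int b" "(Re z)\<^sup>2 + (Im z)\<^sup>2 = of_int c"
    by (auto elim!: Ints_cases)
  have "real_of_int (a\<^sup>2 + b\<^sup>2) = (2 * Re z)\<^sup>2 + (2 * Im z)\<^sup>2" using abc by simp
  also have "\<dots> = real_of_int (4 * c)" using abc(3) by (simp add: power_mult_distrib)
  finally have ab: "a\<^sup>2 + b\<^sup>2 = 4 * c" by (simp only: of_int_eq_iff)
  have "even a \<and> even b" using square_mod_4[of a] square_mod_4[of b] ab by presburger
  then obtain a' b' where "a = 2 * a'" "b = 2 * b'" by (auto elim!: evenE)
  thus ?thesis using abc unfolding gauss_def by auto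
qed

lemma gauss_rat_0 [simp, intro]: "0 \<in> gauss_rat"
  and gauss_rat_1 [simp, intro]: "1 \<in> gauss_rat"
  and gauss_rat_ii [simp, intro]: "\<i> \<in> gauss_rat"
  and gauss_rat_of_int [simp, intro]: "of_int n \<in> gauss_rat"
  and gauss_rat_numeral [simp, intro]: "numeral k \<in> gauss_rat"
  by (simp_all add: gauss_rat_def)

lemma gauss_rat_add [intro]: "x \<in> gauss_rat \<Longrightarrow> y \<in> gauss_rat \<Longrightarrow> x + y \<in> gauss_rat"
  and gauss_rat_diff [intro]: "x \<in> gauss_rat \<Longrightarrow> y \<in> gauss_rat \<Longrightarrow> x - y \<in> gauss_rat"
  and gauss_rat_minus [intro]: "x \<in> gauss_rat \<Longrightarrow> - x \<in> gauss_rat"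
  and gauss_rat_mult [intro]: "x \<in> gauss_rat \<Longrightarrow> y \<in> gauss_rat \<Longrightarrow> x * y \<in> gauss_rat"
  and gauss_rat_cnj [intro]: "x \<in> gauss_rat \<Longrightarrow> cnj x \<in> gauss_rat"
  by (simp_all add: gauss_rat_def)

lemma gauss_rat_inverse [intro]: "x \<in> gauss_rat \<Longrightarrow> inverse x \<in> gauss_rat"
  by (simp add: gauss_rat_def)

lemma gauss_rat_divide [intro]: "x \<in> gauss_rat \<Longrightarrow> y \<in> gauss_rat \<Longrightarrow> x / y \<in> gauss_rat"
  unfolding divide_inverse by (intro gauss_rat_mult gauss_rat_inverse)

lemma gauss_rat_power [intro]: "x \<in> gauss_rat \<Longrightarrow> x ^ n \<in> gauss_rat"
  by (induction n) auto

lemma gauss_in_gauss_rat: "x \<in> gauss \<Longrightarrow> x \<in> gauss_rat"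
  unfolding gauss_def gauss_rat_def using Ints_subset_Rats by auto

lemma gauss_rat_denominator:
  assumes "z \<in> gauss_rat"
  obtains n :: int where "n > 0" "of_int n * z \<in> gauss"
proof -
  obtain a b c d where "b > 0" "d > 0" "Re z = of_int a / of_int b" "Im z = of_int c / of_int d"
    using assms unfolding gauss_rat_def by (auto elim!: Rats_cases')
  hence "b * d > 0" "of_int (b * d) * z \<in> gauss" unfolding gauss_def by auto
  thus ?thesis using that by blast
qed

lemma algebraic_int_gauss_quadratic:
  assumes TN: "T \<in> gauss" "N \<in> gauss" and eq: "z\<^sup>2 = T * z - N"
  shows "algebraic_int z"
proof -
  define B where "B = {1, \<i>, z, \<i> * z}"
  have fin: "finite B" by (simp add: B_def)
  have mem: "1 \<in> zspan B" "\<i> \<in> zspan B" "z \<in> zspan B" "\<i> * z \<in> zspan B"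
    by (auto intro!: zspan_base simp: B_def)
  have lin: "a * w \<in> zspan B" if aw: "a \<in> gauss" "w \<in> {1, \<i>, z, \<i> * z}" for a w
  proof -
    obtain m n where a: "a = of_int m + \<i> * of_int n" using aw(1) by (rule gauss_cases)
    have "of_int m * w \<in> zspan B" using aw(2) mem by (intro zspan_scale) auto
    moreover have "of_int n * (\<i> * w) \<in> zspan B"
    proof (rule zspan_scale)
      have "of_int (-1) * 1 \<in> zspan B" "of_int (-1) * z \<in> zspan B" using mem zspan_scale by blast+
      thus "\<i> * w \<in> zspan B" using aw(2) mem by (auto simp: mult.assoc[symmetric])
    qed
    ultimately have "of_int m * w + of_int n * (\<i> * w) \<in> zspan B" by (rule zspan_add)
    thus ?thesis by (simp add: a algebra_simps)
  qed
  have zz1: "z * z = T * z + (- N) * 1"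
    using eq by (simp add: power2_eq_square)
  hence "\<i> * (z * z) = \<i> * (T * z + (- N) * 1)" by simp
  hence zz2: "z * (\<i> * z) = (\<i> * T) * z + (- \<i> * N) * 1"
    by (simp only: distrib_left mult_ac) simp
  show ?thesis
  proof (rule algebraic_int_zspan[OF fin, of 1])
    fix b assume "b \<in> B"
    moreover have "z * z \<in> zspan B" unfolding zz1
      by (intro zspan_add lin) (use TN in auto)
    moreover have "z * (\<i> * z) \<in> zspan B" unfolding zz2
      by (intro zspan_add lin) (use TN in auto)
    ultimately show "z * b \<in> zspan B" using mem by (auto simp: B_def mult.commute)
  qed (auto simp: B_def)
qed

section \<open>Legendre symbols\<close>

lemma Legendre_euler:
  assumes "prime p" "p > 2"
  shows "[Legendre a p = a ^ nat ((p - 1) div 2)] (mod p)"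
proof -
  have "prime (nat p)" "2 < nat p" "int (nat p) = p" using assms by (auto simp: prime_nat_iff_prime)
  moreover have "(nat p - 1) div 2 = nat ((p - 1) div 2)" using assms by simp
  ultimately show ?thesis using euler_criterion[of "nat p" a] by metis
qed

lemma Legendre_values: "Legendre a p \<in> {0, 1, -1}"
  unfolding Legendre_def by auto

lemma Legendre_eqI:
  assumes "(p :: int) > 2" "[Legendre a p = x] (mod p)" "x \<in> {0, 1, -1}"
  shows "Legendre a p = x"
proof -
  have "p dvd Legendre a p - x" using assms(2) by (simp add: cong_iff_dvd_diff)
  moreover have "\<bar>Legendre a p - x\<bar> < p" using Legendre_values[of a p] assms(1,3) by auto
  ultimately show ?thesis using zdvd_imp_le[of p "\<bar>Legendre a p - x\<bar>"] by fastforce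
qed

lemma Legendre_mult:
  assumes "prime p" "p > 2"
  shows "Legendre (a * b) p = Legendre a p * Legendre b p"
proof (rule Legendre_eqI)
  have "[Legendre (a * b) p = (a * b) ^ nat ((p - 1) div 2)] (mod p)" by (rule Legendre_euler[OF assms])
  also have "(a * b) ^ nat ((p - 1) div 2) = a ^ nat ((p - 1) div 2) * b ^ nat ((p - 1) div 2)"
    by (rule power_mult_distrib)
  also have "[\<dots> = Legendre a p * Legendre b p] (mod p)"
    by (intro cong_mult cong_sym[OF Legendre_euler[OF assms]])
  finally show "[Legendre (a * b) p = Legendre a p * Legendre b p] (mod p)" .
  show "Legendre a p * Legendre b p \<in> {0, 1, -1}"
    using Legendre_values[of a p] Legendre_values[of b p] by auto
qed (fact assms(2))

lemma Legendre_unit: "\<not> p dvd a \<Longrightarrow> Legendre a p \<in> {1, -1}"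
  unfolding Legendre_def by (simp add: cong_0_iff)

lemma Legendre_minus_one:
  assumes "prime p" "[p = 1] (mod 4)"
  shows "p > 2" "Legendre (-1) p = 1"
proof -
  have "p > 1" using prime_gt_1_int[OF assms(1)] .
  moreover have m: "p mod 4 = 1" using assms(2) by (simp add: cong_def)
  ultimately show "p > 2" by presburger
  have "even (nat ((p - 1) div 2))" using m \<open>p > 1\<close> by (simp add: even_nat_iff) presburger
  thus "Legendre (-1) p = 1" using Legendre_euler[OF assms(1) \<open>p > 2\<close>, of "-1"] \<open>p > 2\<close>
    by (intro Legendre_eqI) auto
qed

lemma Legendre_square:
  assumes "\<not> p dvd y" "p dvd x\<^sup>2 - n * y\<^sup>2" "prime p" "p > 2" "\<not> p dvd n"
  shows "Legendre n p = 1"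
proof -
  have "Legendre (n * y\<^sup>2) p = 1"
  proof -
    have "\<not> p dvd n * y\<^sup>2" using assms by (metis prime_dvd_mult_iff prime_dvd_power)
    moreover have "[x\<^sup>2 = n * y\<^sup>2] (mod p)" using assms(2) by (simp add: cong_iff_dvd_diff)
    hence "QuadRes p (n * y\<^sup>2)" unfolding QuadRes_def by blast
    ultimately show ?thesis unfolding Legendre_def by (simp add: cong_0_iff)
  qed
  moreover have "Legendre (y\<^sup>2) p = 1"
    using Legendre_mult[OF assms(3,4), of y y] Legendre_unit[OF assms(1)] by (auto simp: power2_eq_square)
  ultimately show ?thesis using Legendre_mult[OF assms(3,4), of n "y\<^sup>2"] by simp
qed

lemma Legendre_sqrt_minus_one:
  assumes "prime p" "p > 2" "p dvd r\<^sup>2 + 1"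
  shows "Legendre r p = Legendre 2 p"
proof -
  have n1: "\<not> p dvd r"
  proof
    assume "p dvd r"
    hence "p dvd (r\<^sup>2 + 1) - r * r" using assms(3) by (intro dvd_diff) auto
    thus False using assms(2) by (simp add: power2_eq_square)
  qed
  have n2: "\<not> p dvd 2" using assms(2) zdvd_imp_le by fastforce
  have "\<not> p dvd 1 + r"
  proof
    assume "p dvd 1 + r"
    hence "p dvd (r\<^sup>2 + 1) - (1 + r) * (r - 1)" using assms(3) by (intro dvd_diff dvd_mult2) auto
    moreover have "(r\<^sup>2 + 1) - (1 + r) * (r - 1) = 2" by (simp add: power2_eq_square algebra_simps)
    ultimately show False using n2 by simp
  qed
  moreover have "(1 + r)\<^sup>2 - (2 * r) * 1\<^sup>2 = r\<^sup>2 + 1" by (simp add: power2_eq_square algebra_simps)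
  moreover have "\<not> p dvd 2 * r" using n1 n2 assms(1) by (simp add: prime_dvd_mult_iff)
  ultimately have "Legendre (2 * r) p = 1"
    using Legendre_square[of p 1 "1 + r" "2 * r"] assms by (simp add: zdvd_not_zless)
  thus ?thesis using Legendre_mult[OF assms(1,2), of 2 r] Legendre_unit[OF n1] Legendre_unit[OF n2] by auto
qed

lemma Legendre_swap:
  assumes "prime p" "[p = 1] (mod 4)" "prime q" "[q = 1] (mod 4)" "p \<noteq> q"
  shows "Legendre p q = Legendre q p"
proof -
  have pq: "p > 2" "q > 2" using Legendre_minus_one assms by auto
  have "even ((p - 1) div 2)" using assms(2) pq(1) unfolding cong_def by presburger
  moreover have "(p - 1) div 2 \<ge> 0" "(q - 1) div 2 \<ge> 0" using pq by auto
  ultimately have ev: "even (nat ((p - 1) div 2 * ((q - 1) div 2)))" by (simp add: even_nat_iff)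
  have "Legendre p q * Legendre q p = 1"
    using Quadratic_Reciprocity_int[of p q] assms pq ev by (simp add: prime_nat_iff_prime)
  thus ?thesis using Legendre_values[of p q] Legendre_values[of q p] by auto
qed

section \<open>Local conditions at split primes\<close>

lemma exists_gprime:
  assumes "prime p" "[p = 1] (mod 4)"
  obtains \<pi> where "gprime \<pi>" "gnorm \<pi> = p"
proof -
  have p2: "p > 2" and L: "Legendre (-1) p = 1" using Legendre_minus_one[OF assms] by auto
  have "QuadRes p (-1)" using L unfolding Legendre_def by (auto split: if_splits)
  then obtain r where "[r\<^sup>2 = -1] (mod p)" unfolding QuadRes_def by auto
  then obtain t where t: "r\<^sup>2 + 1 = p * t" by (auto simp: cong_iff_dvd_diff)
  define w where "w = of_int r - \<i>"
  have w: "w \<in> gauss" unfolding w_def by auto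
  have ww: "w * cnj w = of_int p * of_int t"
  proof -
    have "w * cnj w = of_int (r\<^sup>2 + 1)" by (simp add: w_def algebra_simps power2_eq_square)
    thus ?thesis unfolding t by simp
  qed
  obtain g p' w' u v where g: "g \<in> gauss" "p' \<in> gauss" "w' \<in> gauss" "u \<in> gauss" "v \<in> gauss"
    "g \<noteq> 0" "of_int p = g * p'" "w = g * w'" "u * p' + v * w' = 1"
  proof -
    have "(of_int p :: complex) \<noteq> 0" using p2 by simp
    from gauss_bezout[OF gauss_of_int w this] show ?thesis using that by blast
  qed
  have notdvd: "of_int p * z \<noteq> of_int r - \<i> \<and> of_int p * z \<noteq> of_int r + \<i>" if zg: "z \<in> gauss" for z
  proof -
    obtain a b where z: "z = of_int a + \<i> * of_int b" using zg by (rule gauss_cases)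
    have "p * b \<noteq> 1" "p * b \<noteq> -1"
      using p2 zmult_eq_1_iff[of p b] zmult_eq_1_iff[of p "- b"] by auto
    hence "real_of_int (p * b) \<noteq> of_int 1" "real_of_int (p * b) \<noteq> of_int (-1)"
      unfolding of_int_eq_iff by auto
    thus ?thesis by (auto simp: z complex_eq_iff)
  qed
  have "gnorm g * gnorm p' = p\<^sup>2" using g(1,2,7) gnorm_mult[of g p'] gnorm_of_int[of p] by simp
  moreover have "gnorm g \<noteq> 1"
  proof
    assume g1: "gnorm g = 1"
    have "cnj w = cnj w * (u * p' + v * w') * (cnj g * g)" using gnorm_1_inverse[OF g(1) g1] g(9) by simp
    also have "\<dots> = cnj w * u * cnj g * of_int p + v * cnj g * (w * cnj w)"
      unfolding g(7,8) by (simp add: algebra_simps)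
    also have "\<dots> = of_int p * (cnj w * u * cnj g + v * cnj g * of_int t)"
      unfolding ww by (simp add: algebra_simps)
    finally have "cnj w = of_int p * (cnj w * u * cnj g + v * cnj g * of_int t)" .
    moreover have "cnj w * u * cnj g + v * cnj g * of_int t \<in> gauss"
      using w g by (intro gauss_add gauss_mult gauss_cnj gauss_of_int)
    moreover have "cnj w = of_int r + \<i>" by (simp add: w_def)
    ultimately show False using notdvd[of "cnj w * u * cnj g + v * cnj g * of_int t"] by simp
  qed
  moreover have "gnorm p' \<noteq> 1"
  proof
    assume p1: "gnorm p' = 1"
    have "w = of_int p * (cnj p' * w')" using gnorm_1_inverse[OF g(2) p1] g(7,8) by (simp add: algebra_simps)
    thus False using notdvd[of "cnj p' * w'"] g unfolding w_def by auto
  qed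
  ultimately have "gnorm g = p"
  proof -
    assume pp: "gnorm g * gnorm p' = p\<^sup>2" and g1: "gnorm g \<noteq> 1" and p1: "gnorm p' \<noteq> 1"
    have "p dvd gnorm g * gnorm p'" unfolding pp by simp
    hence "p dvd gnorm g \<or> p dvd gnorm p'" using assms(1) prime_dvd_mult_iff by blast
    thus "gnorm g = p"
    proof
      assume "p dvd gnorm g"
      then obtain k where k: "gnorm g = p * k" by auto
      hence "k * gnorm p' = p" using pp p2 by (simp add: power2_eq_square)
      moreover have "k \<ge> 0" using k p2 gnorm_nonneg[of g] by (simp add: zero_le_mult_iff)
      ultimately show ?thesis
        using prime_int_mult_cases[of k "gnorm p'"] assms(1) gnorm_nonneg p1 k by auto
    next
      assume "p dvd gnorm p'"
      then obtain k where k: "gnorm p' = p * k" by auto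
      hence gk: "gnorm g * k = p" using pp p2 by (simp add: power2_eq_square)
      moreover have "k \<ge> 0" using k p2 gnorm_nonneg[of p'] by (simp add: zero_le_mult_iff)
      ultimately show ?thesis
        using prime_int_mult_cases[of "gnorm g" k] assms(1) gnorm_nonneg g1 by auto
    qed
  qed
  thus ?thesis using that g(1) assms(1) unfolding gprime_def by auto
qed

lemma gprime_of_int_dvd:
  assumes "gprime \<pi>" "gnorm \<pi> = p"
  shows "gdvd \<pi> (of_int n) \<longleftrightarrow> p dvd n"
proof
  assume "gdvd \<pi> (of_int n)"
  hence "p dvd n\<^sup>2" using gdvd_gnorm[of \<pi> "of_int n"] assms unfolding gprime_def by auto
  thus "p dvd n" using assms prime_dvd_power unfolding gprime_def by blast
next
  assume "p dvd n"
  then obtain m where "n = p * m" by auto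
  hence "of_int n = \<pi> * (cnj \<pi> * of_int m)"
    using assms gnorm_cnj_mult[of \<pi>] unfolding gprime_def by (auto simp: mult.assoc)
  thus "gdvd \<pi> (of_int n)" unfolding gdvd_def using assms unfolding gprime_def
    by (metis gauss_cnj gauss_mult gauss_of_int)
qed

lemma gprime_cnj: "gprime \<pi> \<Longrightarrow> gprime (cnj \<pi>)"
  unfolding gprime_def by auto

lemma gprime_residue_ii:
  assumes "gprime \<pi>" "gnorm \<pi> = p"
  obtains r where "gdvd \<pi> (\<i> - of_int r)" "p dvd r\<^sup>2 + 1"
proof -
  have pi: "\<pi> \<in> gauss" "prime p" using assms unfolding gprime_def by auto
  obtain a b where ab: "\<pi> = of_int a + \<i> * of_int b" using pi(1) by (rule gauss_cases)
  have "real_of_int (gnorm \<pi>) = of_int (a\<^sup>2 + b\<^sup>2)" using gnorm_eq[OF pi(1)] by (simp add: ab cmod_power2)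
  hence p: "p = a\<^sup>2 + b\<^sup>2" using assms(2) by (simp only: of_int_eq_iff)
  have "\<not> p dvd b"
  proof
    assume b: "p dvd b"
    have "a\<^sup>2 = p - b * b" using p by (simp add: power2_eq_square)
    hence "p dvd a\<^sup>2" using b by auto
    hence "p dvd a" using pi(2) prime_dvd_power by blast
    hence "p\<^sup>2 dvd a\<^sup>2 + b\<^sup>2" using b by (intro dvd_add) (auto intro: dvd_power_same)
    hence "p * p dvd p * 1" using p by (simp add: power2_eq_square)
    hence "p dvd 1" using pi(2) by (metis dvd_mult_cancel_left not_prime_0)
    thus False using pi(2) not_prime_unit by blast
  qed
  hence "coprime b p" using pi(2) by (metis coprime_commute prime_imp_coprime)
  then obtain b' where "[b * b' = 1] (mod p)" using cong_solve_coprime_int by blast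
  then obtain t where t: "b * b' - 1 = p * t" by (auto simp: cong_iff_dvd_diff)
  define r where "r = - (a * b')"
  have p': "of_int p = \<pi> * cnj \<pi>" using gnorm_cnj_mult[OF pi(1)] assms(2) by simp
  have "\<pi> * of_int b' - \<i> * (of_int p * of_int t) = of_int (a * b') + \<i> * of_int (b * b' - p * t)"
    by (simp add: ab algebra_simps)
  also have "b * b' - p * t = 1" using t by simp
  finally have "\<i> - of_int r = \<pi> * (of_int b' - \<i> * (cnj \<pi> * of_int t))"
    unfolding r_def p' by (simp add: algebra_simps)
  moreover have "of_int b' - \<i> * (cnj \<pi> * of_int t) \<in> gauss" using pi by auto
  ultimately have 1: "gdvd \<pi> (\<i> - of_int r)" unfolding gdvd_def by blast
  have "gdvd \<pi> ((- \<i> - of_int r) * (\<i> - of_int r))" by (rule gdvd_mult_left[OF 1]) auto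
  moreover have "(- \<i> - of_int r) * (\<i> - of_int r) = of_int (r\<^sup>2 + 1)"
    by (simp add: algebra_simps power2_eq_square)
  ultimately have "p dvd r\<^sup>2 + 1" using gprime_of_int_dvd[OF assms] by metis
  thus ?thesis using that 1 by blast
qed

lemma gprime_residue:
  assumes "gprime \<pi>" "x \<in> gauss"
  obtains n :: int where "gdvd \<pi> (x - of_int n)"
proof -
  obtain r where r: "gdvd \<pi> (\<i> - of_int r)" using gprime_residue_ii[OF assms(1) refl] by blast
  obtain a b where x: "x = of_int a + \<i> * of_int b" using assms(2) by (rule gauss_cases)
  have "gdvd \<pi> (of_int b * (\<i> - of_int r))" using r by (rule gdvd_mult_left) auto
  moreover have "of_int b * (\<i> - of_int r) = x - of_int (a + b * r)" by (simp add: x algebra_simps)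
  ultimately show ?thesis using that by metis
qed

lemma gprime_not_dvd_cnj:
  assumes "gprime \<pi>" "gnorm \<pi> > 2"
  shows "\<not> gdvd \<pi> (cnj \<pi>)"
proof
  assume *: "gdvd \<pi> (cnj \<pi>)"
  obtain r where r: "gdvd \<pi> (\<i> - of_int r)" using gprime_residue_ii[OF assms(1) refl] by blast
  then obtain c where c: "c \<in> gauss" "\<i> - of_int r = \<pi> * c" unfolding gdvd_def by auto
  have "- \<i> - of_int r = cnj (\<i> - of_int r)" by simp
  also have "\<dots> = cnj c * cnj \<pi>" by (simp add: c(2))
  finally have "gdvd \<pi> (- \<i> - of_int r)" using gdvd_mult_left[OF *, of "cnj c"] c(1) by auto
  from gdvd_diff[OF r this] have "gdvd \<pi> (2 * \<i>)" by simp
  hence "gdvd \<pi> (- \<i> * (2 * \<i>))" by (rule gdvd_mult_left) auto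
  also have "- \<i> * (2 * \<i>) = of_int 2" by (simp add: complex_eq_iff)
  finally have "gdvd \<pi> (of_int 2)" .
  hence "gnorm \<pi> dvd 2" using gprime_of_int_dvd[OF assms(1) refl] by blast
  thus False using assms(2) zdvd_imp_le by fastforce
qed

lemma gauss_local_solution:
  assumes pi: "gprime \<pi>" and D: "D' \<in> gauss" "\<not> gdvd \<pi> D'" and e: "e \<in> gauss"
    and XYZ: "X \<in> gauss" "Y \<in> gauss" "Z \<in> gauss" "Z \<noteq> 0"
    and eq: "X\<^sup>2 - \<pi> * D' * Y\<^sup>2 = e * Z\<^sup>2"
  shows "\<exists>x\<in>gauss. \<exists>y\<in>gauss. \<not> gdvd \<pi> y \<and> gdvd \<pi> (x\<^sup>2 - e * y\<^sup>2)"
  using XYZ eq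
proof (induction "nat (gnorm Z)" arbitrary: X Y Z rule: less_induct)
  case less
  have piD: "\<pi> \<in> gauss" "\<pi> \<noteq> 0" using pi gprime_nonzero unfolding gprime_def by auto
  show ?case
  proof (cases "gdvd \<pi> Z")
    case False
    have "X\<^sup>2 - e * Z\<^sup>2 = \<pi> * (D' * Y\<^sup>2)" using less.prems(5) by (simp add: algebra_simps)
    hence "gdvd \<pi> (X\<^sup>2 - e * Z\<^sup>2)" unfolding gdvd_def using D less.prems by blast
    thus ?thesis using False less.prems by blast
  next
    case True
    then obtain Z' where Z: "Z' \<in> gauss" "Z = \<pi> * Z'" unfolding gdvd_def by auto
    have "X\<^sup>2 = \<pi> * (D' * Y\<^sup>2 + e * \<pi> * Z'\<^sup>2)" using less.prems(5) Z by (simp add: algebra_simps power2_eq_square)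
    moreover have "D' * Y\<^sup>2 + e * \<pi> * Z'\<^sup>2 \<in> gauss"
      using D e piD Z less.prems by (intro gauss_add gauss_mult gauss_power)
    ultimately have "gdvd \<pi> (X\<^sup>2)" unfolding gdvd_def by blast
    then obtain X' where X: "X' \<in> gauss" "X = \<pi> * X'"
      using gprime_dvd_power2D[OF pi] less.prems unfolding gdvd_def by blast
    have "\<pi> * (D' * Y\<^sup>2) = \<pi> * (\<pi> * (X'\<^sup>2 - e * Z'\<^sup>2))"
      using less.prems(5) Z X by (simp add: algebra_simps power2_eq_square)
    hence "D' * Y\<^sup>2 = \<pi> * (X'\<^sup>2 - e * Z'\<^sup>2)" using piD by simp
    moreover have "X'\<^sup>2 - e * Z'\<^sup>2 \<in> gauss" using e Z X by (intro gauss_diff gauss_mult gauss_power)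
    ultimately have "gdvd \<pi> (D' * Y\<^sup>2)" unfolding gdvd_def by blast
    hence "gdvd \<pi> (Y\<^sup>2)" using gprime_dvd_multD[OF pi D(1), of "Y\<^sup>2"] D less.prems by blast
    then obtain Y' where Y: "Y' \<in> gauss" "Y = \<pi> * Y'"
      using gprime_dvd_power2D[OF pi] less.prems unfolding gdvd_def by blast
    have "\<pi>\<^sup>2 * (X'\<^sup>2 - \<pi> * D' * Y'\<^sup>2) = \<pi>\<^sup>2 * (e * Z'\<^sup>2)"
      using less.prems(5) X Y Z by (simp add: algebra_simps power2_eq_square)
    hence eq': "X'\<^sup>2 - \<pi> * D' * Y'\<^sup>2 = e * Z'\<^sup>2" using piD by simp
    have "Z' \<noteq> 0" using Z less.prems by auto
    hence "gnorm Z' > 0" using gnorm_pos Z by blast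
    moreover have "gnorm \<pi> > 1" using pi prime_gt_1_int unfolding gprime_def by blast
    moreover have "gnorm Z = gnorm \<pi> * gnorm Z'" using Z gnorm_mult piD by simp
    ultimately have "nat (gnorm Z') < nat (gnorm Z)" by simp
    from less.hyps[OF this X(1) Y(1) Z(1) \<open>Z' \<noteq> 0\<close> eq'] show ?thesis .
  qed
qed

lemma gauss_local_Legendre:
  assumes pi: "gprime \<pi>" "gnorm \<pi> = p" "p > 2"
    and D: "D = p * D'" "\<not> p dvd D'"
    and e: "e \<in> gauss" "gdvd \<pi> (e - of_int n)" "\<not> p dvd n"
    and XYZ: "X \<in> gauss" "Y \<in> gauss" "Z \<in> gauss" "Z \<noteq> 0"
    and eq: "X\<^sup>2 - of_int D * Y\<^sup>2 = e * Z\<^sup>2"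
  shows "Legendre n p = 1"
proof -
  have pg: "\<pi> \<in> gauss" "prime p" using pi unfolding gprime_def by auto
  define D1 where "D1 = cnj \<pi> * of_int D'"
  have D1: "D1 \<in> gauss" "of_int D = \<pi> * D1"
    using pg gnorm_cnj_mult[OF pg(1)] pi(2) by (auto simp: D1_def D)
  have "\<not> gdvd \<pi> D1"
    using gprime_dvd_multD[OF pi(1), of "cnj \<pi>" "of_int D'"] gprime_not_dvd_cnj[OF pi(1)] pi D
      gprime_of_int_dvd[OF pi(1,2)] pg unfolding D1_def by auto
  then obtain x y where xy: "x \<in> gauss" "y \<in> gauss" "\<not> gdvd \<pi> y" "gdvd \<pi> (x\<^sup>2 - e * y\<^sup>2)"
    using gauss_local_solution[OF pi(1) D1(1) _ e(1) XYZ] eq D1(2) by metis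
  obtain a where a: "gdvd \<pi> (x - of_int a)" using gprime_residue[OF pi(1) xy(1)] by blast
  obtain b where b: "gdvd \<pi> (y - of_int b)" using gprime_residue[OF pi(1) xy(2)] by blast
  have "of_int (a\<^sup>2 - n * b\<^sup>2) = (x\<^sup>2 - e * y\<^sup>2) - (x + of_int a) * (x - of_int a)
      + (e * (y + of_int b)) * (y - of_int b) + (of_int b)\<^sup>2 * (e - of_int n)"
    by (simp add: power2_eq_square algebra_simps)
  also have "gdvd \<pi> \<dots>"
  proof (intro gdvd_add gdvd_diff[OF xy(4)])
    show "gdvd \<pi> ((x + of_int a) * (x - of_int a))" using xy by (intro gdvd_mult_left[OF a]) auto
    show "gdvd \<pi> ((e * (y + of_int b)) * (y - of_int b))" using xy e by (intro gdvd_mult_left[OF b]) auto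
    show "gdvd \<pi> ((of_int b)\<^sup>2 * (e - of_int n))" by (intro gdvd_mult_left[OF e(2)]) auto
  qed
  finally have "p dvd a\<^sup>2 - n * b\<^sup>2" using gprime_of_int_dvd[OF pi(1,2)] by blast
  moreover have "\<not> p dvd b"
  proof
    assume "p dvd b"
    hence "gdvd \<pi> (of_int b)" using gprime_of_int_dvd[OF pi(1,2)] by simp
    from gdvd_add[OF b this] show False using xy(3) by simp
  qed
  ultimately show ?thesis using Legendre_square pg(2) pi(3) e(3) by blast
qed

lemma gauss_local_Legendre_ramified:
  assumes pi: "gprime \<pi>" "gnorm \<pi> = p" "p > 2"
    and D: "D = p * D'" "\<not> p dvd D'"
    and e: "e \<in> gauss" "gdvd \<pi> (e - of_int n)" "\<not> p dvd n"
    and XYZ: "X \<in> gauss" "Y \<in> gauss" "Z \<in> gauss" "Z \<noteq> 0"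
    and eq: "X\<^sup>2 - of_int D * Y\<^sup>2 = of_int p * e * Z\<^sup>2"
  shows "Legendre (- (D' * n)) p = 1"
proof -
  have pg: "\<pi> \<in> gauss" "prime p" "p \<noteq> 0" using pi unfolding gprime_def by auto
  have p': "of_int p = \<pi> * cnj \<pi>" using gnorm_cnj_mult[OF pg(1)] pi(2) by simp
  have X2: "X\<^sup>2 = of_int p * (of_int D' * Y\<^sup>2 + e * Z\<^sup>2)" using eq D by (simp add: algebra_simps)
  have in_g: "of_int D' * Y\<^sup>2 + e * Z\<^sup>2 \<in> gauss" using XYZ e by (intro gauss_add gauss_mult gauss_power) auto
  have "X\<^sup>2 = \<pi> * (cnj \<pi> * (of_int D' * Y\<^sup>2 + e * Z\<^sup>2))" using X2 p' by (simp add: mult.assoc)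
  moreover have "cnj \<pi> * (of_int D' * Y\<^sup>2 + e * Z\<^sup>2) \<in> gauss" using in_g pg by (intro gauss_mult) auto
  ultimately have "gdvd \<pi> (X\<^sup>2)" unfolding gdvd_def by blast
  then obtain X1 where X1: "X1 \<in> gauss" "X = \<pi> * X1"
    using gprime_dvd_power2D[OF pi(1) XYZ(1)] unfolding gdvd_def by blast
  have "X\<^sup>2 = cnj \<pi> * (\<pi> * (of_int D' * Y\<^sup>2 + e * Z\<^sup>2))" using X2 p' by (simp add: mult_ac)
  moreover have "\<pi> * (of_int D' * Y\<^sup>2 + e * Z\<^sup>2) \<in> gauss" using in_g pg by (intro gauss_mult) auto
  ultimately have "gdvd (cnj \<pi>) (X\<^sup>2)" unfolding gdvd_def by blast
  hence "gdvd (cnj \<pi>) (\<pi> * X1)" using gprime_dvd_power2D[OF gprime_cnj[OF pi(1)] XYZ(1)] X1 by simp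
  hence "gdvd (cnj \<pi>) X1"
    using gprime_dvd_multD[OF gprime_cnj[OF pi(1)] pg(1) X1(1)]
      gprime_not_dvd_cnj[OF gprime_cnj[OF pi(1)]] pi by auto
  then obtain X2 where X2': "X2 \<in> gauss" "X1 = cnj \<pi> * X2" unfolding gdvd_def by auto
  have X: "X = of_int p * X2" using X1 X2' p' by simp
  have "of_int p * (of_int p * X2\<^sup>2) = of_int p * (of_int D' * Y\<^sup>2 + e * Z\<^sup>2)"
    using X2 X by (simp add: power2_eq_square algebra_simps)
  hence *: "of_int p * X2\<^sup>2 = of_int D' * Y\<^sup>2 + e * Z\<^sup>2" using pg(3) by simp
  have "(of_int D' * Y)\<^sup>2 - of_int D * X2\<^sup>2 = of_int D' * (of_int D' * Y\<^sup>2 - of_int p * X2\<^sup>2)"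
    by (simp add: D power2_eq_square algebra_simps)
  also have "\<dots> = (- of_int D' * e) * Z\<^sup>2" unfolding * by (simp add: algebra_simps)
  finally have eq': "(of_int D' * Y)\<^sup>2 - of_int D * X2\<^sup>2 = (- of_int D' * e) * Z\<^sup>2" .
  have "gdvd \<pi> (- of_int D' * (e - of_int n))" using e(2) by (rule gdvd_mult_left) auto
  hence "gdvd \<pi> (- of_int D' * e - of_int (- (D' * n)))" by (simp add: algebra_simps)
  moreover have "\<not> p dvd - (D' * n)" using D e(3) pg by (simp add: prime_dvd_mult_iff)
  ultimately show ?thesis
    using gauss_local_Legendre[OF pi D, of "- of_int D' * e" "- (D' * n)", OF _ _ _ _ X2'(1) XYZ(3,4) eq'] e XYZ
    by auto
qed

lemma gauss_unit_residue:
  assumes pi: "gprime \<pi>" "gnorm \<pi> = p" "[p = 1] (mod 4)" and v: "v \<in> {1, -1, \<i>, -\<i>}"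
  obtains n where "gdvd \<pi> (v - of_int n)" "\<not> p dvd n"
    "Legendre n p = (if v \<in> {1, -1} then 1 else Legendre 2 p)"
proof -
  have pp: "prime p" using pi unfolding gprime_def by auto
  have p2: "p > 2" and L1: "Legendre (-1) p = 1" using Legendre_minus_one[OF pp pi(3)] by auto
  have n1: "\<not> p dvd 1" using p2 by simp
  obtain r where r: "gdvd \<pi> (\<i> - of_int r)" "p dvd r\<^sup>2 + 1" using gprime_residue_ii[OF pi(1,2)] .
  have Lr: "Legendre r p = Legendre 2 p" by (rule Legendre_sqrt_minus_one[OF pp p2 r(2)])
  have nr: "\<not> p dvd r"
  proof
    assume "p dvd r"
    hence "p dvd (r\<^sup>2 + 1) - r * r" using r(2) by (intro dvd_diff) auto
    thus False using n1 by (simp add: power2_eq_square)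
  qed
  have "Legendre 1 p = 1" using Legendre_square[of p 1 1 1] pp p2 n1 by simp
  have 0: "gdvd \<pi> 0" unfolding gdvd_def by (intro bexI[of _ 0]) auto
  consider "v = 1" | "v = -1" | "v = \<i>" | "v = -\<i>" using v by auto
  thus ?thesis
  proof cases
    case 1
    thus ?thesis using that[of 1] 0 n1 \<open>Legendre 1 p = 1\<close> by simp
  next
    case 2
    thus ?thesis using that[of "-1"] 0 n1 L1 by simp
  next
    case 3
    hence "v \<notin> {1, -1}" by (auto simp: complex_eq_iff)
    thus ?thesis using that[of r] r(1) nr Lr unfolding 3 by simp
  next
    case 4
    have "gdvd \<pi> ((-1) * (\<i> - of_int r))" using r(1) by (rule gdvd_mult_left) auto
    also have "(-1) * (\<i> - of_int r) = -\<i> - of_int (- r)" by simp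
    finally have "gdvd \<pi> (-\<i> - of_int (- r))" .
    moreover have "v \<notin> {1, -1}" using 4 by (auto simp: complex_eq_iff)
    moreover have "Legendre (- r) p = Legendre 2 p"
      using Legendre_mult[OF pp p2, of "-1" r] L1 Lr by simp
    ultimately show ?thesis using that[of "- r"] nr unfolding 4 by simp
  qed
qed

locale symbol_primes =
  fixes p1 p2 :: int
  assumes prime1: "prime p1" and prime2: "prime p2"
    and cong1: "[p1 = 1] (mod 4)" and cong2: "[p2 = 1] (mod 4)"
    and neq: "p1 \<noteq> p2"
    and symbols: "(Legendre p1 p2 = -1 \<and> Legendre 2 p1 = -1) \<or>
         (Legendre p1 p2 = -1 \<and> Legendre 2 p2 = -1) \<or>
         (Legendre 2 p1 = -1 \<and> Legendre 2 p2 = -1)"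
begin

lemma gt2: "p1 > 2" "p2 > 2"
  using Legendre_minus_one prime1 prime2 cong1 cong2 by auto

lemma swap: "Legendre p2 p1 = Legendre p1 p2"
  using Legendre_swap[OF prime2 cong2 prime1 cong1] neq by simp

lemma not_dvd: "\<not> p1 dvd 2" "\<not> p2 dvd 2" "\<not> p1 dvd p2" "\<not> p2 dvd p1"
  using gt2 zdvd_imp_le[of p1 2] zdvd_imp_le[of p2 2] neq
    primes_dvd_imp_eq[OF prime1 prime2] primes_dvd_imp_eq[OF prime2 prime1]
  by auto

lemma Legendre_pm: "Legendre 2 p1 \<in> {1, -1}" "Legendre 2 p2 \<in> {1, -1}" "Legendre p1 p2 \<in> {1, -1}"
  using Legendre_unit not_dvd by auto

lemmas Legendre_mult1 = Legendre_mult[OF prime1 gt2(1)]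

lemma Legendre_power1: "\<not> p1 dvd a \<Longrightarrow> Legendre (a ^ k) p1 = Legendre a p1 ^ k"
proof (induction k)
  case 0
  have "\<not> p1 dvd 1" using prime1 not_prime_unit by blast
  thus ?case using Legendre_square[of p1 1 1 1] prime1 gt2 by simp
qed (simp add: Legendre_mult1)

lemma Legendre_1: "Legendre 1 p1 = 1"
  using Legendre_power1[of 2 0] not_dvd by simp

lemma norm_symbol:
  assumes v: "v \<in> {1, -1, \<i>, -\<i>}" and m: "\<not> p1 dvd m"
    and XYZ: "X \<in> gauss" "Y \<in> gauss" "Z \<in> gauss" "Z \<noteq> 0"
  shows "X\<^sup>2 - of_int (2 * p1 * p2) * Y\<^sup>2 = of_int m * v * Z\<^sup>2 \<Longrightarrow>
      Legendre m p1 * (if v \<in> {1, -1} then 1 else Legendre 2 p1) = 1" (is "?eq \<Longrightarrow> _")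
    and "X\<^sup>2 - of_int (2 * p1 * p2) * Y\<^sup>2 = of_int p1 * (of_int m * v) * Z\<^sup>2 \<Longrightarrow>
      Legendre 2 p1 * Legendre p1 p2 * Legendre m p1 * (if v \<in> {1, -1} then 1 else Legendre 2 p1) = 1"
      (is "?eq' \<Longrightarrow> _")
proof -
  obtain \<pi> where pi: "gprime \<pi>" "gnorm \<pi> = p1" using exists_gprime[OF prime1 cong1] .
  obtain n where n: "gdvd \<pi> (v - of_int n)" "\<not> p1 dvd n"
    "Legendre n p1 = (if v \<in> {1, -1} then 1 else Legendre 2 p1)"
    using gauss_unit_residue[OF pi cong1 v] .
  have D: "2 * p1 * p2 = p1 * (2 * p2)" "\<not> p1 dvd 2 * p2"
    using not_dvd prime1 by (auto simp: prime_dvd_mult_iff)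
  have mv: "of_int m * v \<in> gauss" using v by auto
  have "gdvd \<pi> (of_int m * (v - of_int n))" using n(1) by (rule gdvd_mult_left) auto
  hence g: "gdvd \<pi> (of_int m * v - of_int (m * n))" by (simp add: algebra_simps)
  have mn: "\<not> p1 dvd m * n" using n(2) m prime1 by (simp add: prime_dvd_mult_iff)
  {
    assume ?eq
    from gauss_local_Legendre[OF pi gt2(1) D mv g mn XYZ this]
    show "Legendre m p1 * (if v \<in> {1, -1} then 1 else Legendre 2 p1) = 1"
      unfolding Legendre_mult1 n(3) .
  }
  {
    assume ?eq'
    from gauss_local_Legendre_ramified[OF pi gt2(1) D mv g mn XYZ this]
    have "Legendre ((-1) * (2 * p2 * (m * n))) p1 = 1" by simp
    thus "Legendre 2 p1 * Legendre p1 p2 * Legendre m p1 *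
        (if v \<in> {1, -1} then 1 else Legendre 2 p1) = 1"
      unfolding Legendre_mult1 n(3) swap using Legendre_minus_one(2)[OF prime1 cong1]
      by (simp add: mult.assoc)
  }
qed

lemma not_dvd_1: "\<not> p1 dvd 1"
  using prime1 not_prime_unit by blast

lemma norm_int_symbol:
  fixes X Y Z :: int and a b c :: nat
  assumes abc: "b \<le> 1" and Z: "Z \<noteq> 0"
    and eq: "X\<^sup>2 - 2 * p1 * p2 * Y\<^sup>2 = 2 ^ a * p1 ^ b * p2 ^ c * Z\<^sup>2"
  shows "(Legendre 2 p1 * Legendre p1 p2) ^ b * Legendre 2 p1 ^ a * Legendre p1 p2 ^ c = 1"
proof -
  define m where "m = 2 ^ a * p2 ^ c"
  have m: "\<not> p1 dvd m" unfolding m_def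
    using not_dvd prime1 by (auto simp: prime_dvd_mult_iff dest: prime_dvd_power)
  have Lm: "Legendre m p1 = Legendre 2 p1 ^ a * Legendre p1 p2 ^ c"
    unfolding m_def Legendre_mult1 using Legendre_power1 not_dvd swap by simp
  have XYZ: "(of_int X :: complex) \<in> gauss" "(of_int Y :: complex) \<in> gauss"
    "(of_int Z :: complex) \<in> gauss" "(of_int Z :: complex) \<noteq> 0" using Z by auto
  have "(of_int X)\<^sup>2 - of_int (2 * p1 * p2) * (of_int Y)\<^sup>2 =
      (of_int (p1 ^ b * m * Z\<^sup>2) :: complex)"
    using arg_cong[OF eq, of "of_int :: int \<Rightarrow> complex"] by (simp add: m_def mult_ac)
  moreover have "b = 0 \<or> b = 1" using abc by auto
  ultimately show ?thesis using norm_symbol[OF _ m XYZ, of 1] Lm by (auto simp: mult.assoc)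
qed

lemma symbol_primes_flip: "symbol_primes p2 p1"
  by unfold_locales (use prime1 prime2 cong1 cong2 neq symbols swap in auto)

interpretation flip: symbol_primes p2 p1 by (rule symbol_primes_flip)

lemma norm_unit_cases:
  assumes "v \<in> {1, -1, \<i>, -\<i>}" "X \<in> gauss" "Y \<in> gauss" "Z \<in> gauss" "Z \<noteq> 0"
    and eq: "X\<^sup>2 - of_int (2 * p1 * p2) * Y\<^sup>2 = v * Z\<^sup>2"
  shows "v \<in> {1, -1}"
proof -
  have eq': "X\<^sup>2 - of_int (2 * p1 * p2) * Y\<^sup>2 = of_int 1 * v * Z\<^sup>2"
    "X\<^sup>2 - of_int (2 * p2 * p1) * Y\<^sup>2 = of_int 1 * v * Z\<^sup>2" using eq by (simp_all add: mult_ac)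
  show ?thesis
    using norm_symbol(1)[OF assms(1) not_dvd_1 assms(2-5) eq'(1)]
      flip.norm_symbol(1)[OF assms(1) flip.not_dvd_1 assms(2-5) eq'(2)]
      Legendre_1 flip.Legendre_1 symbols
    by (auto split: if_splits)
qed

lemma not_norm_p1:
  assumes "v \<in> {1, -1, \<i>, -\<i>}" "X \<in> gauss" "Y \<in> gauss" "Z \<in> gauss" "Z \<noteq> 0"
  shows "X\<^sup>2 - of_int (2 * p1 * p2) * Y\<^sup>2 \<noteq> of_int p1 * v * Z\<^sup>2"
proof
  assume eq: "X\<^sup>2 - of_int (2 * p1 * p2) * Y\<^sup>2 = of_int p1 * v * Z\<^sup>2"
  hence eq': "X\<^sup>2 - of_int (2 * p1 * p2) * Y\<^sup>2 = of_int p1 * (of_int 1 * v) * Z\<^sup>2"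
    "X\<^sup>2 - of_int (2 * p2 * p1) * Y\<^sup>2 = of_int p1 * v * Z\<^sup>2" by (simp_all add: mult_ac)
  show False
    using norm_symbol(2)[OF assms(1) not_dvd_1 assms(2-5) eq'(1)]
      flip.norm_symbol(1)[OF assms(1) flip.not_dvd(3) assms(2-5) eq'(2)] Legendre_1 symbols swap
      Legendre_pm by (auto split: if_splits)
qed

lemma norm_int_cases:
  fixes X Y Z :: int and a b c :: nat
  assumes abc: "a \<le> 1" "b \<le> 1" "c \<le> 1" and Z: "Z \<noteq> 0"
    and eq: "X\<^sup>2 - 2 * p1 * p2 * Y\<^sup>2 = 2 ^ a * p1 ^ b * p2 ^ c * Z\<^sup>2"
  shows "a = b \<and> b = c"
proof -
  have eq': "X\<^sup>2 - 2 * p2 * p1 * Y\<^sup>2 = 2 ^ a * p2 ^ c * p1 ^ b * Z\<^sup>2" using eq by (simp add: mult_ac)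
  have "a \<in> {0, 1}" "b \<in> {0, 1}" "c \<in> {0, 1}" using abc by auto
  thus ?thesis
    using norm_int_symbol[OF abc(2) Z eq] flip.norm_int_symbol[OF abc(3) Z eq'] symbols swap Legendre_pm
    by auto
qed

end

section \<open>Pell equations\<close>

lemma dirichlet_approximation:
  fixes \<theta> :: real and N :: nat
  assumes N: "N > 0"
  obtains x y :: int where "0 < y" "y \<le> int N" "\<bar>x - y * \<theta>\<bar> < 1 / N"
proof -
  define f where "f k = nat \<lfloor>frac (real k * \<theta>) * N\<rfloor>" for k :: nat
  have f: "f k < N" for k
  proof -
    have "frac (real k * \<theta>) * N < 1 * real N" using N frac_lt_1 by (intro mult_strict_right_mono) auto
    thus ?thesis unfolding f_def by (simp add: floor_less_iff nat_less_iff)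
  qed
  have "\<not> inj_on f {..N}"
  proof
    assume "inj_on f {..N}"
    hence "card {..N} \<le> card {..<N}" using f by (intro card_inj_on_le[of f]) auto
    thus False by simp
  qed
  then obtain k l where kl: "k < l" "l \<le> N" "f k = f l"
    unfolding inj_on_def by (metis atMost_iff linorder_neqE_nat)
  define u v where "u = frac (real k * \<theta>)" and "v = frac (real l * \<theta>)"
  have "\<lfloor>u * N\<rfloor> = \<lfloor>v * N\<rfloor>" using kl(3) unfolding f_def u_def v_def
    by (simp add: eq_nat_nat_iff frac_ge_0)
  hence "\<bar>u * N - v * N\<bar> < 1" by linarith
  hence "\<bar>u - v\<bar> * N < 1" by (simp add: abs_mult left_diff_distrib[symmetric])
  hence "\<bar>u - v\<bar> < 1 / N" using N by (simp add: field_simps)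
  moreover have "(\<lfloor>real l * \<theta>\<rfloor> - \<lfloor>real k * \<theta>\<rfloor>) - (int l - int k) * \<theta> = u - v"
    by (simp add: u_def v_def frac_def algebra_simps)
  ultimately show ?thesis
    using kl that[of "int l - int k" "\<lfloor>real l * \<theta>\<rfloor> - \<lfloor>real k * \<theta>\<rfloor>"] by simp
qed

text \<open>Dirichlet's argument: infinitely many pairs have a small norm, and the quotient of two of
  them with the same norm and the same residues is a unit.\<close>

lemma pell_solution:
  fixes D :: int
  assumes D: "D > 0" "\<not> (\<exists>r. r\<^sup>2 = D)"
  obtains x y :: int where "x > 0" "y > 0" "x\<^sup>2 - D * y\<^sup>2 = 1"
proof -
  define s where "s = sqrt (of_int D)"
  have s: "s > 0" "s\<^sup>2 = of_int D" using D by (simp_all add: s_def)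
  have nz: "x\<^sup>2 - D * y\<^sup>2 \<noteq> 0" if "y > 0" for x y :: int
  proof
    assume "x\<^sup>2 - D * y\<^sup>2 = 0"
    hence x: "x\<^sup>2 = D * y\<^sup>2" by simp
    hence "y\<^sup>2 dvd x\<^sup>2" by simp
    hence "y dvd x" by simp
    then obtain z where "x = y * z" by auto
    hence "y\<^sup>2 * z\<^sup>2 = y\<^sup>2 * D" using x by (simp add: power_mult_distrib mult.commute)
    hence "z\<^sup>2 = D" using that by simp
    thus False using D(2) by blast
  qed
  define M where "M = \<lceil>2 * s + 1\<rceil>"
  define S where "S = {(x, y). (y :: int) > 0 \<and> \<bar>x\<^sup>2 - D * y\<^sup>2\<bar> \<le> M}"
  have "infinite S"
  proof
    assume fin: "finite S"
    define g where "g = (\<lambda>(x, y). \<bar>of_int x - of_int y * s\<bar>)"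
    have gpos: "g xy > 0" if "xy \<in> S" for xy
    proof -
      obtain x y where xy: "xy = (x, y)" "y > 0" using \<open>xy \<in> S\<close> unfolding S_def by auto
      have "of_int x - of_int y * s \<noteq> 0"
      proof
        assume "of_int x - of_int y * s = 0"
        hence "(of_int x)\<^sup>2 = (of_int y * s)\<^sup>2" by simp
        hence "real_of_int (x\<^sup>2) = of_int (D * y\<^sup>2)" using s by (simp add: power_mult_distrib)
        hence "x\<^sup>2 = D * y\<^sup>2" by (simp only: of_int_eq_iff)
        thus False using nz[OF xy(2)] by simp
      qed
      thus ?thesis by (simp add: g_def xy)
    qed
    define e where "e = Min (insert 1 (g ` S))"
    have e: "e > 0" "\<And>xy. xy \<in> S \<Longrightarrow> e \<le> g xy"
      unfolding e_def using fin gpos by (auto simp: Min_gr_iff)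
    obtain N :: nat where N: "N > 0" "1 / N < e"     proof -
      obtain k where "inverse (real (Suc k)) < e" using reals_Archimedean[OF e(1)] by blast
      thus ?thesis using that[of "Suc k"] by (simp add: inverse_eq_divide)
    qed
    obtain x y :: int where xy: "0 < y" "y \<le> int N" "\<bar>x - y * s\<bar> < 1 / N"
      using dirichlet_approximation[OF N(1)] .
    have "\<bar>of_int x + of_int y * s\<bar> \<le> 2 * of_int y * s + \<bar>of_int x - of_int y * s\<bar>"
    proof -
      have "\<bar>of_int x + of_int y * s\<bar> = \<bar>2 * of_int y * s + (of_int x - of_int y * s)\<bar>"
        by (simp add: algebra_simps)
      also have "\<dots> \<le> \<bar>2 * of_int y * s\<bar> + \<bar>of_int x - of_int y * s\<bar>" by (rule abs_triangle_ineq)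
      finally show ?thesis using xy(1) s(1) by simp
    qed
    also have "\<dots> \<le> 2 * N * s + 1 / N" using xy s(1) by (intro add_mono mult_mono) auto
    finally have b: "\<bar>of_int x + of_int y * s\<bar> \<le> 2 * N * s + 1 / N" .
    have "real_of_int \<bar>x\<^sup>2 - D * y\<^sup>2\<bar> = \<bar>(of_int x)\<^sup>2 - s\<^sup>2 * (of_int y)\<^sup>2\<bar>" using s(2) by simp
    also have "(of_int x)\<^sup>2 - s\<^sup>2 * (of_int y)\<^sup>2 = (of_int x - of_int y * s) * (of_int x + of_int y * s)"
      by (simp add: power2_eq_square algebra_simps)
    also have "\<bar>\<dots>\<bar> \<le> (1 / N) * (2 * N * s + 1 / N)" unfolding abs_mult
      using xy(3) b by (intro mult_mono) auto
    also have "\<dots> = 2 * s + 1 / (real N)\<^sup>2" using N(1) by (simp add: field_simps power2_eq_square)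
    also have "\<dots> \<le> 2 * s + 1" using N(1) by (simp add: field_simps)
    also have "\<dots> \<le> of_int M" unfolding M_def by (rule le_of_int_ceiling)
    finally have "(x, y) \<in> S" using xy(1) unfolding S_def by (simp only: of_int_le_iff) simp
    from e(2)[OF this] xy(3) N(2) show False by (simp add: g_def)
  qed
  define f where "f = (\<lambda>(x, y). let n = x\<^sup>2 - D * y\<^sup>2 in (n, x mod n, y mod n))"
  have "f ` S \<subseteq> {-M..M} \<times> {-M..M} \<times> {-M..M}"
  proof (rule image_subsetI)
    fix xy assume "xy \<in> S"
    then obtain x y where xy: "xy = (x, y)" and S: "y > 0" "\<bar>x\<^sup>2 - D * y\<^sup>2\<bar> \<le> M" unfolding S_def by auto
    define n where "n = x\<^sup>2 - D * y\<^sup>2"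
    have n0: "n \<noteq> 0" "\<bar>n\<bar> \<le> M" using nz[OF S(1)] S(2) by (auto simp: n_def)
    have "\<bar>z mod n\<bar> < \<bar>n\<bar>" for z using n0(1) by (rule abs_mod_less)
    from this[of x] this[of y] show "f xy \<in> {-M..M} \<times> {-M..M} \<times> {-M..M}"
      using n0 unfolding xy f_def Let_def n_def[symmetric] prod.case by auto
  qed
  hence "finite (f ` S)" by (rule finite_subset) auto
  then obtain q where q: "q \<in> S" "infinite {r \<in> S. f r = f q}"
    using pigeonhole_infinite[OF \<open>infinite S\<close>] by blast
  obtain r where r: "r \<in> S" "f r = f q" "r \<noteq> q"
  proof -
    have "infinite ({r \<in> S. f r = f q} - {q})" using q(2) by simp
    hence "{r \<in> S. f r = f q} - {q} \<noteq> {}" by (intro notI) simp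
    thus ?thesis using that by auto
  qed
  obtain x1 y1 x2 y2 where qr: "q = (x1, y1)" "r = (x2, y2)" by fastforce
  define n where "n = x1\<^sup>2 - D * y1\<^sup>2"
  have y: "y1 > 0" "y2 > 0" using q(1) r(1) qr unfolding S_def by auto
  have n2: "x2\<^sup>2 - D * y2\<^sup>2 = n" "x2 mod n = x1 mod n" "y2 mod n = y1 mod n"
    using r(2) unfolding f_def qr Let_def n_def by auto
  have n0: "n \<noteq> 0" using nz[OF y(1), of x1] unfolding n_def .
  have "[x1 * x2 - D * y1 * y2 = x1 * x1 - D * y1 * y1] (mod n)"
    using n2 by (intro cong_diff cong_mult cong_refl) (auto simp: cong_def)
  also have "x1 * x1 - D * y1 * y1 = n" by (simp add: n_def power2_eq_square)
  finally have "n dvd x1 * x2 - D * y1 * y2" using cong_dvd_iff[of "x1 * x2 - D * y1 * y2" n n] by simp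
  then obtain X where X: "x1 * x2 - D * y1 * y2 = n * X" by auto
  have "[x1 * y2 - x2 * y1 = x1 * y1 - x1 * y1] (mod n)"
    using n2 by (intro cong_diff cong_mult cong_refl) (auto simp: cong_def)
  hence "n dvd x1 * y2 - x2 * y1" by (simp add: cong_0_iff)
  then obtain Y where Y: "x1 * y2 - x2 * y1 = n * Y" by auto
  have "n\<^sup>2 * (X\<^sup>2 - D * Y\<^sup>2) = (n * X)\<^sup>2 - D * (n * Y)\<^sup>2"
    by (simp add: power2_eq_square algebra_simps)
  also have "\<dots> = (x1\<^sup>2 - D * y1\<^sup>2) * (x2\<^sup>2 - D * y2\<^sup>2)"
    unfolding X[symmetric] Y[symmetric] by (simp add: power2_eq_square algebra_simps)
  also have "\<dots> = n\<^sup>2" unfolding n2(1) n_def[symmetric] by (simp add: power2_eq_square)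
  finally have XY: "X\<^sup>2 - D * Y\<^sup>2 = 1" using n0 by simp
  have "Y \<noteq> 0"
  proof
    assume "Y = 0"
    hence xy: "x1 * y2 = x2 * y1" using Y by simp
    have "n * y2\<^sup>2 = (x1 * y2)\<^sup>2 - D * y1\<^sup>2 * y2\<^sup>2" unfolding n_def by (simp add: power2_eq_square algebra_simps)
    also have "\<dots> = n * y1\<^sup>2" unfolding xy n2(1)[symmetric] by (simp add: power2_eq_square algebra_simps)
    finally have "y2\<^sup>2 = y1\<^sup>2" using n0 by simp
    hence "y1 = y2" using y by simp
    thus False using xy y r(3) qr by simp
  qed
  moreover have "X \<noteq> 0"
  proof
    assume "X = 0"
    hence "D * Y\<^sup>2 = -1" using XY by simp
    moreover have "D * Y\<^sup>2 \<ge> 0" using D(1) by simp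
    ultimately show False by simp
  qed
  ultimately show ?thesis using that[of "\<bar>X\<bar>" "\<bar>Y\<bar>"] XY by simp
qed

lemma coprime_mult_square_int:
  fixes a b w :: int
  assumes "coprime a b" "a \<ge> 0" "b \<ge> 0" "a * b = w\<^sup>2" "a \<noteq> 0" "b \<noteq> 0"
  obtains r s where "a = r\<^sup>2" "b = s\<^sup>2"
proof -
  obtain m n :: nat where mn: "a = int m" "b = int n" using assms(2,3) by (metis nonneg_int_cases)
  have ab: "m > 0" "n > 0" using assms(5,6) mn by auto
  have "int (m * n) = int ((nat \<bar>w\<bar>)\<^sup>2)" using assms(4) mn by simp
  hence "m * n = (nat \<bar>w\<bar>)\<^sup>2" by (simp only: of_nat_eq_iff)
  hence p: "is_nth_power 2 (m * n)" unfolding is_nth_power_def by blast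
  have "coprime m n" using assms(1) mn by simp
  from is_nth_power_mult_coprime_natD[OF this p ab] obtain r s where "m = r\<^sup>2" "n = s\<^sup>2"
    unfolding is_nth_power_def by auto
  thus ?thesis using that[of "int r" "int s"] mn by simp
qed

lemma pell_split:
  fixes D :: int
  assumes D: "D > 0" "\<not> (\<exists>r. r\<^sup>2 = D)" "D mod 4 = 1 \<or> D mod 4 = 2"
  obtains d1 d2 a b :: int where "d1 > 0" "d2 > 0" "d1 * d2 = D" "d1 \<noteq> 1" "d1 * a\<^sup>2 - d2 * b\<^sup>2 = 1"
proof -
  define P where "P y \<longleftrightarrow> y > 0 \<and> (\<exists>x. x > 0 \<and> x\<^sup>2 - D * (int y)\<^sup>2 = 1)" for y :: nat
  obtain x0 y0 :: int where "x0 > 0" "y0 > 0" "x0\<^sup>2 - D * y0\<^sup>2 = 1" using pell_solution[OF D(1,2)] .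
  hence "P (nat y0)" unfolding P_def by auto
  then obtain y where y: "P y" and min: "\<And>z. P z \<Longrightarrow> y \<le> z"
    using ex_has_least_nat[of P "nat y0" id] by auto
  obtain x where x: "x > 0" "x\<^sup>2 - D * (int y)\<^sup>2 = 1" and y0: "y > 0" using y unfolding P_def by auto
  have "even y"
  proof (rule ccontr)
    assume "odd y"
    hence "(int y)\<^sup>2 mod 4 = 1" using square_mod_4[of "int y"] by simp
    hence "(D * (int y)\<^sup>2) mod 4 = D mod 4" by (metis mod_mult_right_eq mult.right_neutral)
    moreover have "x\<^sup>2 mod 4 = (1 + D * (int y)\<^sup>2) mod 4" using x(2) by (simp add: algebra_simps)
    ultimately have "x\<^sup>2 mod 4 = (1 + D) mod 4" by (metis mod_add_right_eq)
    thus False using square_mod_4[of x] D(3) by presburger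
  qed
  then obtain w where w: "y = 2 * w" by auto
  have "odd x"
  proof
    assume "even x"
    hence "even (x\<^sup>2 - D * (int y)\<^sup>2)" using w by simp
    thus False using x(2) by simp
  qed
  then obtain m where m: "x = 2 * m + 1" by (auto elim: oddE)
  have w0: "w > 0" using y0 w by simp
  have mw: "m * (m + 1) = D * (int w)\<^sup>2" using x(2) by (simp add: m w power2_eq_square algebra_simps)
  have "m \<noteq> 0" using mw D(1) w0 by auto
  hence m0: "m > 0" using x(1) m by simp
  define d1 where "d1 = gcd (m + 1) D"
  define d2 where "d2 = gcd m D"
  have cop: "coprime (m + 1) m" by simp
  have d12: "d1 * d2 = D"
  proof (rule zdvd_antisym_nonneg)
    have "coprime d1 d2" unfolding d1_def d2_def using cop
      by (meson coprime_divisors gcd_dvd1)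
    thus "d1 * d2 dvd D" by (intro divides_mult) (simp_all add: d1_def d2_def)
    have "D dvd (m + 1) * m" using mw by (simp add: mult.commute)
    hence "D dvd gcd (m * (m + 1)) (m * D)" by (simp add: mult.commute)
    hence "D dvd m * d1" unfolding d1_def by (simp add: gcd_mult_left)
    hence "D dvd gcd (d1 * m) (d1 * D)" by (simp add: mult.commute)
    thus "D dvd d1 * d2" unfolding d2_def by (simp add: gcd_mult_left)
  qed (use D(1) in \<open>auto simp: d1_def d2_def\<close>)
  have d0: "d1 > 0" "d2 > 0" using D(1) by (simp_all add: d1_def d2_def)
  obtain u v where uv: "m + 1 = d1 * u" "m = d2 * v" unfolding d1_def d2_def by (meson dvdE gcd_dvd1)
  have "D * (u * v) = (d1 * u) * (d2 * v)" using d12 by (simp add: mult_ac)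
  also have "\<dots> = (m + 1) * m" by (simp only: uv(1)[symmetric] uv(2)[symmetric])
  also have "\<dots> = D * (int w)\<^sup>2" using mw by (simp add: mult.commute)
  finally have "D * (u * v) = D * (int w)\<^sup>2" .
  hence uvw: "u * v = (int w)\<^sup>2" using D(1) by simp
  have "d1 * u > 0" "d2 * v > 0" using uv m0 by auto
  hence uv0: "u > 0" "v > 0" using d0 by (simp_all add: zero_less_mult_iff)
  have "coprime (d1 * u) (d2 * v)" using cop by (simp only: uv(1)[symmetric] uv(2)[symmetric])
  hence "coprime u v" by simp
  then obtain a b where ab: "u = a\<^sup>2" "v = b\<^sup>2" using coprime_mult_square_int[of u v "int w"] uv0 uvw by auto
  have eq: "d1 * a\<^sup>2 - d2 * b\<^sup>2 = 1" using uv ab by simp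
  have "d1 \<noteq> 1"
  proof
    assume d1: "d1 = 1"
    hence "a\<^sup>2 - D * b\<^sup>2 = 1" using eq d12 by simp
    moreover have "b \<noteq> 0" "a \<noteq> 0" using ab uv0 by auto
    ultimately have "P (nat \<bar>b\<bar>)" unfolding P_def by (intro conjI exI[of _ "\<bar>a\<bar>"]) auto
    hence "int y \<le> \<bar>b\<bar>" using min by fastforce
    moreover have "\<bar>b\<bar> \<le> int w"
    proof -
      have "1 * v \<le> u * v" using uv0 by (intro mult_right_mono) auto
      hence "b\<^sup>2 \<le> (int w)\<^sup>2" using uvw ab by simp
      thus ?thesis by (simp add: abs_le_square_iff[symmetric])
    qed
    ultimately show False using w w0 by simp
  qed
  thus ?thesis using that d0 d12 eq by blast
qed

section \<open>Products of modules\<close>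

inductive_set sprod :: "complex set \<Rightarrow> complex set \<Rightarrow> complex set" for M N where
  zero: "0 \<in> sprod M N"
| step: "a \<in> M \<Longrightarrow> b \<in> N \<Longrightarrow> x \<in> sprod M N \<Longrightarrow> a * b + x \<in> sprod M N"

definition is_mod :: "complex set \<Rightarrow> complex set \<Rightarrow> bool" where
  "is_mod R M \<longleftrightarrow> 0 \<in> M \<and> (\<forall>x\<in>M. \<forall>y\<in>M. x + y \<in> M) \<and> (\<forall>r\<in>R. \<forall>x\<in>M. r * x \<in> M)"

definition scl :: "complex \<Rightarrow> complex set \<Rightarrow> complex set" where
  "scl c M = (\<lambda>x. c * x) ` M"

lemma is_ideal_iff: "is_ideal R I \<longleftrightarrow> I \<subseteq> R \<and> is_mod R I"
  unfolding is_ideal_def is_mod_def by auto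

lemma sprod_mult: "a \<in> M \<Longrightarrow> b \<in> N \<Longrightarrow> a * b \<in> sprod M N"
  using sprod.step[OF _ _ sprod.zero] by fastforce

lemma sprod_add: "x \<in> sprod M N \<Longrightarrow> y \<in> sprod M N \<Longrightarrow> x + y \<in> sprod M N"
  by (induction rule: sprod.induct) (auto simp: add.assoc intro: sprod.step)

lemma sprod_least:
  assumes "0 \<in> T" "\<And>x y. x \<in> T \<Longrightarrow> y \<in> T \<Longrightarrow> x + y \<in> T" "\<And>a b. a \<in> M \<Longrightarrow> b \<in> N \<Longrightarrow> a * b \<in> T"
  shows "sprod M N \<subseteq> T"
proof
  fix x assume "x \<in> sprod M N"
  thus "x \<in> T" by induction (use assms in auto)
qed

lemma sprod_comm: "sprod M N = sprod N M"
proof -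
  have "sprod M N \<subseteq> sprod N M" for M N
  proof (rule sprod_least)
    fix a b assume "a \<in> M" "b \<in> N"
    thus "a * b \<in> sprod N M" using sprod_mult[of b N a M] by (simp add: mult.commute)
  qed (auto intro: sprod.zero sprod_add)
  thus ?thesis by blast
qed

lemma sprod_assoc: "sprod (sprod M N) L = sprod M (sprod N L)"
proof -
  have *: "sprod (sprod M N) L \<subseteq> sprod M (sprod N L)" for M N L
  proof (rule sprod_least)
    fix x l assume x: "x \<in> sprod M N" and l: "l \<in> L"
    from x show "x * l \<in> sprod M (sprod N L)"
    proof induction
      case (step a b x)
      have "a * (b * l) \<in> sprod M (sprod N L)" using step l by (intro sprod_mult)
      from sprod_add[OF this step(4)] show ?case by (simp add: algebra_simps)
    qed (simp add: sprod.zero)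
  qed (auto intro: sprod.zero sprod_add)
  have "sprod M (sprod N L) = sprod (sprod L N) M" by (metis sprod_comm)
  also have "\<dots> \<subseteq> sprod L (sprod N M)" by (rule *)
  also have "\<dots> = sprod (sprod M N) L" by (metis sprod_comm)
  finally show ?thesis using * by blast
qed

lemma is_mod_sprod: "is_mod R M \<Longrightarrow> is_mod R (sprod M N)"
  unfolding is_mod_def
proof (intro conjI ballI)
  assume M: "0 \<in> M \<and> (\<forall>x\<in>M. \<forall>y\<in>M. x + y \<in> M) \<and> (\<forall>r\<in>R. \<forall>x\<in>M. r * x \<in> M)"
  fix r x assume r: "r \<in> R" and x: "x \<in> sprod M N"
  from x show "r * x \<in> sprod M N"
  proof induction
    case (step a b x)
    have "(r * a) * b + r * x \<in> sprod M N" using step M r by (intro sprod.step) auto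
    thus ?case by (simp add: algebra_simps)
  qed (simp add: sprod.zero)
qed (auto intro: sprod.zero sprod_add)

lemma sprod_scl: "sprod (scl c M) N = scl c (sprod M N)"
proof
  show "sprod (scl c M) N \<subseteq> scl c (sprod M N)"
  proof (rule sprod_least)
    fix a b assume "a \<in> scl c M" "b \<in> N"
    thus "a * b \<in> scl c (sprod M N)" unfolding scl_def by (auto simp: mult.assoc intro: sprod_mult)
  next
    fix x y assume "x \<in> scl c (sprod M N)" "y \<in> scl c (sprod M N)"
    then obtain x' y' where "x = c * x'" "y = c * y'" "x' \<in> sprod M N" "y' \<in> sprod M N"
      unfolding scl_def by auto
    thus "x + y \<in> scl c (sprod M N)" unfolding scl_def
      by (intro image_eqI[of _ _ "x' + y'"]) (auto simp: distrib_left intro: sprod_add)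
  qed (auto simp: scl_def intro: sprod.zero image_eqI[of _ _ 0])
  show "scl c (sprod M N) \<subseteq> sprod (scl c M) N"
  proof
    fix z assume "z \<in> scl c (sprod M N)"
    then obtain x where z: "z = c * x" and x: "x \<in> sprod M N" unfolding scl_def by auto
    from x have "c * x \<in> sprod (scl c M) N"
    proof induction
      case (step a b x)
      have "(c * a) * b + c * x \<in> sprod (scl c M) N" using step by (intro sprod.step) (auto simp: scl_def)
      thus ?case by (simp add: algebra_simps)
    qed (simp add: sprod.zero)
    thus "z \<in> sprod (scl c M) N" by (simp add: z)
  qed
qed

lemma sprod_scl_right: "sprod M (scl c N) = scl c (sprod M N)"
  by (metis sprod_comm sprod_scl)

lemma scl_scl: "scl c (scl d M) = scl (c * d) M"
  unfolding scl_def by (auto simp: image_image mult.assoc)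

lemma scl_1 [simp]: "scl 1 M = M"
  unfolding scl_def by auto

lemma scl_eq_sclD:
  assumes "scl c M = scl d N" "c \<noteq> 0"
  shows "M = scl (inverse c * d) N"
proof -
  have "scl (inverse c) (scl c M) = scl (inverse c * d) N" unfolding assms(1) scl_scl ..
  thus ?thesis using assms(2) by (simp add: scl_scl)
qed

lemma is_mod_scl: "is_mod R M \<Longrightarrow> is_mod R (scl c M)"
  unfolding is_mod_def scl_def
proof (intro conjI ballI)
  assume M: "0 \<in> M \<and> (\<forall>x\<in>M. \<forall>y\<in>M. x + y \<in> M) \<and> (\<forall>r\<in>R. \<forall>x\<in>M. r * x \<in> M)"
  show "0 \<in> (*) c ` M" using M by (intro image_eqI[of _ _ 0]) auto
  fix x assume "x \<in> (*) c ` M"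
  then obtain x' where x: "x' \<in> M" "x = c * x'" by auto
  {
    fix y assume "y \<in> (*) c ` M"
    then obtain y' where "y' \<in> M" "y = c * y'" by auto
    thus "x + y \<in> (*) c ` M" using x M by (intro image_eqI[of _ _ "x' + y'"]) (auto simp: distrib_left)
  }
  fix r assume "r \<in> R"
  thus "r * x \<in> (*) c ` M" using x M by (intro image_eqI[of _ _ "r * x'"]) auto
qed

lemma scl_unit:
  assumes "is_mod R M" "u \<in> R" "inverse u \<in> R" "u \<noteq> 0"
  shows "scl u M = M"
proof
  show "scl u M \<subseteq> M" using assms unfolding scl_def is_mod_def by auto
  show "M \<subseteq> scl u M"
  proof
    fix x assume "x \<in> M"
    hence "inverse u * x \<in> M" using assms unfolding is_mod_def by auto
    thus "x \<in> scl u M" unfolding scl_def using assms(4) by (intro image_eqI[of _ _ "inverse u * x"]) auto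
  qed
qed

lemma sprod_ring_left:
  assumes "is_mod R M" "1 \<in> R"
  shows "sprod R M = M"
proof
  show "sprod R M \<subseteq> M" using assms unfolding is_mod_def by (intro sprod_least) auto
  show "M \<subseteq> sprod R M" using sprod_mult[OF assms(2)] by fastforce
qed

lemma scl_ring_mem: "1 \<in> R \<Longrightarrow> c \<in> scl c R"
  unfolding scl_def by (intro image_eqI[of _ _ 1]) auto

text \<open>A module whose square is generated by a square is itself principal when the ring is
  integrally closed: the inclusion into the principal module is integrality, and the generator
  is recovered by dividing an expression of its square by it.\<close>

lemma sprod_square_principal:
  assumes R: "is_mod R R" "1 \<in> R" and J: "J \<subseteq> K" and S: "is_mod R S" "J \<subseteq> S" "S \<subseteq> sprod R J"
    and int: "\<And>x. x \<in> K \<Longrightarrow> algebraic_int x \<Longrightarrow> x \<in> R"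
    and R_int: "\<And>x. x \<in> R \<Longrightarrow> algebraic_int x"
    and K_div: "\<And>x. x \<in> K \<Longrightarrow> x / s \<in> K"
    and s: "s \<noteq> 0" and u: "u \<in> R" "inverse u \<in> R" "u \<noteq> 0"
    and sq: "\<And>x. x \<in> J \<Longrightarrow> x\<^sup>2 / s\<^sup>2 \<in> R"
    and d: "u * s\<^sup>2 \<in> sprod J J"
  shows "S = scl s R"
proof -
  have xs: "x / s \<in> R" if "x \<in> J" for x
  proof (rule int)
    show "algebraic_int (x / s)"
      by (rule algebraic_int_of_square) (use sq[OF that] R_int in \<open>simp add: power_divide\<close>)
  qed (use J that K_div in auto)
  have Js: "J \<subseteq> scl s R"
  proof
    fix x assume "x \<in> J"
    thus "x \<in> scl s R" unfolding scl_def using xs s by (intro image_eqI[of _ _ "x / s"]) auto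
  qed
  have "sprod R J \<subseteq> scl s R"
    using is_mod_scl[OF R(1), of s] Js unfolding is_mod_def by (intro sprod_least) auto
  moreover have "z / s \<in> S" if "z \<in> sprod J J" for z
    using that
  proof induction
    case (step a b x)
    have "(b / s) * a \<in> S" using xs[OF step(2)] S(1,2) step(1) unfolding is_mod_def by blast
    hence "(b / s) * a + x / s \<in> S" using step(4) S(1) unfolding is_mod_def by blast
    also have "(b / s) * a + x / s = (a * b + x) / s" by (simp add: add_divide_distrib)
    finally show ?case .
  qed (use S(1) in \<open>auto simp: is_mod_def\<close>)
  from this[OF d] have "u * s \<in> S" using s by (simp add: power2_eq_square)
  hence "inverse u * (u * s) \<in> S" using S(1) u(2) unfolding is_mod_def by blast
  hence "s \<in> S" using u(3) by (simp add: mult.assoc[symmetric])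
  hence "scl s R \<subseteq> S" using S(1) unfolding scl_def is_mod_def by (auto simp: mult.commute)
  ultimately show ?thesis using S(3) by blast
qed

section \<open>Rings of integers\<close>

lemma subfield_gen_field: "subfield_C (gen_field A)"
  unfolding gen_field_def subfield_C_def by blast

lemma gen_field_base: "A \<subseteq> gen_field A"
  unfolding gen_field_def by blast

lemma gen_field_least: "subfield_C S \<Longrightarrow> A \<subseteq> S \<Longrightarrow> gen_field A \<subseteq> S"
  unfolding gen_field_def by blast

context
  fixes K :: "complex set"
  assumes K: "subfield_C K"
begin

lemma subfield_0: "0 \<in> K" and subfield_1: "1 \<in> K"
  and subfield_add: "x \<in> K \<Longrightarrow> y \<in> K \<Longrightarrow> x + y \<in> K"
  and subfield_diff: "x \<in> K \<Longrightarrow> y \<in> K \<Longrightarrow> x - y \<in> K"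
  and subfield_mult: "x \<in> K \<Longrightarrow> y \<in> K \<Longrightarrow> x * y \<in> K"
  using K unfolding subfield_C_def by auto

lemma subfield_inverse: "x \<in> K \<Longrightarrow> inverse x \<in> K"
  using K unfolding subfield_C_def by (cases "x = 0") auto

lemma subfield_divide: "x \<in> K \<Longrightarrow> y \<in> K \<Longrightarrow> x / y \<in> K"
  unfolding divide_inverse by (intro subfield_mult subfield_inverse)

lemma subfield_minus: "x \<in> K \<Longrightarrow> - x \<in> K"
  using subfield_diff[OF subfield_0] by simp

lemma subfield_of_int: "of_int n \<in> K"
proof -
  have nat: "of_nat m \<in> K" for m
    by (induction m) (auto intro: subfield_0 subfield_1 subfield_add)
  show ?thesis
  proof (cases "n \<ge> 0")
    case True
    thus ?thesis using nat[of "nat n"] by simp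
  next
    case False
    thus ?thesis using subfield_minus[OF nat[of "nat (- n)"]] by simp
  qed
qed

lemma subfield_Rats:
  assumes "x \<in> \<rat>"
  shows "complex_of_real x \<in> K"
proof -
  obtain a b where "x = of_int a / of_int b" using assms by (auto elim: Rats_cases')
  hence "complex_of_real x = of_int a / of_int b" by simp
  thus ?thesis using subfield_divide subfield_of_int by metis
qed

lemma subfield_gauss_rat:
  assumes "\<i> \<in> K" "z \<in> gauss_rat"
  shows "z \<in> K"
proof -
  have "z = complex_of_real (Re z) + \<i> * complex_of_real (Im z)" by (rule complex_eq)
  moreover have "complex_of_real (Re z) + \<i> * complex_of_real (Im z) \<in> K"
    using assms unfolding gauss_rat_def by (intro subfield_add subfield_mult subfield_Rats) auto
  ultimately show ?thesis by metis
qed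

abbreviation (input) int_ring ("\<O>") where "\<O> \<equiv> ring_of_integers K"

lemma roi_iff: "x \<in> \<O> \<longleftrightarrow> x \<in> K \<and> algebraic_int x"
  unfolding ring_of_integers_def by simp

lemma roi_0: "0 \<in> \<O>" and roi_1: "1 \<in> \<O>"
  and roi_add: "x \<in> \<O> \<Longrightarrow> y \<in> \<O> \<Longrightarrow> x + y \<in> \<O>"
  and roi_mult: "x \<in> \<O> \<Longrightarrow> y \<in> \<O> \<Longrightarrow> x * y \<in> \<O>"
  using subfield_0 subfield_1 subfield_add subfield_mult algebraic_int_plus_times
  by (auto simp: roi_iff)

lemma roi_mod: "is_mod \<O> \<O>"
  unfolding is_mod_def using roi_0 roi_add roi_mult by blast

lemma roi_ideal_mult:
  assumes "is_ideal \<O> I" "is_ideal \<O> J"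
  shows "ideal_mult \<O> I J = sprod I J" "is_ideal \<O> (sprod I J)"
proof -
  have IJ: "I \<subseteq> \<O>" "J \<subseteq> \<O>" "is_mod \<O> I" "is_mod \<O> J" using assms is_ideal_iff by auto
  show id: "is_ideal \<O> (sprod I J)" unfolding is_ideal_iff
  proof
    show "sprod I J \<subseteq> \<O>"
    proof (rule sprod_least)
      fix a b assume "a \<in> I" "b \<in> J"
      thus "a * b \<in> \<O>" using IJ(1,2) by (intro roi_mult) auto
    qed (auto intro: roi_0 roi_add)
  qed (rule is_mod_sprod[OF IJ(3)])
  show "ideal_mult \<O> I J = sprod I J" unfolding ideal_mult_def ideal_gen_def
  proof
    show "\<Inter> {Ja. is_ideal \<O> Ja \<and> {a * b |a b. a \<in> I \<and> b \<in> J} \<subseteq> Ja} \<subseteq> sprod I J"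
      using id sprod_mult by (intro Inter_lower) auto
    show "sprod I J \<subseteq> \<Inter> {Ja. is_ideal \<O> Ja \<and> {a * b |a b. a \<in> I \<and> b \<in> J} \<subseteq> Ja}"
    proof (intro Inter_greatest)
      fix L assume "L \<in> {Ja. is_ideal \<O> Ja \<and> {a * b |a b. a \<in> I \<and> b \<in> J} \<subseteq> Ja}"
      hence "is_mod \<O> L" "\<And>a b. a \<in> I \<Longrightarrow> b \<in> J \<Longrightarrow> a * b \<in> L" unfolding is_ideal_iff by blast+
      thus "sprod I J \<subseteq> L" unfolding is_mod_def by (intro sprod_least) auto
    qed
  qed
qed

lemma roi_ideal_gen:
  assumes "I \<subseteq> \<O>"
  shows "ideal_gen \<O> I = sprod \<O> I"
proof -
  have id: "is_ideal \<O> (sprod \<O> I)" unfolding is_ideal_iff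
  proof
    show "sprod \<O> I \<subseteq> \<O>" using assms roi_0 roi_add roi_mult by (intro sprod_least) auto
  qed (rule is_mod_sprod[OF roi_mod])
  have "I \<subseteq> sprod \<O> I" using sprod_mult[OF roi_1] by fastforce
  hence "ideal_gen \<O> I \<subseteq> sprod \<O> I" unfolding ideal_gen_def using id by (intro Inter_lower) auto
  moreover have "sprod \<O> I \<subseteq> ideal_gen \<O> I" unfolding ideal_gen_def
  proof (intro Inter_greatest)
    fix L assume "L \<in> {J. is_ideal \<O> J \<and> I \<subseteq> J}"
    hence "is_mod \<O> L" "I \<subseteq> L" using is_ideal_iff by auto
    thus "sprod \<O> I \<subseteq> L" unfolding is_mod_def by (intro sprod_least) auto
  qed
  ultimately show ?thesis by blast
qed

lemma roi_ideal_self: "is_ideal \<O> \<O>"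
  unfolding is_ideal_iff using roi_mod by simp

lemma ideal_pow_ideal:
  "is_ideal \<O> I \<Longrightarrow> is_ideal \<O> (ideal_pow \<O> I n)"
  by (induction n) (auto simp: roi_ideal_self roi_ideal_mult)

lemma ideal_pow_Suc:
  "is_ideal \<O> I \<Longrightarrow>
    ideal_pow \<O> I (Suc n) = sprod I (ideal_pow \<O> I n)"
  by (simp add: roi_ideal_mult ideal_pow_ideal)

lemma ideal_pow_double:
  assumes "is_ideal \<O> I"
  shows "ideal_pow \<O> (sprod I I) n = ideal_pow \<O> I (2 * n)"
proof (induction n)
  case (Suc n)
  have "ideal_pow \<O> (sprod I I) (Suc n) =
      sprod (sprod I I) (ideal_pow \<O> I (2 * n))"
    unfolding ideal_pow_Suc[OF roi_ideal_mult(2)[OF assms assms]] Suc ..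
  also have "\<dots> = sprod I (sprod I (ideal_pow \<O> I (2 * n)))" by (rule sprod_assoc)
  also have "\<dots> = ideal_pow \<O> I (Suc (Suc (2 * n)))"
    unfolding ideal_pow_Suc[OF assms] ..
  finally show ?case by simp
qed simp

lemma ideal_pow_1: "is_ideal \<O> I \<Longrightarrow> ideal_pow \<O> I 1 = I"
  using ideal_pow_Suc[of I 0] sprod_comm[of I] sprod_ring_left[OF _ roi_1, of I] is_ideal_iff by auto

lemma ideal_class_trivial_iff:
  assumes "I \<subseteq> \<O>"
  shows "ideal_class \<O> I = ideal_class \<O> \<O>
    \<longleftrightarrow> (\<exists>\<gamma>. \<gamma> \<noteq> 0 \<and> I = scl \<gamma> \<O>)"
proof
  have nz: "\<O> \<in> nz_ideals \<O>" unfolding nz_ideals_def using roi_ideal_self roi_1 by auto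
  have refl: "ideal_equiv \<O> \<O> \<O>" unfolding ideal_equiv_def using roi_1 by (intro bexI[of _ 1]) auto
  {
    assume "ideal_class \<O> I = ideal_class \<O> \<O>"
    hence "\<O> \<in> ideal_class \<O> I" using nz refl unfolding ideal_class_def by simp
    then obtain \<alpha> \<beta> where ab: "\<alpha> \<noteq> 0" "\<beta> \<noteq> 0" "scl \<alpha> I = scl \<beta> \<O>"
      unfolding ideal_class_def ideal_equiv_def scl_def by auto
    thus "\<exists>\<gamma>. \<gamma> \<noteq> 0 \<and> I = scl \<gamma> \<O>"
      using scl_eq_sclD[OF ab(3,1)] by (intro exI[of _ "inverse \<alpha> * \<beta>"]) auto
  }
  {
    assume "\<exists>\<gamma>. \<gamma> \<noteq> 0 \<and> I = scl \<gamma> \<O>"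
    then obtain \<gamma> where g: "\<gamma> \<noteq> 0" "I = scl \<gamma> \<O>" by blast
    have gR: "\<gamma> \<in> \<O>" using scl_ring_mem[OF roi_1, of \<gamma>] g assms by auto
    have "ideal_equiv \<O> I J \<longleftrightarrow> ideal_equiv \<O> \<O> J" for J
    proof
      assume "ideal_equiv \<O> I J"
      then obtain \<alpha> \<beta> where ab: "\<alpha> \<in> \<O> - {0}" "\<beta> \<in> \<O> - {0}" "scl \<alpha> I = scl \<beta> J"
        unfolding ideal_equiv_def scl_def by auto
      have "scl (\<alpha> * \<gamma>) \<O> = scl \<beta> J" using ab(3) unfolding g(2) scl_scl .
      moreover have "\<alpha> * \<gamma> \<in> \<O> - {0}" using ab gR g roi_mult by auto
      ultimately show "ideal_equiv \<O> \<O> J" using ab(2) unfolding ideal_equiv_def scl_def by blast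
    next
      assume "ideal_equiv \<O> \<O> J"
      then obtain \<alpha> \<beta> where ab: "\<alpha> \<in> \<O> - {0}" "\<beta> \<in> \<O> - {0}" "scl \<alpha> \<O> = scl \<beta> J"
        unfolding ideal_equiv_def scl_def by auto
      have "scl \<alpha> I = scl \<gamma> (scl \<alpha> \<O>)" unfolding g(2) scl_scl by (simp add: mult.commute)
      hence "scl \<alpha> I = scl (\<gamma> * \<beta>) J" unfolding ab(3) scl_scl .
      moreover have "\<gamma> * \<beta> \<in> \<O> - {0}" using ab gR g roi_mult by auto
      ultimately show "ideal_equiv \<O> I J" using ab(1) unfolding ideal_equiv_def scl_def by blast
    qed
    thus "ideal_class \<O> I = ideal_class \<O> \<O>" unfolding ideal_class_def by simp
  }
qed

end

section \<open>Quadratic extensions of the Gaussian field\<close>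

locale quad_field =
  fixes D :: int
  assumes D_pos: "D > 0" and D_nonsquare: "\<not> (\<exists>r. r\<^sup>2 = D)"
begin

definition \<eta> :: complex where "\<eta> = complex_of_real (sqrt (of_int D))"

definition k :: "complex set" where "k = gen_field {\<eta>, \<i>}"

abbreviation R :: "complex set" where "R \<equiv> ring_of_integers k"

definition \<sigma> :: "complex \<Rightarrow> complex" where
  "\<sigma> x = (THE y. \<exists>a\<in>gauss_rat. \<exists>b\<in>gauss_rat. x = a + b * \<eta> \<and> y = a - b * \<eta>)"

definition nm :: "complex \<Rightarrow> complex" where "nm x = x * \<sigma> x"

lemma eta_sq: "\<eta> * \<eta> = of_int D"
  using D_pos by (simp add: \<eta>_def flip: of_real_mult)

lemma eta_nonzero: "\<eta> \<noteq> 0"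
  using D_pos by (simp add: \<eta>_def)

lemma eta_not_rat: "\<eta> \<notin> gauss_rat"
proof
  assume "\<eta> \<in> gauss_rat"
  hence "sqrt (of_int D) \<in> \<rat>" by (simp add: \<eta>_def gauss_rat_def)
  moreover have "algebraic_int (sqrt (of_int D) :: real)" by auto
  ultimately have "sqrt (of_int D) \<in> \<int>" using rational_algebraic_int_is_int by blast
  then obtain m where "sqrt (of_int D) = of_int m" by (auto elim: Ints_cases)
  hence "real_of_int D = of_int (m\<^sup>2)" using D_pos by (metis less_eq_real_def of_int_0_less_iff of_int_power real_sqrt_pow2)
  hence "m\<^sup>2 = D" by (simp only: of_int_eq_iff)
  thus False using D_nonsquare by blast
qed

lemma rep_unique:
  assumes "a \<in> gauss_rat" "b \<in> gauss_rat" "c \<in> gauss_rat" "d \<in> gauss_rat" "a + b * \<eta> = c + d * \<eta>"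
  shows "a = c \<and> b = d"
proof (rule ccontr)
  assume n: "\<not> (a = c \<and> b = d)"
  have e: "(b - d) * \<eta> = c - a" using assms(5) by (simp add: algebra_simps)
  have "b \<noteq> d" using n e by auto
  hence "\<eta> = (c - a) / (b - d)" using e by (simp add: field_simps)
  also have "\<dots> \<in> gauss_rat" using assms by auto
  finally show False using eta_not_rat by blast
qed

lemma sigma_eq: "a \<in> gauss_rat \<Longrightarrow> b \<in> gauss_rat \<Longrightarrow> \<sigma> (a + b * \<eta>) = a - b * \<eta>"
  unfolding \<sigma>_def by (rule the_equality) (use rep_unique in blast)+

lemma subfield_rep: "subfield_C {a + b * \<eta> |a b. a \<in> gauss_rat \<and> b \<in> gauss_rat}"
  unfolding subfield_C_def
proof (intro conjI ballI impI)
  let ?S = "{a + b * \<eta> |a b. a \<in> gauss_rat \<and> b \<in> gauss_rat}"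
  have I: "a + b * \<eta> \<in> ?S" if "a \<in> gauss_rat" "b \<in> gauss_rat" for a b using that by blast
  show "0 \<in> ?S" using I[of 0 0] by simp
  show "1 \<in> ?S" using I[of 1 0] by simp
  {
    fix x y assume "x \<in> ?S" "y \<in> ?S"
    then obtain a b c d where ab: "a \<in> gauss_rat" "b \<in> gauss_rat" "c \<in> gauss_rat" "d \<in> gauss_rat"
      "x = a + b * \<eta>" "y = c + d * \<eta>" by blast
    have "x + y = (a + c) + (b + d) * \<eta>" "x - y = (a - c) + (b - d) * \<eta>"
      using ab by (simp_all add: algebra_simps)
    moreover have "(a + c) + (b + d) * \<eta> \<in> ?S" using ab by (intro I gauss_rat_add)
    moreover have "(a - c) + (b - d) * \<eta> \<in> ?S" using ab by (intro I gauss_rat_diff)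
    ultimately show "x + y \<in> ?S" "x - y \<in> ?S" by simp_all
    have "x * y = a * c + b * d * (\<eta> * \<eta>) + (a * d + b * c) * \<eta>"
      unfolding ab(5,6) by (simp add: algebra_simps)
    also have "\<dots> = (a * c + b * d * of_int D) + (a * d + b * c) * \<eta>" by (simp only: eta_sq)
    also have "\<dots> \<in> ?S" using ab by (intro I gauss_rat_add gauss_rat_mult gauss_rat_of_int)
    finally show "x * y \<in> ?S" .
  }
  fix x assume "x \<in> ?S" "x \<noteq> 0"
  then obtain a b where ab: "a \<in> gauss_rat" "b \<in> gauss_rat" "x = a + b * \<eta>" by blast
  define n where "n = a * a - b * b * of_int D"
  have n: "x * (a - b * \<eta>) = n"
  proof -
    have "x * (a - b * \<eta>) = a * a - b * b * (\<eta> * \<eta>)" using ab by (simp add: algebra_simps)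
    thus ?thesis by (simp only: eta_sq n_def)
  qed
  have "a - b * \<eta> \<noteq> 0"
  proof
    assume "a - b * \<eta> = 0"
    hence "a + (- b) * \<eta> = 0 + 0 * \<eta>" by simp
    hence "a = 0 \<and> - b = 0" using rep_unique[of a "- b" 0 0] ab by auto
    thus False using ab(3) \<open>x \<noteq> 0\<close> by simp
  qed
  hence "inverse x = (a - b * \<eta>) / n" using \<open>x \<noteq> 0\<close> by (simp add: n[symmetric] field_simps)
  also have "\<dots> = a / n + (- b / n) * \<eta>" by (simp add: diff_divide_distrib)
  also have "\<dots> \<in> ?S"
  proof (rule I)
    have "n \<in> gauss_rat" using ab by (auto simp: n_def)
    thus "a / n \<in> gauss_rat" "- b / n \<in> gauss_rat" using ab by auto
  qed
  finally show "inverse x \<in> ?S" .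
qed

lemma subfield_k: "subfield_C k"
  unfolding k_def by (rule subfield_gen_field)

lemma eta_k: "\<eta> \<in> k" and ii_k: "\<i> \<in> k"
  unfolding k_def using gen_field_base by blast+

lemma gauss_rat_k: "z \<in> gauss_rat \<Longrightarrow> z \<in> k"
  using subfield_gauss_rat[OF subfield_k ii_k] .

lemma k_eq: "k = {a + b * \<eta> |a b. a \<in> gauss_rat \<and> b \<in> gauss_rat}"
proof
  have "\<eta> = 0 + 1 * \<eta>" "\<i> = \<i> + 0 * \<eta>" by simp_all
  hence "{\<eta>, \<i>} \<subseteq> {a + b * \<eta> |a b. a \<in> gauss_rat \<and> b \<in> gauss_rat}"
    using gauss_rat_0 gauss_rat_1 gauss_rat_ii by blast
  thus "k \<subseteq> {a + b * \<eta> |a b. a \<in> gauss_rat \<and> b \<in> gauss_rat}"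
    unfolding k_def by (rule gen_field_least[OF subfield_rep])
  show "{a + b * \<eta> |a b. a \<in> gauss_rat \<and> b \<in> gauss_rat} \<subseteq> k"
    using subfield_add[OF subfield_k] subfield_mult[OF subfield_k] gauss_rat_k eta_k by blast
qed

lemma k_cases:
  assumes "x \<in> k"
  obtains a b where "a \<in> gauss_rat" "b \<in> gauss_rat" "x = a + b * \<eta>" "\<sigma> x = a - b * \<eta>"
  using assms unfolding k_eq by (auto simp: sigma_eq)

lemma sigma_rat [simp]: "a \<in> gauss_rat \<Longrightarrow> \<sigma> a = a"
  using sigma_eq[of a 0] by auto

lemma sigma_eta: "\<sigma> \<eta> = - \<eta>"
  using sigma_eq[of 0 1] by simp

lemma sigma_k: "x \<in> k \<Longrightarrow> \<sigma> x \<in> k"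
proof (erule k_cases)
  fix a b assume "a \<in> gauss_rat" "b \<in> gauss_rat" "\<sigma> x = a - b * \<eta>"
  thus ?thesis using subfield_diff[OF subfield_k] subfield_mult[OF subfield_k] gauss_rat_k eta_k by metis
qed

lemma sigma_sigma: "x \<in> k \<Longrightarrow> \<sigma> (\<sigma> x) = x"
proof (erule k_cases)
  fix a b assume ab: "a \<in> gauss_rat" "b \<in> gauss_rat" "x = a + b * \<eta>" "\<sigma> x = a - b * \<eta>"
  have "\<sigma> (a + (- b) * \<eta>) = a - (- b) * \<eta>" using ab by (intro sigma_eq) auto
  thus ?thesis using ab by simp
qed

lemma sigma_add: "x \<in> k \<Longrightarrow> y \<in> k \<Longrightarrow> \<sigma> (x + y) = \<sigma> x + \<sigma> y"
proof (elim k_cases)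
  fix a b c d assume ab: "a \<in> gauss_rat" "b \<in> gauss_rat" "x = a + b * \<eta>" "\<sigma> x = a - b * \<eta>"
    "c \<in> gauss_rat" "d \<in> gauss_rat" "y = c + d * \<eta>" "\<sigma> y = c - d * \<eta>"
  have "\<sigma> ((a + c) + (b + d) * \<eta>) = (a + c) - (b + d) * \<eta>" using ab by (intro sigma_eq) auto
  moreover have "(a + c) + (b + d) * \<eta> = x + y" unfolding ab(3,7) by (simp add: algebra_simps)
  ultimately have "\<sigma> (x + y) = (a + c) - (b + d) * \<eta>" by simp
  thus ?thesis unfolding ab(4,8) by (simp add: algebra_simps)
qed

lemma sigma_mult: "x \<in> k \<Longrightarrow> y \<in> k \<Longrightarrow> \<sigma> (x * y) = \<sigma> x * \<sigma> y"
proof (elim k_cases)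
  fix a b c d assume ab: "a \<in> gauss_rat" "b \<in> gauss_rat" "x = a + b * \<eta>" "\<sigma> x = a - b * \<eta>"
    "c \<in> gauss_rat" "d \<in> gauss_rat" "y = c + d * \<eta>" "\<sigma> y = c - d * \<eta>"
  have e: "\<sigma> ((a * c + b * d * of_int D) + (a * d + b * c) * \<eta>)
      = (a * c + b * d * of_int D) - (a * d + b * c) * \<eta>" using ab by (intro sigma_eq) auto
  have "x * y = (a * c + b * d * (\<eta> * \<eta>)) + (a * d + b * c) * \<eta>"
    unfolding ab(3,7) by (simp add: algebra_simps)
  moreover have "\<sigma> x * \<sigma> y = (a * c + b * d * (\<eta> * \<eta>)) - (a * d + b * c) * \<eta>"
    unfolding ab(4,8) by (simp add: algebra_simps)
  ultimately show ?thesis using e unfolding eta_sq by simp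
qed

lemma sigma_0 [simp]: "\<sigma> 0 = 0" and sigma_1 [simp]: "\<sigma> 1 = 1"
  by simp_all

lemma sigma_eq_0_iff: "x \<in> k \<Longrightarrow> \<sigma> x = 0 \<longleftrightarrow> x = 0"
  using sigma_sigma sigma_0 by metis

lemma sigma_inverse: "x \<in> k \<Longrightarrow> \<sigma> (inverse x) = inverse (\<sigma> x)"
proof (cases "x = 0")
  case False
  assume x: "x \<in> k"
  have "\<sigma> x * \<sigma> (inverse x) = \<sigma> (x * inverse x)"
    using x by (intro sigma_mult[symmetric] subfield_inverse[OF subfield_k])
  thus ?thesis using False by (simp add: inverse_unique)
qed simp

lemma sigma_divide: "x \<in> k \<Longrightarrow> y \<in> k \<Longrightarrow> \<sigma> (x / y) = \<sigma> x / \<sigma> y"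
  unfolding divide_inverse by (simp add: sigma_mult sigma_inverse subfield_inverse[OF subfield_k])

lemma sigma_algebraic_int:
  assumes "x \<in> k" "algebraic_int x"
  shows "algebraic_int (\<sigma> x)"
proof -
  obtain p where p: "poly (map_poly of_int p) x = 0" "lead_coeff p = 1"
    using assms(2) unfolding algebraic_int_altdef_ipoly by auto
  have "poly (map_poly of_int q) x \<in> k \<and> \<sigma> (poly (map_poly of_int q) x) = poly (map_poly of_int q) (\<sigma> x)"
    for q :: "int poly"
  proof (induction q)
    case (pCons a q)
    have a: "of_int a \<in> k" by (rule subfield_of_int[OF subfield_k])
    have "x * poly (map_poly of_int q) x \<in> k" using assms pCons by (intro subfield_mult[OF subfield_k]) auto
    thus ?case using a pCons assms(1)
      by (auto simp: map_poly_pCons sigma_add sigma_mult intro: subfield_add[OF subfield_k])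
  qed (simp add: subfield_0[OF subfield_k])
  from this[of p] have "poly (map_poly of_int p) (\<sigma> x) = 0" using p by simp
  thus ?thesis using p(2) unfolding algebraic_int_altdef_ipoly by blast
qed

lemma sigma_R: "x \<in> R \<Longrightarrow> \<sigma> x \<in> R"
  using sigma_algebraic_int sigma_k by (simp add: ring_of_integers_def)

lemma trace_rat: "x \<in> k \<Longrightarrow> x + \<sigma> x \<in> gauss_rat"
  by (erule k_cases) auto

lemma nm_rep: "a \<in> gauss_rat \<Longrightarrow> b \<in> gauss_rat \<Longrightarrow> nm (a + b * \<eta>) = a\<^sup>2 - of_int D * b\<^sup>2"
proof -
  assume ab: "a \<in> gauss_rat" "b \<in> gauss_rat"
  have "nm (a + b * \<eta>) = a\<^sup>2 - (\<eta> * \<eta>) * b\<^sup>2"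
    unfolding nm_def sigma_eq[OF ab] by (simp add: power2_eq_square algebra_simps)
  thus ?thesis by (simp add: eta_sq)
qed

lemma nm_rat: "x \<in> k \<Longrightarrow> nm x \<in> gauss_rat"
  by (erule k_cases) (auto simp: nm_rep)

lemma nm_mult: "x \<in> k \<Longrightarrow> y \<in> k \<Longrightarrow> nm (x * y) = nm x * nm y"
  by (simp add: nm_def sigma_mult)

lemma nm_divide: "x \<in> k \<Longrightarrow> y \<in> k \<Longrightarrow> nm (x / y) = nm x / nm y"
  by (simp add: nm_def sigma_divide)

lemma nm_gauss_rat: "a \<in> gauss_rat \<Longrightarrow> nm a = a\<^sup>2"
  by (simp add: nm_def power2_eq_square)

lemma nm_eq_0_iff: "x \<in> k \<Longrightarrow> nm x = 0 \<longleftrightarrow> x = 0"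
  by (simp add: nm_def sigma_eq_0_iff)

lemma R_rat: "x \<in> R \<Longrightarrow> x \<in> gauss_rat \<Longrightarrow> x \<in> gauss"
  using algebraic_int_gauss_rat by (simp add: ring_of_integers_def)

lemma gauss_R: "x \<in> gauss \<Longrightarrow> x \<in> R"
  using gauss_algebraic_int gauss_rat_k gauss_in_gauss_rat by (simp add: ring_of_integers_def)

lemmas R_mult = roi_mult[OF subfield_k] and R_add = roi_add[OF subfield_k]
  and R_1 = roi_1[OF subfield_k] and R_mod = roi_mod[OF subfield_k]
  and k_mult = subfield_mult[OF subfield_k] and k_divide = subfield_divide[OF subfield_k]
  and k_inverse = subfield_inverse[OF subfield_k] and k_add = subfield_add[OF subfield_k]
  and k_1 = subfield_1[OF subfield_k]
  and k_of_int = subfield_of_int[OF subfield_k]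

lemma R_k: "x \<in> R \<Longrightarrow> x \<in> k" and R_algebraic_int: "x \<in> R \<Longrightarrow> algebraic_int x"
  by (simp_all add: ring_of_integers_def)

lemma eta_R: "\<eta> \<in> R"
  unfolding roi_iff[OF subfield_k] using eta_k
  by (auto simp: \<eta>_def)

lemma R_quadratic:
  assumes "z \<in> k" "z + \<sigma> z \<in> gauss" "nm z \<in> gauss"
  shows "z \<in> R"
proof -
  have "z\<^sup>2 = (z + \<sigma> z) * z - nm z" by (simp add: nm_def power2_eq_square algebra_simps)
  thus ?thesis using algebraic_int_gauss_quadratic[OF assms(2,3)] assms(1)
    by (simp add: ring_of_integers_def)
qed

lemma sigma_scl: "c \<in> k \<Longrightarrow> M \<subseteq> k \<Longrightarrow> \<sigma> ` scl c M = scl (\<sigma> c) (\<sigma> ` M)"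
  unfolding scl_def by (auto simp: image_image sigma_mult subset_eq intro!: image_cong)

lemma sigma_R_image: "\<sigma> ` R = R"
proof
  show "\<sigma> ` R \<subseteq> R" using sigma_R by auto
  show "R \<subseteq> \<sigma> ` R"
  proof
    fix x assume "x \<in> R"
    thus "x \<in> \<sigma> ` R" using sigma_R sigma_sigma[OF R_k] by (intro image_eqI[of _ _ "\<sigma> x"]) auto
  qed
qed

lemma is_mod_sigma: "is_mod R M \<Longrightarrow> M \<subseteq> k \<Longrightarrow> is_mod R (\<sigma> ` M)"
  unfolding is_mod_def
proof (intro conjI ballI)
  assume M: "0 \<in> M \<and> (\<forall>x\<in>M. \<forall>y\<in>M. x + y \<in> M) \<and> (\<forall>r\<in>R. \<forall>x\<in>M. r * x \<in> M)" and Mk: "M \<subseteq> k"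
  show "0 \<in> \<sigma> ` M" using M by (intro image_eqI[of _ _ 0]) auto
  fix x assume "x \<in> \<sigma> ` M"
  then obtain x' where x: "x' \<in> M" "x = \<sigma> x'" by auto
  {
    fix y assume "y \<in> \<sigma> ` M"
    then obtain y' where "y' \<in> M" "y = \<sigma> y'" by auto
    thus "x + y \<in> \<sigma> ` M" using x M Mk
      by (intro image_eqI[of _ _ "x' + y'"]) (auto simp: sigma_add subset_eq)
  }
  fix r assume r: "r \<in> R"
  hence "r * x = \<sigma> (\<sigma> r * x')" using x Mk sigma_R R_k by (simp add: sigma_mult sigma_sigma subset_eq)
  thus "r * x \<in> \<sigma> ` M" using x M sigma_R[OF r] by auto
qed

text \<open>Gauss's lemma for the extension: all products x * sigma y with x, y in I are divisible by
  the generator of the intersection of the product ideal with the Gaussian integers, because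
  the quotients have integral trace and norm.\<close>

lemma ideal_norm:
  assumes I: "I \<subseteq> R" "is_mod R I" and nz: "x0 \<in> I" "x0 \<noteq> 0"
  obtains b where "b \<in> gauss" "b \<noteq> 0" "sprod I (\<sigma> ` I) = scl b R"
proof -
  define P where "P = sprod I (\<sigma> ` I)"
  define S where "S = P \<inter> gauss"
  have Pmod: "is_mod R P" unfolding P_def by (rule is_mod_sprod[OF I(2)])
  have Pin: "x * \<sigma> y \<in> P" if "x \<in> I" "y \<in> I" for x y
    unfolding P_def using that by (intro sprod_mult) auto
  have Ik: "x \<in> k" if "x \<in> I" for x using that I R_k by auto
  have nmS: "nm x \<in> S" if "x \<in> I" for x
    unfolding S_def using Pin[OF that that] R_rat nm_rat[OF Ik[OF that]] sigma_R I that R_mult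
    by (auto simp: nm_def)
  have "S \<subseteq> gauss" by (simp add: S_def)
  moreover have "nm x0 \<in> S" "nm x0 \<noteq> 0" using nmS nz nm_eq_0_iff Ik by auto
  moreover have "x - y \<in> S" if "x \<in> S" "y \<in> S" for x y
  proof -
    have "- 1 \<in> R" by (rule gauss_R) auto
    hence "x + (- 1) * y \<in> P" using Pmod that unfolding S_def is_mod_def by blast
    thus ?thesis using that unfolding S_def by auto
  qed
  moreover have "r * x \<in> S" if "r \<in> gauss" "x \<in> S" for r x
    using that Pmod gauss_R unfolding S_def is_mod_def by auto
  ultimately obtain b where b: "b \<in> S" "b \<noteq> 0" "\<And>x. x \<in> S \<Longrightarrow> gdvd b x"
    using gauss_pid[of S "nm x0"] by blast
  have bg: "b \<in> gauss" "b \<in> k" using b(1) gauss_in_gauss_rat gauss_rat_k by (auto simp: S_def)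
  have bdiv: "x / b \<in> gauss" if "x \<in> S" for x
    using b(3)[OF that] b(2) unfolding gdvd_def by auto
  have zR: "x * \<sigma> y / b \<in> R" if xy: "x \<in> I" "y \<in> I" for x y
  proof (rule R_quadratic)
    have xk: "x \<in> k" "y \<in> k" "\<sigma> y \<in> k" using xy Ik sigma_k by auto
    show "x * \<sigma> y / b \<in> k" using xk bg by (intro k_divide k_mult)
    have cb: "\<sigma> b = b" using bg(1) gauss_in_gauss_rat by simp
    have c: "\<sigma> (x * \<sigma> y / b) = y * \<sigma> x / b"
      using xk bg(2) by (simp add: sigma_divide sigma_mult k_mult sigma_sigma cb)
    have "x * \<sigma> y + y * \<sigma> x \<in> S"
    proof -
      have P: "x * \<sigma> y + y * \<sigma> x \<in> P" using Pin xy Pmod unfolding is_mod_def by blast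
      have "\<sigma> (x * \<sigma> y) = y * \<sigma> x" using xk by (simp add: sigma_mult sigma_sigma)
      hence "x * \<sigma> y + y * \<sigma> x \<in> gauss_rat" using trace_rat[of "x * \<sigma> y"] xk k_mult by auto
      moreover have "x * \<sigma> y + y * \<sigma> x \<in> R" using xy I sigma_R R_add R_mult by (meson subsetD)
      ultimately show ?thesis using P R_rat unfolding S_def by auto
    qed
    from bdiv[OF this] show "x * \<sigma> y / b + \<sigma> (x * \<sigma> y / b) \<in> gauss"
      unfolding c by (simp add: add_divide_distrib)
    have "nm (x * \<sigma> y / b) = (nm x / b) * (nm y / b)"
      unfolding nm_def c by simp
    also have "\<dots> \<in> gauss" using bdiv nmS xy by (intro gauss_mult) auto
    finally show "nm (x * \<sigma> y / b) \<in> gauss" .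
  qed
  have "P \<subseteq> scl b R" unfolding P_def
  proof (rule sprod_least)
    fix x y assume "x \<in> I" "y \<in> \<sigma> ` I"
    then obtain y' where "y' \<in> I" "y = \<sigma> y'" by auto
    thus "x * y \<in> scl b R" unfolding scl_def using zR[OF \<open>x \<in> I\<close>, of y'] b(2)
      by (intro image_eqI[of _ _ "x * y / b"]) auto
  qed (use is_mod_scl[OF R_mod, of b] in \<open>auto simp: is_mod_def\<close>)
  moreover have "scl b R \<subseteq> P"
    using b(1) Pmod unfolding S_def scl_def is_mod_def by (auto simp: mult.commute)
  ultimately have "P = scl b R" by blast
  thus ?thesis using that bg b(2) unfolding P_def by blast
qed

lemma scl_R_eq_unit:
  assumes "scl a R = scl b R" "a \<in> gauss_rat" "b \<in> gauss_rat" "b \<noteq> 0"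
  shows "a / b \<in> {1, -1, \<i>, -\<i>}"
proof -
  have "a \<noteq> 0"
  proof
    assume "a = 0"
    hence "scl b R \<subseteq> {0}" using assms(1) by (auto simp: scl_def)
    thus False using scl_ring_mem[OF R_1, of b] assms(4) by auto
  qed
  have "a \<in> scl b R" "b \<in> scl a R" using scl_ring_mem[OF R_1] assms(1) by auto
  then obtain r r' where "r \<in> R" "a = b * r" "r' \<in> R" "b = a * r'"
    unfolding scl_def by blast
  moreover from this have "a / b = r" "b / a = r'" using assms(4) \<open>a \<noteq> 0\<close> by (metis nonzero_mult_div_cancel_left)+
  ultimately have "a / b \<in> R" "b / a \<in> R" by simp_all
  hence "a / b \<in> gauss" "b / a \<in> gauss" using assms R_rat by auto
  thus ?thesis using \<open>a \<noteq> 0\<close> assms(4) by (intro gauss_unit_cases[of _ "b / a"]) auto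
qed

definition ambiguous :: "complex set \<Rightarrow> complex \<Rightarrow> bool" where
  "ambiguous J n \<longleftrightarrow> is_mod R J \<and> J \<subseteq> k \<and> \<sigma> ` J = J \<and> n \<in> gauss_rat \<and> n \<noteq> 0 \<and> sprod J J = scl n R"

lemma gauss_unit_R: "u \<in> {1, -1, \<i>, -\<i>} \<Longrightarrow> u \<in> R \<and> inverse u \<in> R"
  by (auto intro!: gauss_R gauss_minus)

lemma ambiguous_scl:
  assumes "ambiguous J n" "g \<in> gauss_rat" "g \<noteq> 0"
  shows "ambiguous (scl g J) (g\<^sup>2 * n)"
proof -
  have J: "is_mod R J" "J \<subseteq> k" "\<sigma> ` J = J" "n \<in> gauss_rat" "n \<noteq> 0" "sprod J J = scl n R"
    using assms(1) unfolding ambiguous_def by auto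
  have "scl g J \<subseteq> k" using J(2) gauss_rat_k[OF assms(2)] k_mult by (auto simp: scl_def)
  moreover have "\<sigma> ` scl g J = scl g J"
    unfolding sigma_scl[OF gauss_rat_k[OF assms(2)] J(2)] J(3) using assms(2) by simp
  moreover have "sprod (scl g J) (scl g J) = scl (g\<^sup>2 * n) R"
    unfolding sprod_scl sprod_scl_right J(6) scl_scl by (simp add: power2_eq_square mult.assoc)
  ultimately show ?thesis using J assms is_mod_scl unfolding ambiguous_def by auto
qed

text \<open>Hilbert 90: if the square of I is principal, then I differs from its conjugate by a
  factor whose norm is a unit; once this norm is 1 the factor is a quotient of conjugates.\<close>

lemma square_principal_ambiguous:
  assumes I: "I \<subseteq> R" "is_mod R I" "x0 \<in> I" "x0 \<noteq> 0"
    and sq: "sprod I I = scl \<alpha> R" "\<alpha> \<noteq> 0"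
    and units: "\<And>\<beta>. \<beta> \<in> k \<Longrightarrow> nm \<beta> \<in> {1, -1, \<i>, -\<i>} \<Longrightarrow>
      \<exists>\<omega>. \<omega> \<in> R \<and> inverse \<omega> \<in> R \<and> \<omega> \<noteq> 0 \<and> nm \<omega> = nm \<beta>"
    and b: "b \<in> gauss" "b \<noteq> 0" "sprod I (\<sigma> ` I) = scl b R"
  obtains g where "g \<in> k" "g \<noteq> 0" "ambiguous (scl g I) (nm g * b)"
proof -
  have Ik: "I \<subseteq> k" using I R_k by auto
  have cI: "is_mod R (\<sigma> ` I)" by (rule is_mod_sigma[OF I(2) Ik])
  have ak: "\<alpha> \<in> k"
  proof -
    have "\<alpha> \<in> sprod I I" unfolding sq by (rule scl_ring_mem[OF R_1])
    moreover have "sprod I I \<subseteq> k"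
    proof (rule sprod_least)
      fix a b assume "a \<in> I" "b \<in> I"
      thus "a * b \<in> k" using Ik by (intro k_mult) auto
    qed (auto intro: k_add subfield_0[OF subfield_k])
    ultimately show ?thesis by blast
  qed
  have bk: "b \<in> k" "b \<in> gauss_rat" using b gauss_in_gauss_rat gauss_rat_k by auto
  have "scl \<alpha> (\<sigma> ` I) = sprod (scl \<alpha> R) (\<sigma> ` I)"
    unfolding sprod_scl sprod_ring_left[OF cI R_1] ..
  also have "\<dots> = sprod I (scl b R)" unfolding sq(1)[symmetric] sprod_assoc b(3) ..
  also have "\<dots> = scl b I" unfolding sprod_scl_right by (simp add: sprod_comm[of I] sprod_ring_left[OF I(2) R_1])
  finally have ab: "scl \<alpha> (\<sigma> ` I) = scl b I" .
  define \<beta> where "\<beta> = \<alpha> / b"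
  have bek: "\<beta> \<in> k" "\<beta> \<noteq> 0" using ak bk sq b by (auto simp: \<beta>_def intro: k_divide)
  have bI: "scl \<beta> (\<sigma> ` I) = I"
  proof -
    have "scl \<beta> (\<sigma> ` I) = scl (inverse b) (scl \<alpha> (\<sigma> ` I))" by (simp add: scl_scl \<beta>_def divide_inverse mult.commute)
    also have "\<dots> = I" unfolding ab scl_scl using b by simp
    finally show ?thesis .
  qed
  have ccI: "\<sigma> ` \<sigma> ` I = I" using Ik sigma_sigma by (force simp: image_image subset_eq)
  have cIk: "\<sigma> ` I \<subseteq> k" using Ik sigma_k by auto
  have "scl (\<sigma> \<beta>) I = \<sigma> ` I"
  proof -
    have "\<sigma> ` I = \<sigma> ` scl \<beta> (\<sigma> ` I)" using bI by simp
    also have "\<dots> = scl (\<sigma> \<beta>) I" using sigma_scl[OF bek(1) cIk] ccI by simp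
    finally show ?thesis ..
  qed
  hence "scl (nm \<beta>) I = I" using bI by (simp add: nm_def scl_scl[symmetric])
  hence "scl (nm \<beta>) (sprod I (\<sigma> ` I)) = sprod I (\<sigma> ` I)" by (metis sprod_scl)
  hence "scl (nm \<beta> * b) R = scl b R" unfolding b(3) scl_scl .
  from scl_R_eq_unit[OF this] have "nm \<beta> \<in> {1, -1, \<i>, -\<i>}" using nm_rat[OF bek(1)] bk b by auto
  then obtain \<omega> where w: "\<omega> \<in> R" "inverse \<omega> \<in> R" "\<omega> \<noteq> 0" "nm \<omega> = nm \<beta>"
    using units[OF bek(1)] by blast
  define \<beta>' where "\<beta>' = inverse \<omega> * \<beta>"
  have b'k: "\<beta>' \<in> k" "\<beta>' \<noteq> 0" using bek w R_k by (auto simp: \<beta>'_def intro: k_mult)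
  have b'I: "scl \<beta>' (\<sigma> ` I) = I"
  proof -
    have "scl \<beta>' (\<sigma> ` I) = scl (inverse \<omega>) I" unfolding \<beta>'_def scl_scl[symmetric] bI ..
    thus ?thesis using scl_unit[OF I(2) w(2)] w by simp
  qed
  have n1: "\<beta>' * \<sigma> \<beta>' = 1"
  proof -
    have "nm \<beta>' = nm \<beta> / nm \<omega>"
      using nm_divide[OF bek(1) R_k[OF w(1)]] by (simp add: \<beta>'_def divide_inverse mult.commute)
    thus ?thesis using w nm_eq_0_iff[OF bek(1)] bek(2) by (simp add: nm_def)
  qed
  obtain \<gamma> where g: "\<gamma> \<in> k" "\<gamma> \<noteq> 0" "\<gamma> = \<beta>' * \<sigma> \<gamma>"
  proof (cases "\<beta>' = -1")
    case True
    thus ?thesis using that[of \<eta>] eta_k eta_nonzero sigma_eta by simp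
  next
    case False
    have "\<sigma> (1 + \<beta>') = 1 + \<sigma> \<beta>'" using b'k k_1 by (simp add: sigma_add)
    hence "\<beta>' * \<sigma> (1 + \<beta>') = 1 + \<beta>'" using n1 by (simp add: algebra_simps)
    moreover have "1 + \<beta>' \<noteq> 0" using False by (metis add.commute add_eq_0_iff)
    ultimately show ?thesis using that[of "1 + \<beta>'"] b'k k_1 k_add by auto
  qed
  define h where "h = inverse \<gamma>"
  have h: "h \<in> k" "h \<noteq> 0" using g by (auto simp: h_def intro: k_inverse)
  have ch: "\<sigma> h = h * \<beta>'"
  proof -
    have "\<sigma> h = inverse (\<sigma> \<gamma>)" using g by (simp add: h_def sigma_inverse)
    moreover have "h * \<beta>' * \<sigma> \<gamma> = 1" using g by (simp add: h_def mult.assoc)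
    ultimately show ?thesis using inverse_unique[of "\<sigma> \<gamma>" "h * \<beta>'"] by (simp add: mult.commute)
  qed
  define J where "J = scl h I"
  have cJ: "\<sigma> ` J = J"
  proof -
    have "\<sigma> ` J = scl (\<sigma> h) (\<sigma> ` I)" unfolding J_def by (rule sigma_scl[OF h(1) Ik])
    also have "\<dots> = scl h (scl \<beta>' (\<sigma> ` I))" by (simp add: ch scl_scl)
    finally show ?thesis by (simp add: b'I J_def)
  qed
  have "sprod J J = sprod J (\<sigma> ` J)" by (simp add: cJ)
  also have "\<dots> = sprod (scl h I) (scl (\<sigma> h) (\<sigma> ` I))" unfolding J_def sigma_scl[OF h(1) Ik] ..
  also have "\<dots> = scl (nm h * b) R" by (simp add: sprod_scl sprod_scl_right scl_scl b(3) nm_def mult_ac)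
  finally have "sprod J J = scl (nm h * b) R" .
  moreover have "J \<subseteq> k" using Ik h by (auto simp: J_def scl_def intro: k_mult)
  ultimately have "ambiguous J (nm h * b)" unfolding ambiguous_def
    using is_mod_scl[OF I(2), of h] cJ nm_rat[OF h(1)] bk nm_eq_0_iff[OF h(1)] h(2) b(2) by (auto simp: J_def)
  thus ?thesis using that h unfolding J_def by blast
qed

lemma ambiguous_squarefree:
  assumes "ambiguous J n"
  obtains g d where "g \<in> gauss_rat" "g \<noteq> 0" "gsquarefree d" "d = g\<^sup>2 * n" "ambiguous (scl g J) d"
    "scl g J \<subseteq> R" "gdvd d (of_int (2 * D))"
proof -
  have n: "n \<in> gauss_rat" "n \<noteq> 0" using assms unfolding ambiguous_def by auto
  obtain t :: int where t: "t > 0" "of_int t * n \<in> gauss" using gauss_rat_denominator[OF n(1)] .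
  have "of_int t * (of_int t * n) \<in> gauss" "of_int t * (of_int t * n) \<noteq> 0" using t n by auto
  then obtain m d where m: "m \<in> gauss" "m \<noteq> 0" "gsquarefree d" "of_int t * (of_int t * n) = m\<^sup>2 * d"
    by (rule gsquarefree_decomp)
  define g where "g = of_int t / m"
  have g: "g \<in> gauss_rat" "g \<noteq> 0" using t m gauss_in_gauss_rat by (auto simp: g_def)
  have d: "d = g\<^sup>2 * n" using m(2,4) by (simp add: g_def power2_eq_square field_simps)
  define J0 where "J0 = scl g J"
  have am: "ambiguous J0 d" unfolding J0_def d by (rule ambiguous_scl[OF assms g])
  have J0: "is_mod R J0" "J0 \<subseteq> k" "\<sigma> ` J0 = J0" "sprod J0 J0 = scl d R"
    using am unfolding ambiguous_def by auto
  have dg: "d \<in> gauss" "d \<noteq> 0" using m(3) unfolding gsquarefree_def by auto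
  have prodR: "x * y / d \<in> R" if "x \<in> J0" "y \<in> J0" for x y
  proof -
    have "x * y \<in> scl d R" using sprod_mult[OF that] J0(4) by simp
    thus ?thesis using dg by (auto simp: scl_def)
  qed
  have J0R: "J0 \<subseteq> R"
  proof
    fix x assume x: "x \<in> J0"
    have "d * (x * x / d) \<in> R" using R_mult[OF gauss_R[OF dg(1)] prodR[OF x x]] .
    hence "algebraic_int (x\<^sup>2)" using dg R_algebraic_int by (simp add: power2_eq_square)
    thus "x \<in> R" using algebraic_int_of_square x J0(2) by (auto simp: ring_of_integers_def)
  qed
  have dvd: "gdvd d x" if "x \<in> J0" "x \<in> gauss_rat" for x
  proof -
    have xg: "x \<in> gauss" using that J0R R_rat by auto
    have "x * x / d \<in> gauss" using R_rat[OF prodR[OF that(1,1)]] that(2) dg gauss_in_gauss_rat by auto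
    hence "gdvd d (x\<^sup>2)" unfolding gdvd_def using dg
      by (intro bexI[of _ "x * x / d"]) (auto simp: power2_eq_square)
    thus ?thesis by (rule gsquarefree_dvd_power2D[OF m(3) xg])
  qed
  have key: "2 * of_int D * x / d \<in> R" if x: "x \<in> J0" for x
  proof -
    have xk: "x \<in> k" using x J0 by auto
    have cx: "\<sigma> x \<in> J0" using x J0(3) by auto
    have a: "x + \<sigma> x \<in> J0" using x cx J0(1) unfolding is_mod_def by auto
    have "- 1 \<in> R" by (rule gauss_R) auto
    hence "x + (- 1) * \<sigma> x \<in> J0" using x cx J0(1) unfolding is_mod_def by blast
    hence c: "\<eta> * (x - \<sigma> x) \<in> J0" using eta_R J0(1) unfolding is_mod_def by auto
    obtain u v where uv: "u \<in> gauss_rat" "v \<in> gauss_rat" "x = u + v * \<eta>" "\<sigma> x = u - v * \<eta>"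
      using k_cases[OF xk] .
    have "\<eta> * (x - \<sigma> x) = 2 * v * (\<eta> * \<eta>)" unfolding uv(3) uv(4)[unfolded uv(3)] by (simp add: algebra_simps)
    moreover have "2 * v * (\<eta> * \<eta>) \<in> gauss_rat"
      unfolding eta_sq using uv(2) by (intro gauss_rat_mult) auto
    ultimately have crat: "\<eta> * (x - \<sigma> x) \<in> gauss_rat" by (simp only:)
    obtain a' where a': "a' \<in> gauss" "x + \<sigma> x = d * a'" using dvd[OF a trace_rat[OF xk]] unfolding gdvd_def by auto
    obtain c' where c': "c' \<in> gauss" "\<eta> * (x - \<sigma> x) = d * c'" using dvd[OF c crat] unfolding gdvd_def by auto
    have "2 * of_int D * x = of_int D * (x + \<sigma> x) + (\<eta> * \<eta>) * (x - \<sigma> x)"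
      unfolding eta_sq by (simp add: algebra_simps)
    also have "\<dots> = of_int D * (x + \<sigma> x) + \<eta> * (\<eta> * (x - \<sigma> x))" by (simp only: mult.assoc)
    also have "\<dots> = d * (of_int D * a' + \<eta> * c')" unfolding a' c' by (simp add: algebra_simps)
    finally have "2 * of_int D * x / d = of_int D * a' + \<eta> * c'" using dg by simp
    moreover have "of_int D * a' + \<eta> * c' \<in> R"
      using R_mult[OF eta_R gauss_R[OF c'(1)]] R_add gauss_R[OF gauss_mult[OF gauss_of_int a'(1)]] by blast
    ultimately show ?thesis by simp
  qed
  have "sprod J0 J0 \<subseteq> {z. (2 * of_int D)\<^sup>2 * z / d\<^sup>2 \<in> R}"
  proof (rule sprod_least)
    fix x y assume "x \<in> J0" "y \<in> J0"
    from R_mult[OF key[OF this(1)] key[OF this(2)]]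
    show "x * y \<in> {z. (2 * of_int D)\<^sup>2 * z / d\<^sup>2 \<in> R}" by (simp add: power2_eq_square mult_ac)
  next
    fix x y assume "x \<in> {z. (2 * of_int D)\<^sup>2 * z / d\<^sup>2 \<in> R}" "y \<in> {z. (2 * of_int D)\<^sup>2 * z / d\<^sup>2 \<in> R}"
    thus "x + y \<in> {z. (2 * of_int D)\<^sup>2 * z / d\<^sup>2 \<in> R}"
      using R_add by (simp add: distrib_left add_divide_distrib)
  qed (simp add: roi_0[OF subfield_k])
  moreover have "d \<in> sprod J0 J0" unfolding J0(4) by (rule scl_ring_mem[OF R_1])
  ultimately have "(2 * of_int D)\<^sup>2 * d / d\<^sup>2 \<in> R" by blast
  hence "(2 * of_int D)\<^sup>2 / d \<in> R" using dg by (simp add: power2_eq_square)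
  moreover have "(2 * of_int D)\<^sup>2 / d \<in> gauss_rat" using dg gauss_in_gauss_rat by auto
  ultimately have "(2 * of_int D)\<^sup>2 / d \<in> gauss" by (rule R_rat)
  hence "gdvd d ((of_int (2 * D))\<^sup>2)" unfolding gdvd_def using dg
    by (intro bexI[of _ "(2 * of_int D)\<^sup>2 / d"]) auto
  hence "gdvd d (of_int (2 * D))" by (rule gsquarefree_dvd_power2D[OF m(3) gauss_of_int])
  thus ?thesis using that g m(3) d am J0R unfolding J0_def by blast
qed

lemma ambiguous_principal:
  assumes J: "ambiguous J n" and s: "s \<in> k" "s \<noteq> 0" "u \<in> R" "inverse u \<in> R" "u \<noteq> 0" "n = u * s\<^sup>2"
  shows "J = scl s R"
proof (rule sprod_square_principal[OF R_mod R_1])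
  have am: "is_mod R J" "J \<subseteq> k" "sprod J J = scl n R" using J unfolding ambiguous_def by auto
  show "J \<subseteq> k" "is_mod R J" "J \<subseteq> J" using am by auto
  show "J \<subseteq> sprod R J" using sprod_ring_left[OF am(1) R_1] by simp
  show "x / s \<in> k" if "x \<in> k" for x using that s by (intro k_divide)
  show "u * s\<^sup>2 \<in> sprod J J" using scl_ring_mem[OF R_1, of n] s am by simp
  show "x\<^sup>2 / s\<^sup>2 \<in> R" if "x \<in> J" for x
  proof -
    have "x * x \<in> scl n R" using sprod_mult[OF that that] am by simp
    then obtain r where "r \<in> R" "x * x = u * s\<^sup>2 * r" using s by (auto simp: scl_def)
    hence "x\<^sup>2 / s\<^sup>2 = u * r" using s by (simp add: power2_eq_square)
    thus ?thesis using R_mult[OF s(3) \<open>r \<in> R\<close>] by simp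
  qed
qed (use s in \<open>auto simp: ring_of_integers_def\<close>)

end

section \<open>Squares up to units\<close>

definition unit_square :: "complex set \<Rightarrow> complex \<Rightarrow> bool" where
  "unit_square K a \<longleftrightarrow> (\<exists>s u. s \<in> K \<and> s \<noteq> 0 \<and> u \<in> ring_of_integers K \<and> inverse u \<in> ring_of_integers K
     \<and> u \<noteq> 0 \<and> a = u * s\<^sup>2)"

lemma unit_squareI:
  "s \<in> K \<Longrightarrow> s \<noteq> 0 \<Longrightarrow> u \<in> ring_of_integers K \<Longrightarrow> inverse u \<in> ring_of_integers K \<Longrightarrow> u \<noteq> 0
    \<Longrightarrow> unit_square K (u * s\<^sup>2)"
  unfolding unit_square_def by blast

lemma ring_of_integers_mono: "K \<subseteq> L \<Longrightarrow> ring_of_integers K \<subseteq> ring_of_integers L"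
  unfolding ring_of_integers_def by auto

lemma unit_square_mono: "K \<subseteq> L \<Longrightarrow> unit_square K a \<Longrightarrow> unit_square L a"
  unfolding unit_square_def using ring_of_integers_mono by blast

context
  fixes K :: "complex set"
  assumes K: "subfield_C K"
begin

lemma unit_square_mult: "unit_square K a \<Longrightarrow> unit_square K b \<Longrightarrow> unit_square K (a * b)"
proof -
  assume "unit_square K a" "unit_square K b"
  then obtain s u t v where su: "s \<in> K" "s \<noteq> 0" "u \<in> ring_of_integers K" "inverse u \<in> ring_of_integers K"
    "u \<noteq> 0" "a = u * s\<^sup>2" and tv: "t \<in> K" "t \<noteq> 0" "v \<in> ring_of_integers K" "inverse v \<in> ring_of_integers K"
    "v \<noteq> 0" "b = v * t\<^sup>2" unfolding unit_square_def by blast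
  have "unit_square K ((u * v) * (s * t)\<^sup>2)"
    using su tv by (intro unit_squareI) (auto intro: subfield_mult[OF K] roi_mult[OF K])
  thus ?thesis using su tv by (simp add: power_mult_distrib mult_ac)
qed

lemma unit_square_square: "s \<in> K \<Longrightarrow> s \<noteq> 0 \<Longrightarrow> unit_square K (s\<^sup>2)"
  using unit_squareI[of s K 1] roi_1[OF K] by simp

lemma unit_square_unit:
  "u \<in> ring_of_integers K \<Longrightarrow> inverse u \<in> ring_of_integers K \<Longrightarrow> u \<noteq> 0 \<Longrightarrow> unit_square K u"
  using unit_squareI[OF subfield_1[OF K], of u] by simp

lemma unit_square_power: "unit_square K a \<Longrightarrow> unit_square K (a ^ n)"
  by (induction n) (use unit_square_mult unit_square_square[OF subfield_1[OF K]] in auto)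

lemma unit_square_gauss_unit:
  assumes "\<i> \<in> K" "u \<in> {1, -1, \<i>, -\<i>}"
  shows "unit_square K u"
proof -
  have "- \<i> \<in> K" "- 1 \<in> K" using subfield_minus[OF K] assms(1) subfield_1[OF K] by auto
  thus ?thesis using assms subfield_1[OF K]
    by (intro unit_square_unit) (auto simp: ring_of_integers_def)
qed

lemma unit_square_divide:
  assumes "unit_square K a" "unit_square K b"
  shows "unit_square K (a / b)"
proof -
  obtain t v where tv: "t \<in> K" "t \<noteq> 0" "v \<in> ring_of_integers K" "inverse v \<in> ring_of_integers K"
    "v \<noteq> 0" "b = v * t\<^sup>2" using assms(2) unfolding unit_square_def by blast
  have "unit_square K (inverse v * (inverse t)\<^sup>2)"
    using tv by (intro unit_squareI) (auto intro: subfield_inverse[OF K])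
  from unit_square_mult[OF assms(1) this] show ?thesis
    using tv by (simp add: divide_inverse power_inverse mult_ac)
qed

text \<open>With z a primitive 8th root of unity, (1 + z)^2 = (1 + i)(1 + sqrt 2).\<close>

lemma unit_square_one_plus_ii:
  assumes "\<i> \<in> K" "complex_of_real (sqrt 2) \<in> K"
  shows "unit_square K (1 + \<i>)"
proof -
  define r where "r = complex_of_real (sqrt 2)"
  have r: "r * r = 2" "r \<noteq> 0" "r \<in> K" using assms(2) by (simp_all add: r_def flip: of_real_mult)
  define s where "s = 1 + (1 + \<i>) / r"
  have s: "s \<in> K" unfolding s_def using assms(1) r subfield_1[OF K]
    by (intro subfield_add[OF K] subfield_divide[OF K])
  have alg: "algebraic_int r" by (auto simp: r_def)
  have u: "r - 1 \<in> ring_of_integers K" "1 + r \<in> ring_of_integers K"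
    using r(3) alg subfield_1[OF K] by (auto simp: ring_of_integers_def
        intro!: subfield_add[OF K] subfield_diff[OF K] algebraic_int_plus_times algebraic_int_diff)
  have inv: "(r - 1) * (1 + r) = 1" using r(1) by (simp add: algebra_simps)
  hence n: "r - 1 \<noteq> 0" "1 + r \<noteq> 0" by auto
  have "inverse (r - 1) = 1 + r" using inv by (rule inverse_unique)
  have ss: "s\<^sup>2 = (1 + \<i>) * (1 + r)"
  proof -
    have "r * r * s\<^sup>2 = (r + (1 + \<i>))\<^sup>2" using r(2) by (simp add: s_def power2_eq_square field_simps)
    also have "\<dots> = r * r + 2 * r * (1 + \<i>) + (1 + \<i>)\<^sup>2" by (simp add: power2_eq_square algebra_simps)
    also have "\<dots> = 2 * ((1 + \<i>) * (1 + r))" unfolding r(1) by (simp add: power2_eq_square algebra_simps)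
    finally show ?thesis unfolding r(1) by simp
  qed
  have "1 + \<i> \<noteq> 0" by (simp add: complex_eq_iff)
  hence "(1 + \<i>) * (1 + r) \<noteq> 0" using n(2) by (rule no_zero_divisors)
  hence "s \<noteq> 0" using ss by auto
  have "unit_square K ((r - 1) * s\<^sup>2)"
    using s \<open>s \<noteq> 0\<close> u n \<open>inverse (r - 1) = 1 + r\<close> by (intro unit_squareI) auto
  moreover have "(r - 1) * s\<^sup>2 = (1 + \<i>) * ((r - 1) * (1 + r))" unfolding ss by (simp add: mult_ac)
  ultimately show ?thesis unfolding inv by simp
qed

end

section \<open>Squarefree divisors\<close>

lemma gsquarefree_factor:
  assumes "gsquarefree (a * b)" "a \<in> gauss" "b \<in> gauss"
  shows "gsquarefree b"
  unfolding gsquarefree_def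
proof (intro conjI ballI impI)
  show "b \<noteq> 0" using assms(1) unfolding gsquarefree_def by auto
  fix q assume q: "q \<in> gauss" "gdvd (q\<^sup>2) b"
  have "gdvd (q\<^sup>2) (a * b)" using gdvd_mult_left[OF q(2) assms(2)] .
  thus "gnorm q = 1" using assms(1) q(1) unfolding gsquarefree_def by blast
qed fact

lemma gsquarefree_strip:
  assumes pi: "gprime \<pi>" and c: "c \<in> gauss"
  shows "gsquarefree d \<Longrightarrow> gdvd d (\<pi> ^ n * c) \<Longrightarrow>
    \<exists>e d'. e \<le> (1 :: nat) \<and> gsquarefree d' \<and> d = \<pi> ^ e * d' \<and> gdvd d' c"
proof (induction n arbitrary: d)
  case 0
  thus ?case by (intro exI[of _ 0] exI[of _ d]) auto
next
  case (Suc n)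
  have pg: "\<pi> \<in> gauss" using pi unfolding gprime_def by auto
  have d: "d \<in> gauss" using Suc.prems(1) unfolding gsquarefree_def by auto
  have "\<pi> ^ n * c \<in> gauss" using pg c by (intro gauss_mult gauss_power)
  moreover have "gdvd d (\<pi> * (\<pi> ^ n * c))" using Suc.prems(2) by (simp add: mult.assoc)
  ultimately consider "gdvd d (\<pi> ^ n * c)" | d' where "d' \<in> gauss" "d = \<pi> * d'" "gdvd d' (\<pi> ^ n * c)"
    using gdvd_gprime_mult_cases[OF pi d] by blast
  thus ?case
  proof cases
    case 1
    thus ?thesis using Suc.IH Suc.prems(1) by blast
  next
    case 2
    have sf: "gsquarefree d'" using gsquarefree_factor[of \<pi> d'] Suc.prems(1) 2 pg by auto
    from Suc.IH[OF this 2(3)] obtain e d'' where e: "e \<le> 1" "gsquarefree d''" "d' = \<pi> ^ e * d''" "gdvd d'' c"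
      by blast
    have "e = 0"
    proof (rule ccontr)
      assume "e \<noteq> 0"
      hence "d = \<pi>\<^sup>2 * d''" using e 2 by (simp add: le_Suc_eq power2_eq_square)
      moreover have "d'' \<in> gauss" using e(2) unfolding gsquarefree_def by auto
      ultimately have "gdvd (\<pi>\<^sup>2) d" unfolding gdvd_def by blast
      hence "gnorm \<pi> = 1" using Suc.prems(1) pg unfolding gsquarefree_def by blast
      thus False using pi unfolding gprime_def by auto
    qed
    thus ?thesis using e 2 by (intro exI[of _ 1] exI[of _ d'']) auto
  qed
qed

lemma gdvd_unit_cases:
  assumes "gsquarefree d" "gdvd d u" "u \<in> {1, -1, \<i>, -\<i>}"
  shows "d \<in> {1, -1, \<i>, -\<i>}"
proof -
  obtain c where c: "c \<in> gauss" "u = d * c" using assms(2) unfolding gdvd_def by auto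
  have u: "u \<in> gauss" "u * cnj u = 1" using assms(3) by auto
  have "d * (c * cnj u) = 1" using u c by (simp add: mult.assoc)
  thus ?thesis using c u assms(1) by (intro gauss_unit_cases[of _ "c * cnj u"]) (auto simp: gsquarefree_def)
qed

lemma gprime_one_plus_ii: "gprime (1 + \<i>)" "gnorm (1 + \<i>) = 2"
proof -
  have "(cmod (1 + \<i>))\<^sup>2 = 2" by (simp add: cmod_power2)
  thus "gnorm (1 + \<i>) = 2" by (simp add: gnorm_def)
  thus "gprime (1 + \<i>)" unfolding gprime_def by auto
qed

lemma one_plus_ii_powers: "(1 + \<i>)\<^sup>2 = 2 * \<i>" "(1 + \<i>) ^ 4 = - 4"
  by (simp_all add: complex_eq_iff power2_eq_square eval_nat_numeral)

lemma gsquarefree_dvd_4: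
  assumes "gsquarefree d" "gdvd d 4"
  obtains u a where "u \<in> {1, -1, \<i>, -\<i>}" "a \<le> (1 :: nat)" "d = u * (1 + \<i>) ^ a"
proof -
  have "gdvd d ((1 + \<i>) ^ 4 * (-1))" using assms(2) unfolding one_plus_ii_powers by simp
  from gsquarefree_strip[OF gprime_one_plus_ii(1) _ assms(1) this]
  obtain a d' where "a \<le> 1" "gsquarefree d'" "d = (1 + \<i>) ^ a * d'" "gdvd d' (-1)" by auto
  thus ?thesis using that[of d' a] gdvd_unit_cases[of d' "-1"] by (auto simp: mult.commute)
qed

lemma gsquarefree_dvd_2p:
  assumes "gsquarefree d" "gdvd d (of_int (2 * p))" and pi: "gprime \<pi>" "gnorm \<pi> = p"
  obtains u a b b' where "u \<in> {1, -1, \<i>, -\<i>}" "a \<le> (1 :: nat)" "b \<le> (1 :: nat)" "b' \<le> (1 :: nat)"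
    "d = u * (1 + \<i>) ^ a * \<pi> ^ b * cnj \<pi> ^ b'"
proof -
  have pg: "\<pi> \<in> gauss" "cnj \<pi> \<in> gauss" using pi unfolding gprime_def by auto
  have p: "of_int p = \<pi> * cnj \<pi>" using gnorm_cnj_mult[OF pg(1)] pi by simp
  have "of_int (2 * p) = (1 + \<i>) ^ 2 * (\<pi> ^ 1 * (cnj \<pi> ^ 1 * (- \<i>)))"
    unfolding one_plus_ii_powers by (simp add: p)
  hence "gdvd d ((1 + \<i>) ^ 2 * (\<pi> ^ 1 * (cnj \<pi> ^ 1 * (- \<i>))))" using assms(2) by (simp only:)
  from gsquarefree_strip[OF gprime_one_plus_ii(1) _ assms(1) this]
  obtain a d1 where 1: "a \<le> 1" "gsquarefree d1" "d = (1 + \<i>) ^ a * d1"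
    "gdvd d1 (\<pi> ^ 1 * (cnj \<pi> ^ 1 * (- \<i>)))" using pg by auto
  from gsquarefree_strip[OF pi(1) _ 1(2,4)]
  obtain b d2 where 2: "b \<le> 1" "gsquarefree d2" "d1 = \<pi> ^ b * d2"
    "gdvd d2 (cnj \<pi> ^ 1 * (- \<i>))" using pg by auto
  from gsquarefree_strip[OF gprime_cnj[OF pi(1)] _ 2(2,4)]
  obtain b' d3 where 3: "b' \<le> 1" "gsquarefree d3" "d2 = cnj \<pi> ^ b' * d3" "gdvd d3 (- \<i>)" by auto
  have "d3 \<in> {1, -1, \<i>, -\<i>}" using gdvd_unit_cases[OF 3(2,4)] by simp
  moreover have "d = d3 * (1 + \<i>) ^ a * \<pi> ^ b * cnj \<pi> ^ b'"
    unfolding 1(3) 2(3) 3(3) by (simp only: mult_ac)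
  ultimately show ?thesis using that 1(1) 2(1) 3(1) by blast
qed

lemma gsquarefree_dvd_4pq:
  assumes "gsquarefree d" "gdvd d (of_int (2 * (2 * p * q)))"
    and pi: "gprime \<pi>" "gnorm \<pi> = p" and rho: "gprime \<rho>" "gnorm \<rho> = q"
  obtains u a b b' c c' where "u \<in> {1, -1, \<i>, -\<i>}" "a \<le> (1 :: nat)" "b \<le> (1 :: nat)" "b' \<le> (1 :: nat)"
    "c \<le> (1 :: nat)" "c' \<le> (1 :: nat)" "d = u * (1 + \<i>) ^ a * \<pi> ^ b * cnj \<pi> ^ b' * \<rho> ^ c * cnj \<rho> ^ c'"
proof -
  have pg: "\<pi> \<in> gauss" "cnj \<pi> \<in> gauss" "\<rho> \<in> gauss" "cnj \<rho> \<in> gauss"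
    using pi rho unfolding gprime_def by auto
  have p: "of_int p = \<pi> * cnj \<pi>" "of_int q = \<rho> * cnj \<rho>"
    using gnorm_cnj_mult[OF pg(1)] gnorm_cnj_mult[OF pg(3)] pi rho by simp_all
  have "of_int (2 * (2 * p * q)) = (1 + \<i>) ^ 4 * (\<pi> ^ 1 * (cnj \<pi> ^ 1 * (\<rho> ^ 1 * (cnj \<rho> ^ 1 * (- 1)))))"
    unfolding one_plus_ii_powers by (simp add: p)
  hence "gdvd d ((1 + \<i>) ^ 4 * (\<pi> ^ 1 * (cnj \<pi> ^ 1 * (\<rho> ^ 1 * (cnj \<rho> ^ 1 * (- 1))))))"
    using assms(2) by (simp only:)
  from gsquarefree_strip[OF gprime_one_plus_ii(1) _ assms(1) this]
  obtain a d1 where 1: "a \<le> 1" "gsquarefree d1" "d = (1 + \<i>) ^ a * d1"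
    "gdvd d1 (\<pi> ^ 1 * (cnj \<pi> ^ 1 * (\<rho> ^ 1 * (cnj \<rho> ^ 1 * (- 1)))))" using pg by auto
  from gsquarefree_strip[OF pi(1) _ 1(2,4)]
  obtain b d2 where 2: "b \<le> 1" "gsquarefree d2" "d1 = \<pi> ^ b * d2"
    "gdvd d2 (cnj \<pi> ^ 1 * (\<rho> ^ 1 * (cnj \<rho> ^ 1 * (- 1))))" using pg by auto
  from gsquarefree_strip[OF gprime_cnj[OF pi(1)] _ 2(2,4)]
  obtain b' d3 where 3: "b' \<le> 1" "gsquarefree d3" "d2 = cnj \<pi> ^ b' * d3"
    "gdvd d3 (\<rho> ^ 1 * (cnj \<rho> ^ 1 * (- 1)))" using pg by auto
  from gsquarefree_strip[OF rho(1) _ 3(2,4)]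
  obtain c d4 where 4: "c \<le> 1" "gsquarefree d4" "d3 = \<rho> ^ c * d4"
    "gdvd d4 (cnj \<rho> ^ 1 * (- 1))" using pg by auto
  from gsquarefree_strip[OF gprime_cnj[OF rho(1)] _ 4(2,4)]
  obtain c' d5 where 5: "c' \<le> 1" "gsquarefree d5" "d4 = cnj \<rho> ^ c' * d5" "gdvd d5 (- 1)" by auto
  have "d5 \<in> {1, -1, \<i>, -\<i>}" using gdvd_unit_cases[OF 5(2,4)] by simp
  moreover have "d = d5 * (1 + \<i>) ^ a * \<pi> ^ b * cnj \<pi> ^ b' * \<rho> ^ c * cnj \<rho> ^ c'"
    unfolding 1(3) 2(3) 3(3) 4(3) 5(3) by (simp only: mult_ac)
  ultimately show ?thesis using 1(1) 2(1) 3(1) 4(1) 5(1) by (intro that)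
qed

section \<open>Capitulation criterion\<close>

context quad_field
begin

lemma sigma_sprod: "M \<subseteq> k \<Longrightarrow> N \<subseteq> k \<Longrightarrow> \<sigma> ` sprod M N \<subseteq> sprod (\<sigma> ` M) (\<sigma> ` N)"
proof
  fix y assume MN: "M \<subseteq> k" "N \<subseteq> k" and "y \<in> \<sigma> ` sprod M N"
  then obtain x where y: "y = \<sigma> x" and x: "x \<in> sprod M N" by auto
  from x have "x \<in> k \<and> \<sigma> x \<in> sprod (\<sigma> ` M) (\<sigma> ` N)"
  proof induction
    case (step a b x)
    have ab: "a \<in> k" "b \<in> k" "x \<in> k" using step MN by auto
    have "\<sigma> (a * b + x) = \<sigma> a * \<sigma> b + \<sigma> x" using ab by (simp add: sigma_add sigma_mult k_mult)
    moreover have "\<sigma> a * \<sigma> b + \<sigma> x \<in> sprod (\<sigma> ` M) (\<sigma> ` N)" using step by (intro sprod.step) auto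
    ultimately show ?case using ab k_add k_mult by simp
  qed (simp add: sprod.zero subfield_0[OF subfield_k])
  thus "y \<in> sprod (\<sigma> ` M) (\<sigma> ` N)" by (simp add: y)
qed

lemma sigma_sprod_eq:
  assumes "M \<subseteq> k" "N \<subseteq> k"
  shows "\<sigma> ` sprod M N = sprod (\<sigma> ` M) (\<sigma> ` N)"
proof
  show "\<sigma> ` sprod M N \<subseteq> sprod (\<sigma> ` M) (\<sigma> ` N)" by (rule sigma_sprod[OF assms])
  have ss: "\<sigma> ` \<sigma> ` L = L" if "L \<subseteq> k" for L
    using that sigma_sigma by (force simp: image_image subset_eq)
  have sk: "\<sigma> ` L \<subseteq> k" if "L \<subseteq> k" for L using that sigma_k by auto
  have "\<sigma> ` sprod (\<sigma> ` M) (\<sigma> ` N) \<subseteq> sprod M N"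
    using sigma_sprod[OF sk[OF assms(1)] sk[OF assms(2)]] ss assms by simp
  hence "\<sigma> ` \<sigma> ` sprod (\<sigma> ` M) (\<sigma> ` N) \<subseteq> \<sigma> ` sprod M N" by blast
  moreover have "sprod (\<sigma> ` M) (\<sigma> ` N) \<subseteq> k"
  proof (rule sprod_least)
    fix a b assume "a \<in> \<sigma> ` M" "b \<in> \<sigma> ` N"
    thus "a * b \<in> k" using sk assms by (intro k_mult) blast+
  qed (auto intro: k_add subfield_0[OF subfield_k])
  ultimately show "sprod (\<sigma> ` M) (\<sigma> ` N) \<subseteq> \<sigma> ` sprod M N" using ss by simp
qed

lemma power_principal:
  assumes units: "\<And>\<beta>. \<beta> \<in> k \<Longrightarrow> nm \<beta> \<in> {1, -1, \<i>, -\<i>} \<Longrightarrow>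
      \<exists>\<omega>. \<omega> \<in> R \<and> inverse \<omega> \<in> R \<and> \<omega> \<noteq> 0 \<and> nm \<omega> = nm \<beta>"
    and genus: "\<And>J \<theta>. \<theta> \<in> k \<Longrightarrow> ambiguous J (nm \<theta>) \<Longrightarrow> \<exists>s. s \<noteq> 0 \<and> J = scl s R"
  shows "is_ideal R I \<Longrightarrow> I \<noteq> {0} \<Longrightarrow> \<exists>\<gamma>. \<gamma> \<noteq> 0 \<and> ideal_pow R I (2 ^ m) = scl \<gamma> R \<Longrightarrow>
    \<exists>\<alpha>. \<alpha> \<noteq> 0 \<and> sprod I I = scl \<alpha> R"
proof (induction m arbitrary: I)
  case 0
  then obtain \<gamma> where g: "\<gamma> \<noteq> 0" "I = scl \<gamma> R" using ideal_pow_1[OF subfield_k] by auto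
  have "sprod I I = scl (\<gamma> * \<gamma>) R"
    unfolding g(2) sprod_scl sprod_scl_right sprod_ring_left[OF R_mod R_1] scl_scl ..
  thus ?case using g(1) by (intro exI[of _ "\<gamma> * \<gamma>"]) auto
next
  case (Suc m)
  have I: "I \<subseteq> R" "is_mod R I" using Suc.prems(1) is_ideal_iff by auto
  obtain x0 where x0: "x0 \<in> I" "x0 \<noteq> 0" using Suc.prems(2) I(2) unfolding is_mod_def by blast
  define C where "C = sprod I I"
  have C: "is_ideal R C" unfolding C_def by (rule roi_ideal_mult(2)[OF subfield_k Suc.prems(1,1)])
  hence C': "C \<subseteq> R" "is_mod R C" using is_ideal_iff by auto
  have c0: "x0 * x0 \<in> C" "x0 * x0 \<noteq> 0" using x0 sprod_mult unfolding C_def by auto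
  have "ideal_pow R C (2 ^ m) = ideal_pow R I (2 ^ Suc m)"
    unfolding C_def ideal_pow_double[OF subfield_k Suc.prems(1)] by simp
  moreover have "C \<noteq> {0}" using c0 by blast
  ultimately obtain \<alpha> where a: "\<alpha> \<noteq> 0" "sprod C C = scl \<alpha> R" using Suc.IH[OF C] Suc.prems(3) by metis
  obtain b where b: "b \<in> gauss" "b \<noteq> 0" "sprod I (\<sigma> ` I) = scl b R" using ideal_norm[OF I x0] .
  have Ik: "I \<subseteq> k" using I(1) R_k by auto
  have "sprod C (\<sigma> ` C) = sprod (sprod I I) (sprod (\<sigma> ` I) (\<sigma> ` I))"
    unfolding C_def sigma_sprod_eq[OF Ik Ik] ..
  also have "\<dots> = sprod I (sprod (sprod I (\<sigma> ` I)) (\<sigma> ` I))" by (simp only: sprod_assoc)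
  also have "\<dots> = scl b (sprod I (\<sigma> ` I))"
    unfolding b(3) sprod_scl sprod_scl_right sprod_ring_left[OF is_mod_sigma[OF I(2) Ik] R_1] ..
  also have "\<dots> = scl (b * b) R" unfolding b(3) scl_scl ..
  finally have cc: "sprod C (\<sigma> ` C) = scl (b * b) R" .
  have bb: "b * b \<in> gauss" "b * b \<noteq> 0" using b by auto
  obtain g where g: "g \<in> k" "g \<noteq> 0" "ambiguous (scl g C) (nm g * (b * b))"
    using square_principal_ambiguous[OF C' c0 a(2,1) units bb cc] by blast
  have bk: "b \<in> gauss_rat" using b gauss_in_gauss_rat by auto
  have "nm g * (b * b) = nm (g * b)"
    using nm_mult[OF g(1) gauss_rat_k[OF bk]] nm_gauss_rat[OF bk] by (simp add: power2_eq_square)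
  hence "ambiguous (scl g C) (nm (g * b))" using g(3) by simp
  from genus[OF k_mult[OF g(1) gauss_rat_k[OF bk]] this]
  obtain s where s: "s \<noteq> 0" "scl g C = scl s R" by blast
  show ?case using scl_eq_sclD[OF s(2) g(2)] s(1) g(2) unfolding C_def
    by (intro exI[of _ "inverse g * s"]) auto
qed

lemma capitulation_criterion:
  assumes units: "\<And>\<beta>. \<beta> \<in> k \<Longrightarrow> nm \<beta> \<in> {1, -1, \<i>, -\<i>} \<Longrightarrow>
      \<exists>\<omega>. \<omega> \<in> R \<and> inverse \<omega> \<in> R \<and> \<omega> \<noteq> 0 \<and> nm \<omega> = nm \<beta>"
    and genus: "\<And>J \<theta>. \<theta> \<in> k \<Longrightarrow> ambiguous J (nm \<theta>) \<Longrightarrow> \<exists>s. s \<noteq> 0 \<and> J = scl s R"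
    and K: "subfield_C K" "k \<subseteq> K"
    and ram: "\<And>d. gsquarefree d \<Longrightarrow> gdvd d (of_int (2 * D)) \<Longrightarrow> unit_square K d"
  shows "capitulation_kernel k K = class_group_2 R"
proof -
  let ?O = "ring_of_integers K"
  have "j_map R ?O c = ideal_class ?O ?O" if c: "c \<in> class_group_2 R" for c
  proof -
    obtain I0 where "I0 \<in> nz_ideals R" "c = ideal_class R I0"
      using c unfolding class_group_2_def class_group_def by blast
    moreover have "ideal_equiv R I0 I0" unfolding ideal_equiv_def using R_1 by (intro bexI[of _ 1]) auto
    ultimately have "I0 \<in> c" unfolding ideal_class_def by auto
    hence rep: "class_rep c \<in> c" unfolding class_rep_def by (rule someI)
    define I where "I = class_rep c"
    have "I \<in> nz_ideals R" using rep unfolding I_def \<open>c = ideal_class R I0\<close> ideal_class_def by blast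
    hence id: "is_ideal R I" "I \<noteq> {0}" unfolding nz_ideals_def by auto
    hence I: "I \<subseteq> R" "is_mod R I" using is_ideal_iff by auto
    obtain x0 where x0: "x0 \<in> I" "x0 \<noteq> 0" using id(2) I(2) unfolding is_mod_def by blast
    obtain m where m: "ideal_class R (ideal_pow R I (2 ^ m)) = ideal_class R R"
      using c unfolding class_group_2_def I_def by blast
    have "ideal_pow R I (2 ^ m) \<subseteq> R"
      using ideal_pow_ideal[OF subfield_k id(1), of "2 ^ m"] unfolding is_ideal_iff by blast
    from iffD1[OF ideal_class_trivial_iff[OF subfield_k this] m]
    have pr: "\<exists>\<gamma>. \<gamma> \<noteq> 0 \<and> ideal_pow R I (2 ^ m) = scl \<gamma> R" .
    have "\<exists>\<alpha>. \<alpha> \<noteq> 0 \<and> sprod I I = scl \<alpha> R"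
      by (rule power_principal[OF units genus id pr])
    then obtain \<alpha> where a: "\<alpha> \<noteq> 0" "sprod I I = scl \<alpha> R" by blast
    obtain b where b: "b \<in> gauss" "b \<noteq> 0" "sprod I (\<sigma> ` I) = scl b R" using ideal_norm[OF I x0] .
    obtain g where g: "g \<in> k" "g \<noteq> 0" "ambiguous (scl g I) (nm g * b)"
      by (rule square_principal_ambiguous[OF I x0 a(2,1) units b])
    obtain h d where h: "h \<in> gauss_rat" "h \<noteq> 0" "gsquarefree d" "d = h\<^sup>2 * (nm g * b)"
      "ambiguous (scl h (scl g I)) d" "scl h (scl g I) \<subseteq> R" "gdvd d (of_int (2 * D))"
      by (rule ambiguous_squarefree[OF g(3)])
    define J where "J = scl (h * g) I"
    have J: "J \<subseteq> R" "sprod J J = scl d R"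
      using h(5,6) unfolding J_def scl_scl ambiguous_def by blast+
    obtain s u where su: "s \<in> K" "s \<noteq> 0" "u \<in> ?O" "inverse u \<in> ?O" "u \<noteq> 0" "d = u * s\<^sup>2"
      using ram[OF h(3,7)] unfolding unit_square_def by blast
    have RO: "R \<subseteq> ?O" by (rule ring_of_integers_mono[OF K(2)])
    have JK: "J \<subseteq> K" using J(1) R_k K(2) by blast
    have "sprod ?O J = scl s ?O"
    proof (rule sprod_square_principal[OF roi_mod[OF K(1)] roi_1[OF K(1)] JK])
      show "is_mod ?O (sprod ?O J)" by (rule is_mod_sprod[OF roi_mod[OF K(1)]])
      show "J \<subseteq> sprod ?O J" using sprod_mult[OF roi_1[OF K(1)]] by fastforce
      show "x / s \<in> K" if "x \<in> K" for x using that su by (intro subfield_divide[OF K(1)])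
      show "u * s\<^sup>2 \<in> sprod J J" using scl_ring_mem[OF R_1, of d] su J by simp
      show "x\<^sup>2 / s\<^sup>2 \<in> ?O" if "x \<in> J" for x
      proof -
        have "x * x \<in> scl d R" using sprod_mult[OF that that] J by simp
        then obtain r where "r \<in> R" "x * x = u * s\<^sup>2 * r" using su by (auto simp: scl_def)
        hence "x\<^sup>2 / s\<^sup>2 = u * r" using su by (simp add: power2_eq_square)
        thus ?thesis using roi_mult[OF K(1) su(3)] RO \<open>r \<in> R\<close> by auto
      qed
    qed (use su in \<open>auto simp: ring_of_integers_def\<close>)
    hence "scl (h * g) (sprod ?O I) = scl s ?O" unfolding J_def sprod_scl_right .
    hence "sprod ?O I = scl (inverse (h * g) * s) ?O" by (rule scl_eq_sclD) (use h(2) g(2) in simp)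
    moreover have IO: "I \<subseteq> ?O" using I(1) RO by blast
    ultimately have "\<exists>\<gamma>. \<gamma> \<noteq> 0 \<and> ideal_gen ?O I = scl \<gamma> ?O"
      unfolding roi_ideal_gen[OF K(1) IO] using su(2) h(2) g(2) by (intro exI[of _ "inverse (h * g) * s"]) simp
    moreover have "ideal_gen ?O I \<subseteq> ?O"
      unfolding ideal_gen_def using IO roi_ideal_self[OF K(1)] by (intro Inter_lower) blast
    ultimately show ?thesis
      unfolding j_map_def I_def[symmetric] using iffD2[OF ideal_class_trivial_iff[OF K(1)]] by blast
  qed
  thus ?thesis unfolding capitulation_kernel_def by blast
qed

end

section \<open>Ambiguous ideals from the negative Pell equation\<close>

context quad_field
begin

lemma nm_integral:
  assumes "\<theta> \<in> k"
  obtains X Y Z where "X \<in> gauss" "Y \<in> gauss" "Z \<in> gauss" "Z \<noteq> 0" "X\<^sup>2 - of_int D * Y\<^sup>2 = nm \<theta> * Z\<^sup>2"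
proof -
  obtain a b where ab: "a \<in> gauss_rat" "b \<in> gauss_rat" "\<theta> = a + b * \<eta>" using k_cases[OF assms] .
  obtain m where m: "m > 0" "of_int m * a \<in> gauss" using gauss_rat_denominator[OF ab(1)] .
  obtain n where n: "n > 0" "of_int n * b \<in> gauss" using gauss_rat_denominator[OF ab(2)] .
  have "of_int n * (of_int m * a) \<in> gauss" "of_int m * (of_int n * b) \<in> gauss" using m n by auto
  moreover have "(of_int n * (of_int m * a))\<^sup>2 - of_int D * (of_int m * (of_int n * b))\<^sup>2
      = nm \<theta> * (of_int (m * n))\<^sup>2"
    unfolding ab(3) nm_rep[OF ab(1,2)] by (simp add: power_mult_distrib algebra_simps)
  moreover have "(of_int (m * n) :: complex) \<noteq> 0" using m n by simp
  ultimately show ?thesis using that gauss_of_int by blast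
qed

lemma cmod_nm_integral:
  assumes "\<theta> \<in> k"
  obtains X Y Z :: int where "Z \<noteq> 0" "of_int (X\<^sup>2 - D * Y\<^sup>2) = (cmod (nm \<theta>))\<^sup>2 * (of_int Z)\<^sup>2"
proof -
  obtain a b where ab: "a \<in> gauss_rat" "b \<in> gauss_rat" "\<theta> = a + b * \<eta>" "\<sigma> \<theta> = a - b * \<eta>"
    using k_cases[OF assms] .
  define r where "r = sqrt (of_int D)"
  have r: "r * r = of_int D" "\<eta> = complex_of_real r" using D_pos by (simp_all add: r_def \<eta>_def)
  define P where "P = (cmod a)\<^sup>2 + of_int D * (cmod b)\<^sup>2"
  define Q where "Q = 2 * (Re a * Re b + Im a * Im b)"
  have sq: "(cmod (a + b * of_real t))\<^sup>2 = (cmod a)\<^sup>2 + t * t * (cmod b)\<^sup>2 + t * Q" for t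
    unfolding cmod_power2 by (simp add: Q_def power2_eq_square algebra_simps)
  have "nm \<theta> = (a + b * of_real r) * (a + b * of_real (- r))"
    unfolding nm_def ab(4) unfolding ab(3) r(2) by simp
  hence "(cmod (nm \<theta>))\<^sup>2 = (cmod (a + b * of_real r))\<^sup>2 * (cmod (a + b * of_real (- r)))\<^sup>2"
    by (simp add: norm_mult power_mult_distrib)
  also have "\<dots> = (P + r * Q) * (P - r * Q)" unfolding sq by (simp add: P_def r(1))
  also have "\<dots> = P\<^sup>2 - (r * r) * Q\<^sup>2" by (simp add: power2_eq_square algebra_simps)
  finally have nmPQ: "(cmod (nm \<theta>))\<^sup>2 = P\<^sup>2 - of_int D * Q\<^sup>2" unfolding r(1) .
  have "P \<in> \<rat>" "Q \<in> \<rat>" using ab(1,2) unfolding P_def Q_def gauss_rat_def cmod_power2 by auto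
  then obtain p q p' q' where pq: "q > 0" "P = of_int p / of_int q" "q' > 0" "Q = of_int p' / of_int q'"
    by (auto elim!: Rats_cases')
  have e: "real_of_int p = P * of_int q" "real_of_int p' = Q * of_int q'" using pq by auto
  have "of_int ((p * q')\<^sup>2 - D * (p' * q)\<^sup>2) = (P\<^sup>2 - of_int D * Q\<^sup>2) * (of_int (q * q'))\<^sup>2"
    by (simp add: e power_mult_distrib algebra_simps)
  thus ?thesis using that[of "q * q'" "p * q'" "p' * q"] nmPQ pq by simp
qed

lemma ambiguous_R: "ambiguous R 1"
  unfolding ambiguous_def using R_mod R_k sigma_R_image sprod_ring_left[OF R_mod R_1] by auto

text \<open>This is 1 + i \<epsilon> for the unit \<epsilon> = x + y \<eta> of norm -1; since i \<epsilon> has relative norm 1, Hilbert 90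
  makes the principal ideal it generates ambiguous.\<close>

definition pell_gamma :: "int \<Rightarrow> int \<Rightarrow> complex" where
  "pell_gamma x y = (1 + \<i> * of_int x) + (\<i> * of_int y) * \<eta>"

context
  fixes x y :: int
  assumes pell: "x\<^sup>2 + 1 = D * y\<^sup>2"
begin

lemma pell_gamma_k: "pell_gamma x y \<in> k"
  and nm_pell_gamma: "nm (pell_gamma x y) = 2 * (1 + \<i> * of_int x)"
  and sigma_pell_gamma: "\<sigma> (pell_gamma x y) = (1 + \<i> * of_int x) - (\<i> * of_int y) * \<eta>"
proof -
  have ab: "1 + \<i> * of_int x \<in> gauss_rat" "\<i> * of_int y \<in> gauss_rat" by auto
  show "pell_gamma x y \<in> k" unfolding pell_gamma_def k_eq using ab by blast
  show "\<sigma> (pell_gamma x y) = (1 + \<i> * of_int x) - (\<i> * of_int y) * \<eta>"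
    unfolding pell_gamma_def by (rule sigma_eq[OF ab])
  have "nm (pell_gamma x y) = (1 + \<i> * of_int x)\<^sup>2 + of_int (D * y\<^sup>2)"
    unfolding pell_gamma_def nm_rep[OF ab] by (simp add: power_mult_distrib)
  also have "\<dots> = 2 * (1 + \<i> * of_int x)" unfolding pell[symmetric]
    by (simp add: power2_eq_square algebra_simps)
  finally show "nm (pell_gamma x y) = 2 * (1 + \<i> * of_int x)" .
qed

lemma cmod_nm_pell_gamma: "(cmod (nm (pell_gamma x y)))\<^sup>2 = of_int D * (2 * of_int y)\<^sup>2"
proof -
  have "(cmod (nm (pell_gamma x y)))\<^sup>2 = 4 * of_int (x\<^sup>2 + 1)"
    unfolding nm_pell_gamma by (simp add: cmod_power2 power_mult_distrib)
  thus ?thesis unfolding pell by (simp add: power_mult_distrib)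
qed

lemma pell_y_nonzero: "y \<noteq> 0"
proof
  assume "y = 0"
  hence "x\<^sup>2 + 1 = 0" using pell by simp
  moreover have "x\<^sup>2 \<ge> 0" by simp
  ultimately show False by linarith
qed

lemma pell_gamma_nonzero: "pell_gamma x y \<noteq> 0"
  using cmod_nm_pell_gamma nm_eq_0_iff[OF pell_gamma_k] D_pos pell_y_nonzero by auto

lemma pell_gamma_unit:
  obtains u where "u \<in> R" "inverse u \<in> R" "u \<noteq> 0" "pell_gamma x y = u * \<sigma> (pell_gamma x y)"
proof -
  define u where "u = \<i> * (of_int x + of_int y * \<eta>)"
  define v where "v = \<i> * (of_int x - of_int y * \<eta>)"
  have ab: "\<i> * (of_int x + of_int n * \<eta>) \<in> R" for n
    by (intro R_mult R_add eta_R gauss_R gauss_ii gauss_of_int)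
  have uv: "u \<in> R" "v \<in> R" using ab[of y] ab[of "- y"] by (simp_all add: u_def v_def)
  have "u * v = of_int y * of_int y * (\<eta> * \<eta>) - of_int x * of_int x"
    by (simp add: u_def v_def algebra_simps)
  also have "\<dots> = of_int (D * y\<^sup>2 - x\<^sup>2)" unfolding eta_sq by (simp add: power2_eq_square)
  also have "D * y\<^sup>2 - x\<^sup>2 = 1" using pell by simp
  finally have one: "u * v = 1" by simp
  have "u * \<sigma> (pell_gamma x y) = \<i> * of_int x + \<i> * of_int y * \<eta>
      + (of_int y * of_int y * (\<eta> * \<eta>) - of_int x * of_int x)"
    unfolding sigma_pell_gamma u_def by (simp add: algebra_simps)
  also have "of_int y * of_int y * (\<eta> * \<eta>) - of_int x * of_int x = of_int (D * y\<^sup>2 - x\<^sup>2)"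
    unfolding eta_sq by (simp add: power2_eq_square)
  also have "D * y\<^sup>2 - x\<^sup>2 = 1" using pell by simp
  finally have "u * \<sigma> (pell_gamma x y) = pell_gamma x y" by (simp add: pell_gamma_def)
  moreover have "inverse u = v" using one by (rule inverse_unique)
  moreover have "u \<noteq> 0" using one by auto
  ultimately show ?thesis using that uv by metis
qed

lemma ambiguous_pell:
  assumes "ambiguous J n"
  shows "ambiguous (scl (pell_gamma x y) J) (nm (pell_gamma x y) * n)"
proof -
  let ?g = "pell_gamma x y"
  have J: "is_mod R J" "J \<subseteq> k" "\<sigma> ` J = J" "n \<in> gauss_rat" "n \<noteq> 0" "sprod J J = scl n R"
    using assms unfolding ambiguous_def by auto
  obtain u where u: "u \<in> R" "inverse u \<in> R" "u \<noteq> 0" "?g = u * \<sigma> ?g" using pell_gamma_unit .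
  have "?g * ?g = u * nm ?g" using u(4) by (metis mult.assoc mult.commute nm_def)
  have "scl ?g J \<subseteq> k" using J(2) pell_gamma_k k_mult by (auto simp: scl_def)
  moreover have "\<sigma> ` scl ?g J = scl ?g J"
  proof -
    have "\<sigma> ` scl ?g J = scl (\<sigma> ?g) J" unfolding sigma_scl[OF pell_gamma_k J(2)] J(3) ..
    also have "\<dots> = scl (\<sigma> ?g) (scl u J)" unfolding scl_unit[OF J(1) u(1-3)] ..
    also have "\<dots> = scl (u * \<sigma> ?g) J" unfolding scl_scl by (simp add: mult.commute)
    finally show ?thesis using u(4) by simp
  qed
  moreover have "sprod (scl ?g J) (scl ?g J) = scl (nm ?g * n) R"
  proof -
    have "sprod (scl ?g J) (scl ?g J) = scl (?g * ?g * n) R"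
      unfolding sprod_scl sprod_scl_right J(6) scl_scl by (simp add: mult.assoc)
    also have "\<dots> = scl (nm ?g * n) (scl u R)"
      unfolding \<open>?g * ?g = u * nm ?g\<close> scl_scl by (simp add: mult_ac)
    finally show ?thesis unfolding scl_unit[OF R_mod u(1-3)] .
  qed
  moreover have "nm ?g \<in> gauss_rat" "nm ?g \<noteq> 0"
    using nm_rat[OF pell_gamma_k] nm_eq_0_iff[OF pell_gamma_k] pell_gamma_nonzero by auto
  ultimately show ?thesis using J is_mod_scl unfolding ambiguous_def by auto
qed

lemma unit_square_nm_pell: "unit_square k (nm (pell_gamma x y))"
proof -
  let ?g = "pell_gamma x y"
  obtain u where u: "u \<in> R" "inverse u \<in> R" "u \<noteq> 0" "?g = u * \<sigma> ?g" using pell_gamma_unit .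
  have "unit_square k (?g\<^sup>2 / u)"
    using pell_gamma_k pell_gamma_nonzero u
    by (intro unit_square_divide[OF subfield_k] unit_square_square[OF subfield_k] unit_square_unit[OF subfield_k])
  moreover have "?g\<^sup>2 / u = nm ?g"
  proof -
    have "?g\<^sup>2 = ?g * (u * \<sigma> ?g)" using u(4) by (simp add: power2_eq_square)
    thus ?thesis using u(3) by (simp add: nm_def)
  qed
  ultimately show ?thesis by simp
qed

end

end

lemma prime_mult_not_square:
  fixes q c n m :: int
  assumes "prime q" "\<not> q dvd c" "n \<noteq> 0"
  shows "q * c * n\<^sup>2 \<noteq> m\<^sup>2"
proof
  assume eq: "q * c * n\<^sup>2 = m\<^sup>2"
  have "c \<noteq> 0" using assms(2) by auto
  have pe: "prime_elem q" by (rule prime_imp_prime_elem[OF assms(1)])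
  have "q \<noteq> 0" using assms(1) by auto
  have "multiplicity q (m\<^sup>2) = 2 * multiplicity q m"
    by (cases "m = 0") (use assms(1) eq \<open>c \<noteq> 0\<close> \<open>q \<noteq> 0\<close> assms(3) in \<open>auto simp: prime_elem_multiplicity_power_distrib\<close>)
  moreover have "multiplicity q (q * c * n\<^sup>2) = 1 + 0 + 2 * multiplicity q n"
    using assms \<open>c \<noteq> 0\<close> \<open>q \<noteq> 0\<close> pe
    by (simp add: prime_elem_multiplicity_mult_distrib prime_elem_multiplicity_power_distrib
        not_dvd_imp_multiplicity_0)
  ultimately have "2 * multiplicity q m = 1 + 0 + 2 * multiplicity q n" using eq by simp
  thus False by presburger
qed

lemma prime_int_2: "prime (2 :: int)"
  by (simp add: prime_int_iff')

lemma prime_dvd_not_square: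
  fixes q D :: int
  assumes "prime q" "D = q * c" "\<not> q dvd c"
  shows "\<not> (\<exists>r. r\<^sup>2 = D)"
  using prime_mult_not_square[OF assms(1,3), of 1] unfolding assms(2) by (metis mult_1_right one_neq_zero power_one)

lemma unit_square_gprime:
  assumes K: "subfield_C K" "\<i> \<in> K" "complex_of_real (sqrt (of_int p)) \<in> K"
    and pi: "gprime \<pi>" "gnorm \<pi> = p" and p4: "[p = 1] (mod 4)"
  shows "unit_square K \<pi>" "unit_square K (cnj \<pi>)"
proof -
  have pp: "prime p" using pi unfolding gprime_def by auto
  have p2: "p > 2" using Legendre_minus_one(1)[OF pp p4] .
  have pn1: "\<not> p dvd 1" using p2 by simp
  have pn2: "\<not> p dvd 2" using p2 zdvd_imp_le[of p 2] by auto
  have p0: "p > 0" "\<not> (\<exists>r. r\<^sup>2 = p)" using p2 prime_dvd_not_square[OF pp, of p 1] pn1 by auto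
  interpret F: quad_field p by unfold_locales (fact p0)+
  have "p mod 4 = 1 \<or> p mod 4 = 2" using p4 by (simp add: cong_def)
  then obtain d1 d2 a b where d: "d1 > 0" "d2 > 0" "d1 * d2 = p" "d1 \<noteq> 1" "d1 * a\<^sup>2 - d2 * b\<^sup>2 = 1"
    using pell_split[OF p0] by metis
  have "d2 = 1" using prime_int_mult_cases[of d1 d2] pp d by auto
  hence pell: "b\<^sup>2 + 1 = p * a\<^sup>2" using d by simp
  let ?g = "F.pell_gamma b a"
  have kK: "F.k \<subseteq> K" unfolding F.k_def F.\<eta>_def using K by (intro gen_field_least) auto
  obtain g d where gd: "g \<in> gauss_rat" "g \<noteq> 0" "gsquarefree d" "d = g\<^sup>2 * (F.nm ?g * 1)"
    "F.ambiguous (scl g (scl ?g F.R)) d" "scl g (scl ?g F.R) \<subseteq> F.R" "gdvd d (of_int (2 * p))"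
    by (rule F.ambiguous_squarefree[OF F.ambiguous_pell[OF pell F.ambiguous_R]])
  obtain u e f f' where ef: "u \<in> {1, -1, \<i>, -\<i>}" "e \<le> (1 :: nat)" "f \<le> (1 :: nat)" "f' \<le> (1 :: nat)"
    "d = u * (1 + \<i>) ^ e * \<pi> ^ f * cnj \<pi> ^ f'"
    using gsquarefree_dvd_2p[OF gd(3,7) pi] .
  have pg: "\<pi> \<in> gauss" "cnj \<pi> \<in> gauss" using pi unfolding gprime_def by auto
  have dg: "d \<in> gauss" using gd(3) unfolding gsquarefree_def by auto
  have gK: "g \<in> K" using subfield_gauss_rat[OF K(1,2) gd(1)] .
  have usd: "unit_square K d"
    unfolding gd(4) mult_1_right
    by (intro unit_square_mult[OF K(1)] unit_square_square[OF K(1) gK gd(2)]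
        unit_square_mono[OF kK F.unit_square_nm_pell[OF pell]])
  have u: "u \<in> gauss" "gnorm u = 1" "u \<noteq> 0"
    using ef(1) by (auto simp: gnorm_def)
  have gn: "gnorm d = 2 ^ e * p ^ f * p ^ f'"
  proof -
    have "gnorm d = gnorm u * gnorm (1 + \<i>) ^ e * gnorm \<pi> ^ f * gnorm (cnj \<pi>) ^ f'"
      unfolding ef(5) using u(1) pg
      by (simp add: gnorm_mult gnorm_power gauss_mult gauss_power gauss_add)
    thus ?thesis using u(2) gprime_one_plus_ii(2) pi by simp
  qed
  have "(cmod g)\<^sup>2 \<in> \<rat>" using gd(1) unfolding gauss_rat_def cmod_power2 by auto
  then obtain m n where mn: "n > 0" "(cmod g)\<^sup>2 = of_int m / of_int n" by (auto elim: Rats_cases')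
  have "real_of_int (gnorm d) = (cmod d)\<^sup>2" by (rule gnorm_eq[OF dg])
  also have "\<dots> = ((cmod g)\<^sup>2)\<^sup>2 * (cmod (F.nm ?g))\<^sup>2"
    unfolding gd(4) by (simp add: norm_mult norm_power power_mult_distrib)
  also have "\<dots> * (of_int n)\<^sup>2 = of_int (p * (m * 2 * a)\<^sup>2)"
    unfolding F.cmod_nm_pell_gamma[OF pell] mn(2) using mn(1) by (simp add: power_divide power_mult_distrib)
  finally have "real_of_int (gnorm d * n\<^sup>2) = of_int (p * (m * 2 * a)\<^sup>2)" by simp
  hence eq: "2 ^ e * p ^ f * p ^ f' * n\<^sup>2 = p * (m * 2 * a)\<^sup>2" unfolding of_int_eq_iff gn .
  have n0: "n \<noteq> 0" using mn by simp
  have pe: "\<not> p dvd 2 ^ e" using pn2 pp prime_dvd_power by blast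
  have ff: "f + f' = 1"
  proof (rule ccontr)
    assume "f + f' \<noteq> 1"
    hence "f = 0 \<and> f' = 0 \<or> f = 1 \<and> f' = 1" using ef by auto
    thus False
    proof
      assume "f = 0 \<and> f' = 0"
      hence "p * 2 ^ e * n\<^sup>2 = (p * (m * 2 * a))\<^sup>2" using eq by (simp add: power2_eq_square mult_ac)
      thus False using prime_mult_not_square[OF pp pe n0] by blast
    next
      assume "f = 1 \<and> f' = 1"
      hence "p * (p * 2 ^ e * n\<^sup>2) = p * (m * 2 * a)\<^sup>2" using eq by (simp add: mult_ac)
      hence "p * 2 ^ e * n\<^sup>2 = (m * 2 * a)\<^sup>2" using p2 by simp
      thus False using prime_mult_not_square[OF pp pe n0] by blast
    qed
  qed
  have "e = 0"
  proof (rule ccontr)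
    assume "e \<noteq> 0"
    hence "e = 1" using ef by auto
    moreover have "f = 0 \<and> f' = 1 \<or> f = 1 \<and> f' = 0" using ff by auto
    ultimately have "p * (2 * 1 * n\<^sup>2) = p * (m * 2 * a)\<^sup>2" using eq by auto
    hence "2 * 1 * n\<^sup>2 = (m * 2 * a)\<^sup>2" using p2 by simp
    moreover have "\<not> (2 :: int) dvd 1" by simp
    ultimately show False using prime_mult_not_square[OF prime_int_2 _ n0, of 1] by auto
  qed
  have us: "unit_square K (d / u)"
    by (intro unit_square_divide[OF K(1)] usd unit_square_gauss_unit[OF K(1,2) ef(1)])
  have "unit_square K ((complex_of_real (sqrt (of_int p)))\<^sup>2)"
    using K p2 by (intro unit_square_square) auto
  also have "(complex_of_real (sqrt (of_int p)))\<^sup>2 = of_int p"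
    using p2 by (simp flip: of_real_power)
  finally have usp: "unit_square K (of_int p)" .
  have pc: "of_int p = \<pi> * cnj \<pi>" using gnorm_cnj_mult[OF pg(1)] pi by simp
  have nz: "\<pi> \<noteq> 0" "cnj \<pi> \<noteq> 0" using gprime_nonzero[OF pi(1)] by auto
  have quot: "unit_square K (of_int p / (d / u))" by (rule unit_square_divide[OF K(1) usp us])
  have "f = 1 \<and> f' = 0 \<or> f = 0 \<and> f' = 1" using ff by auto
  hence "unit_square K \<pi> \<and> unit_square K (cnj \<pi>)"
  proof
    assume "f = 1 \<and> f' = 0"
    hence "d / u = \<pi>" using u(3) unfolding ef(5) \<open>e = 0\<close> by simp
    moreover from this have "of_int p / (d / u) = cnj \<pi>" using nz pc by simp
    ultimately show ?thesis using us quot by simp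
  next
    assume "f = 0 \<and> f' = 1"
    hence "d / u = cnj \<pi>" using u(3) unfolding ef(5) \<open>e = 0\<close> by simp
    moreover from this have "of_int p / (d / u) = \<pi>" using nz pc by simp
    ultimately show ?thesis using us quot by simp
  qed
  thus "unit_square K \<pi>" "unit_square K (cnj \<pi>)" by simp_all
qed

section \<open>The genus argument\<close>

lemma dvd_prime_mult_cases:
  fixes q c d :: int
  assumes "prime q" "d dvd q * c"
  shows "d dvd c \<or> (\<exists>d'. d = q * d' \<and> d' dvd c)"
proof -
  obtain e where e: "q * c = d * e" using assms(2) by auto
  have q0: "q \<noteq> 0" using assms(1) by auto
  have "q dvd d * e" using e by (metis dvd_triv_left)
  hence "q dvd d \<or> q dvd e" using assms(1) by (simp add: prime_dvd_mult_iff)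
  thus ?thesis
  proof
    assume "q dvd d"
    then obtain d' where "d = q * d'" by auto
    moreover from this have "c = d' * e" using e q0 by simp
    ultimately show ?thesis by auto
  next
    assume "q dvd e"
    then obtain e' where "e = q * e'" by auto
    hence "c = d * e'" using e q0 by simp
    thus ?thesis by auto
  qed
qed

context symbol_primes
begin

interpretation flip: symbol_primes p2 p1 by (rule symbol_primes_flip)

lemma quad_field_2pq: "quad_field (2 * p1 * p2)"
proof
  show "2 * p1 * p2 > 0" using gt2 by simp
  have "\<not> p1 dvd 2 * p2" using not_dvd prime1 by (auto simp: prime_dvd_mult_iff)
  moreover have "2 * p1 * p2 = p1 * (2 * p2)" by simp
  ultimately show "\<not> (\<exists>r. r\<^sup>2 = 2 * p1 * p2)" using prime_dvd_not_square[OF prime1] by blast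
qed

interpretation F: quad_field "2 * p1 * p2" by (rule quad_field_2pq)

lemma negative_pell:
  obtains x y :: int where "x\<^sup>2 + 1 = 2 * p1 * p2 * y\<^sup>2"
proof -
  have "odd p1" "odd p2" using cong1 cong2 unfolding cong_def by presburger+
  hence "odd (p1 * p2)" by simp
  then obtain m where "p1 * p2 = 2 * m + 1" by (rule oddE)
  hence "2 * p1 * p2 = 4 * m + 2" by simp
  hence "2 * p1 * p2 mod 4 = 1 \<or> 2 * p1 * p2 mod 4 = 2" by presburger
  then obtain d1 d2 a b where d: "d1 > 0" "d2 > 0" "d1 * d2 = 2 * p1 * p2" "d1 \<noteq> 1" "d1 * a\<^sup>2 - d2 * b\<^sup>2 = 1"
    using pell_split[OF F.D_pos F.D_nonsquare] by metis
  have "d1 dvd 2 * (p1 * (p2 * 1))" using d(3) by (metis dvd_triv_left mult.assoc mult.right_neutral)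
  then obtain e d' where e: "e \<le> (1 :: nat)" "d1 = 2 ^ e * d'" "d' dvd p1 * (p2 * 1)"
    using dvd_prime_mult_cases[OF prime_int_2] by (metis One_nat_def le_refl mult_1 power_0 power_one_right zero_le)
  then obtain f d'' where f: "f \<le> (1 :: nat)" "d' = p1 ^ f * d''" "d'' dvd p2 * 1"
    using dvd_prime_mult_cases[OF prime1] by (metis One_nat_def le_refl mult_1 power_0 power_one_right zero_le)
  then obtain h d3 where h: "h \<le> (1 :: nat)" "d'' = p2 ^ h * d3" "d3 dvd 1"
    using dvd_prime_mult_cases[OF prime2] by (metis One_nat_def le_refl mult_1 power_0 power_one_right zero_le)
  have d1: "d1 = 2 ^ e * p1 ^ f * p2 ^ h * d3" using e f h by simp
  have "2 ^ e * p1 ^ f * p2 ^ h > 0" using gt2 by simp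
  hence "d3 > 0" using d(1) unfolding d1 by (intro zero_less_mult_pos[of _ d3])
  hence "d3 = 1" using h(3) by simp
  hence d1': "d1 = 2 ^ e * p1 ^ f * p2 ^ h" using d1 by simp
  have "(d1 * a)\<^sup>2 - 2 * p1 * p2 * b\<^sup>2 = d1 * (d1 * a\<^sup>2 - d2 * b\<^sup>2)"
    unfolding d(3)[symmetric] by (simp add: power2_eq_square algebra_simps)
  hence "(d1 * a)\<^sup>2 - 2 * p1 * p2 * b\<^sup>2 = 2 ^ e * p1 ^ f * p2 ^ h * 1\<^sup>2" using d(5) d1' by simp
  from norm_int_cases[OF e(1) f(1) h(1) _ this] have efh: "e = f" "f = h" by simp_all
  have "e \<noteq> 0"
  proof
    assume "e = 0"
    hence "d1 = 1" using d1' efh by simp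
    thus False using d(4) by contradiction
  qed
  hence D: "d1 = 2 * p1 * p2" using e(1) d1' efh by (simp add: le_Suc_eq)
  hence "d1 * d2 = d1 * 1" using d(3) by simp
  hence "d2 = 1" using d(1) unfolding mult_cancel_left by auto
  thus ?thesis using that[of b a] d(5) D by simp
qed

text \<open>Taking absolute values turns a relative norm into a norm from the real quadratic field, so the
  rational symbols only leave the square class of 1 or of 2 p1 p2 for the absolute norm. In the first
  case the squarefree generator is rational up to a unit, and the conditions at the Gaussian primes
  above p1 and p2 apply.\<close>

lemma ambiguous_norm_cases:
  assumes th: "\<theta> \<in> F.k" and J: "F.ambiguous J (F.nm \<theta>)"
  shows "(\<exists>s. s \<noteq> 0 \<and> J = scl s F.R) \<or>
    (\<exists>r\<in>\<rat>. (cmod (F.nm \<theta>))\<^sup>2 = of_int (2 * p1 * p2) * r\<^sup>2)"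
proof -
  obtain g d where gd: "g \<in> gauss_rat" "g \<noteq> 0" "gsquarefree d" "d = g\<^sup>2 * F.nm \<theta>"
    "F.ambiguous (scl g J) d" "scl g J \<subseteq> F.R" "gdvd d (of_int (2 * (2 * p1 * p2)))"
    by (rule F.ambiguous_squarefree[OF J])
  have gk: "g \<in> F.k" by (rule F.gauss_rat_k[OF gd(1)])
  have gth: "g * \<theta> \<in> F.k" "F.nm (g * \<theta>) = d"
    using F.k_mult[OF gk th] F.nm_mult[OF gk th] F.nm_gauss_rat[OF gd(1)] gd(4) by auto
  obtain \<pi> where pi: "gprime \<pi>" "gnorm \<pi> = p1" using exists_gprime[OF prime1 cong1] .
  obtain \<rho> where rho: "gprime \<rho>" "gnorm \<rho> = p2" using exists_gprime[OF prime2 cong2] .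
  obtain u a b b' c c' where ef: "u \<in> {1, -1, \<i>, -\<i>}" "a \<le> (1 :: nat)" "b \<le> (1 :: nat)" "b' \<le> (1 :: nat)"
    "c \<le> (1 :: nat)" "c' \<le> (1 :: nat)" "d = u * (1 + \<i>) ^ a * \<pi> ^ b * cnj \<pi> ^ b' * \<rho> ^ c * cnj \<rho> ^ c'"
    using gsquarefree_dvd_4pq[OF gd(3,7) pi rho] .
  have pg: "\<pi> \<in> gauss" "cnj \<pi> \<in> gauss" "\<rho> \<in> gauss" "cnj \<rho> \<in> gauss"
    using pi rho unfolding gprime_def by auto
  have dg: "d \<in> gauss" using gd(3) unfolding gsquarefree_def by auto
  have u: "u \<in> gauss" "gnorm u = 1" "u \<noteq> 0" using ef(1) by (auto simp: gnorm_def)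
  have gn: "gnorm d = 2 ^ a * p1 ^ (b + b') * p2 ^ (c + c')"
  proof -
    have "gnorm d = gnorm u * gnorm (1 + \<i>) ^ a * gnorm \<pi> ^ b * gnorm (cnj \<pi>) ^ b' * gnorm \<rho> ^ c * gnorm (cnj \<rho>) ^ c'"
      unfolding ef(7) using u(1) pg
      by (simp add: gnorm_mult gnorm_power gauss_mult gauss_power gauss_add)
    thus ?thesis using u(2) gprime_one_plus_ii(2) pi rho by (simp add: power_add)
  qed
  define f where "f = (b + b') mod 2"
  define h where "h = (c + c') mod 2"
  define w where "w = p1 ^ ((b + b') div 2) * p2 ^ ((c + c') div 2)"
  have w0: "w \<noteq> 0" using gt2 by (simp add: w_def)
  have "p1 ^ (b + b') = p1 ^ f * (p1 ^ ((b + b') div 2))\<^sup>2"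
    unfolding f_def by (metis mod_mult_div_eq power_add power_mult mult.commute)
  moreover have "p2 ^ (c + c') = p2 ^ h * (p2 ^ ((c + c') div 2))\<^sup>2"
    unfolding h_def by (metis mod_mult_div_eq power_add power_mult mult.commute)
  ultimately have gn': "gnorm d = 2 ^ a * p1 ^ f * p2 ^ h * w\<^sup>2"
    unfolding gn by (simp add: w_def power_mult_distrib)
  have fh: "f \<le> 1" "h \<le> 1" unfolding f_def h_def by auto
  obtain X Y Z where XYZ: "Z \<noteq> 0" "of_int (X\<^sup>2 - 2 * p1 * p2 * Y\<^sup>2) = (cmod (F.nm (g * \<theta>)))\<^sup>2 * (of_int Z)\<^sup>2"
    using F.cmod_nm_integral[OF gth(1)] .
  have "real_of_int (X\<^sup>2 - 2 * p1 * p2 * Y\<^sup>2) = of_int (2 ^ a * p1 ^ f * p2 ^ h * (w * Z)\<^sup>2)"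
    unfolding XYZ(2) gth(2) gnorm_eq[OF dg, symmetric] gn' by (simp add: power_mult_distrib)
  hence "X\<^sup>2 - 2 * p1 * p2 * Y\<^sup>2 = 2 ^ a * p1 ^ f * p2 ^ h * (w * Z)\<^sup>2" by (simp only: of_int_eq_iff)
  from norm_int_cases[OF ef(2) fh _ this] have eq: "a = f" "f = h" using w0 XYZ(1) by auto
  show ?thesis
  proof (cases "a = 0")
    case True
    hence "even (b + b')" "even (c + c')" using eq unfolding f_def h_def by presburger+
    hence "b' = b" "c' = c" using ef(3-6) by presburger+
    hence d: "d = u * of_int (p1 ^ b) * of_int (p2 ^ c)"
      using gnorm_cnj_mult[OF pg(1)] gnorm_cnj_mult[OF pg(3)] pi rho True
      unfolding ef(7) by (simp add: power_mult_distrib mult_ac)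
    obtain X Y Z where XYZ: "X \<in> gauss" "Y \<in> gauss" "Z \<in> gauss" "Z \<noteq> 0"
      "X\<^sup>2 - of_int (2 * p1 * p2) * Y\<^sup>2 = d * Z\<^sup>2"
      using F.nm_integral[OF gth(1)] unfolding gth(2) .
    have bc: "b = c"
    proof (rule ccontr)
      assume "b \<noteq> c"
      hence "b = 1 \<and> c = 0 \<or> b = 0 \<and> c = 1" using ef by auto
      thus False
      proof
        assume "b = 1 \<and> c = 0"
        hence "d = of_int p1 * u" using d by simp
        thus False using not_norm_p1[OF ef(1) XYZ(1-4)] XYZ(5) by simp
      next
        assume "b = 0 \<and> c = 1"
        hence "d = of_int p2 * u" using d by simp
        thus False using flip.not_norm_p1[OF ef(1) XYZ(1-4)] XYZ(5) by (simp add: mult_ac)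
      qed
    qed
    have ui: "u * \<i> \<in> {1, -1, \<i>, -\<i>}" using ef(1) by auto
    have "\<exists>s v. s \<in> F.k \<and> s \<noteq> 0 \<and> v \<in> {1, -1, \<i>, -\<i>} \<and> d = v * s\<^sup>2"
    proof (cases "b = 0")
      case True
      hence "d = u * 1\<^sup>2" using d bc by simp
      thus ?thesis using F.k_1 ef(1) by (intro exI[of _ 1] exI[of _ u]) auto
    next
      case False
      hence d': "d = u * of_int (p1 * p2)" using d bc ef(3) by (simp add: le_Suc_eq)
      define s where "s = F.\<eta> / (1 + \<i>)"
      have "1 + \<i> \<noteq> 0" by (simp add: complex_eq_iff)
      hence s: "s \<in> F.k" "s \<noteq> 0"
        using F.eta_k F.eta_nonzero F.k_1 F.ii_k by (auto simp: s_def intro!: F.k_divide F.k_add)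
      have "s\<^sup>2 = (F.\<eta> * F.\<eta>) / (2 * \<i>)"
        unfolding s_def power_divide one_plus_ii_powers by (simp add: power2_eq_square)
      also have "\<dots> = of_int (p1 * p2) / \<i>" unfolding F.eta_sq by simp
      finally have "\<i> * s\<^sup>2 = of_int (p1 * p2)"
        by (simp only: times_divide_eq_right nonzero_mult_div_cancel_left[OF complex_i_not_zero])
      hence "d = (u * \<i>) * s\<^sup>2" unfolding d' by (simp only: mult.assoc)
      thus ?thesis using s ui by blast
    qed
    then obtain s v where s: "s \<in> F.k" "s \<noteq> 0" "v \<in> {1, -1, \<i>, -\<i>}" "d = v * s\<^sup>2" by blast
    have "v \<noteq> 0" using s(3) by auto
    hence "scl g J = scl s F.R"
      using F.ambiguous_principal[OF gd(5) s(1,2) _ _ _ s(4)] F.gauss_unit_R[OF s(3)] by auto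
    hence "J = scl (inverse g * s) F.R" using gd(2) by (rule scl_eq_sclD)
    thus ?thesis using gd(2) s(2) by (intro disjI1 exI[of _ "inverse g * s"]) auto
  next
    case False
    hence gn2: "gnorm d = 2 * p1 * p2 * w\<^sup>2" using gn' eq ef(2) by (simp add: le_Suc_eq)
    define r where "r = of_int w / (cmod g)\<^sup>2"
    have "(cmod g)\<^sup>2 \<in> \<rat>" using gd(1) unfolding gauss_rat_def cmod_power2 by auto
    hence "r \<in> \<rat>" by (simp add: r_def)
    moreover have "((cmod g)\<^sup>2)\<^sup>2 * (cmod (F.nm \<theta>))\<^sup>2 = (cmod d)\<^sup>2"
      unfolding gd(4) by (simp add: norm_mult norm_power power_mult_distrib)
    hence "((cmod g)\<^sup>2)\<^sup>2 * (cmod (F.nm \<theta>))\<^sup>2 = of_int (2 * p1 * p2) * (of_int w)\<^sup>2"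
      unfolding gnorm_eq[OF dg, symmetric] gn2 by simp
    hence "(cmod (F.nm \<theta>))\<^sup>2 = of_int (2 * p1 * p2) * r\<^sup>2"
      using gd(2) by (simp add: r_def power_divide field_simps)
    ultimately show ?thesis by blast
  qed
qed

text \<open>Multiplication by the ambiguous generator coming from the unit of norm -1 exchanges the two
  square classes.\<close>

lemma ambiguous_norm_principal:
  assumes th: "\<theta> \<in> F.k" and J: "F.ambiguous J (F.nm \<theta>)"
  shows "\<exists>s. s \<noteq> 0 \<and> J = scl s F.R"
proof (rule ccontr)
  assume np: "\<not> ?thesis"
  then obtain r where r: "r \<in> \<rat>" "(cmod (F.nm \<theta>))\<^sup>2 = of_int (2 * p1 * p2) * r\<^sup>2"
    using ambiguous_norm_cases[OF th J] by blast
  obtain x y where pell: "x\<^sup>2 + 1 = 2 * p1 * p2 * y\<^sup>2" using negative_pell .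
  let ?g = "F.pell_gamma x y"
  have gth: "?g * \<theta> \<in> F.k" "F.nm (?g * \<theta>) = F.nm ?g * F.nm \<theta>"
    using F.k_mult F.nm_mult F.pell_gamma_k[OF pell] th by auto
  have g0: "?g \<noteq> 0" by (rule F.pell_gamma_nonzero[OF pell])
  have "F.ambiguous (scl ?g J) (F.nm (?g * \<theta>))" unfolding gth(2) by (rule F.ambiguous_pell[OF pell J])
  from ambiguous_norm_cases[OF gth(1) this] show False
  proof
    assume "\<exists>s. s \<noteq> 0 \<and> scl ?g J = scl s F.R"
    then obtain s where s: "s \<noteq> 0" "scl ?g J = scl s F.R" by blast
    have "J = scl (inverse ?g * s) F.R" by (rule scl_eq_sclD[OF s(2) g0])
    moreover have "inverse ?g * s \<noteq> 0" using g0 s(1) by simp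
    ultimately show False using np by blast
  next
    assume "\<exists>r\<in>\<rat>. (cmod (F.nm (?g * \<theta>)))\<^sup>2 = of_int (2 * p1 * p2) * r\<^sup>2"
    then obtain r' where r': "r' \<in> \<rat>" "(cmod (F.nm (?g * \<theta>)))\<^sup>2 = of_int (2 * p1 * p2) * r'\<^sup>2" by blast
    define D where "D = real_of_int (2 * p1 * p2)"
    have D0: "D > 0" using F.D_pos unfolding D_def by (simp only: of_int_0_less_iff)
    have "D * r'\<^sup>2 = (cmod (F.nm ?g))\<^sup>2 * (cmod (F.nm \<theta>))\<^sup>2"
      using r'(2) unfolding gth(2) D_def by (simp add: norm_mult power_mult_distrib)
    also have "\<dots> = D * (D * (2 * of_int y * r)\<^sup>2)"
      unfolding F.cmod_nm_pell_gamma[OF pell] r(2) D_def by (simp add: power_mult_distrib mult_ac)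
    finally have sq: "r'\<^sup>2 = D * (2 * of_int y * r)\<^sup>2" using D0 by simp
    have "\<theta> \<noteq> 0" using J F.nm_eq_0_iff[OF th] unfolding F.ambiguous_def by auto
    hence "r \<noteq> 0" using r(2) F.nm_eq_0_iff[OF th] by auto
    define t where "t = \<bar>r' / (2 * of_int y * r)\<bar>"
    have "t\<^sup>2 = D" using sq \<open>r \<noteq> 0\<close> F.pell_y_nonzero[OF pell]
      by (simp add: t_def power_divide)
    moreover have "t \<ge> 0" by (simp add: t_def)
    ultimately have "sqrt D = t" by (metis real_sqrt_unique)
    moreover have "t \<in> \<rat>" using r(1) r'(1) by (auto simp: t_def)
    ultimately have "F.\<eta> \<in> gauss_rat" unfolding F.\<eta>_def gauss_rat_def D_def[symmetric] by simp
    thus False using F.eta_not_rat by blast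
  qed
qed

lemma capitulation_distinct:
  assumes K: "subfield_C K" "\<i> \<in> K" "complex_of_real (sqrt 2) \<in> K"
    "complex_of_real (sqrt (of_int p1)) \<in> K" "complex_of_real (sqrt (of_int p2)) \<in> K"
  shows "capitulation_kernel F.k K = class_group_2 F.R"
proof (rule F.capitulation_criterion)
  show "subfield_C K" by fact
  have "F.\<eta> = complex_of_real (sqrt 2) * complex_of_real (sqrt (of_int p1)) * complex_of_real (sqrt (of_int p2))"
    by (simp add: F.\<eta>_def real_sqrt_mult)
  hence "F.\<eta> \<in> K" using K by (simp add: subfield_mult)
  thus "F.k \<subseteq> K" unfolding F.k_def using K by (intro gen_field_least) auto
  show "\<exists>s. s \<noteq> 0 \<and> J = scl s F.R" if "\<theta> \<in> F.k" "F.ambiguous J (F.nm \<theta>)" for J \<theta>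
    using ambiguous_norm_principal[OF that] .
  show "\<exists>\<omega>. \<omega> \<in> F.R \<and> inverse \<omega> \<in> F.R \<and> \<omega> \<noteq> 0 \<and> F.nm \<omega> = F.nm \<beta>"
    if be: "\<beta> \<in> F.k" "F.nm \<beta> \<in> {1, -1, \<i>, -\<i>}" for \<beta>
  proof -
    obtain X Y Z where XYZ: "X \<in> gauss" "Y \<in> gauss" "Z \<in> gauss" "Z \<noteq> 0"
      "X\<^sup>2 - of_int (2 * p1 * p2) * Y\<^sup>2 = F.nm \<beta> * Z\<^sup>2" using F.nm_integral[OF be(1)] .
    have "F.nm \<beta> \<in> {1, -1}" by (rule norm_unit_cases[OF be(2) XYZ])
    moreover have "F.nm 1 = 1" "F.nm \<i> = -1" by (simp_all add: F.nm_gauss_rat)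
    ultimately show ?thesis using F.gauss_unit_R[of 1] F.gauss_unit_R[of \<i>]
      by (metis (no_types) complex_i_not_zero empty_iff insert_iff one_neq_zero)
  qed
  show "unit_square K d" if d: "gsquarefree d" "gdvd d (of_int (2 * (2 * p1 * p2)))" for d
  proof -
    obtain \<pi> where pi: "gprime \<pi>" "gnorm \<pi> = p1" using exists_gprime[OF prime1 cong1] .
    obtain \<rho> where rho: "gprime \<rho>" "gnorm \<rho> = p2" using exists_gprime[OF prime2 cong2] .
    obtain u a b b' c c' where "a \<le> (1 :: nat)" "b \<le> (1 :: nat)" "b' \<le> (1 :: nat)"
      "c \<le> (1 :: nat)" "c' \<le> (1 :: nat)" and ef: "u \<in> {1, -1, \<i>, -\<i>}"
      "d = u * (1 + \<i>) ^ a * \<pi> ^ b * cnj \<pi> ^ b' * \<rho> ^ c * cnj \<rho> ^ c'"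
      using gsquarefree_dvd_4pq[OF d pi rho] .
    show ?thesis unfolding ef(2)
      by (intro unit_square_mult[OF K(1)] unit_square_power[OF K(1)] unit_square_gauss_unit[OF K(1,2) ef(1)]
          unit_square_one_plus_ii[OF K(1-3)] unit_square_gprime[OF K(1,2,4) pi cong1]
          unit_square_gprime[OF K(1,2,5) rho cong2])
  qed
qed

end

interpretation sqrt2: quad_field 2
proof
  show "\<not> (\<exists>r :: int. r\<^sup>2 = 2)"
    using prime_dvd_not_square[OF prime_int_2, of 2 1] by auto
qed simp

lemma capitulation_sqrt2:
  assumes K: "subfield_C K" "sqrt2.k \<subseteq> K"
  shows "capitulation_kernel sqrt2.k K = class_group_2 (ring_of_integers sqrt2.k)"
proof (rule sqrt2.capitulation_criterion[OF _ _ K])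
  let ?k = "sqrt2.k"
  have eta: "sqrt2.\<eta> = complex_of_real (sqrt 2)" by (simp add: sqrt2.\<eta>_def)
  have us: "unit_square ?k d" if d: "gsquarefree d" "gdvd d (of_int (2 * 2))" for d
  proof -
    have "gdvd d 4" using d(2) by simp
    from gsquarefree_dvd_4[OF d(1) this] obtain u a where u: "u \<in> {1, -1, \<i>, -\<i>}"
      and "a \<le> (1 :: nat)" and du: "d = u * (1 + \<i>) ^ a" .
    have "complex_of_real (sqrt 2) \<in> ?k" using sqrt2.eta_k unfolding eta .
    thus ?thesis unfolding du
      by (intro unit_square_mult[OF sqrt2.subfield_k] unit_square_power[OF sqrt2.subfield_k]
          unit_square_gauss_unit[OF sqrt2.subfield_k sqrt2.ii_k u]
          unit_square_one_plus_ii[OF sqrt2.subfield_k sqrt2.ii_k])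
  qed
  thus "unit_square K d" if "gsquarefree d" "gdvd d (of_int (2 * 2))" for d
    using unit_square_mono[OF K(2)] that by blast
  show "\<exists>s. s \<noteq> 0 \<and> J = scl s (ring_of_integers ?k)"
    if th: "\<theta> \<in> ?k" "sqrt2.ambiguous J (sqrt2.nm \<theta>)" for J \<theta>
  proof -
    obtain g d where "g \<in> gauss_rat" and gd: "g \<noteq> 0" "gsquarefree d" and "d = g\<^sup>2 * sqrt2.nm \<theta>"
      and am: "sqrt2.ambiguous (scl g J) d" and "scl g J \<subseteq> ring_of_integers ?k" and dv: "gdvd d (of_int (2 * 2))"
      by (rule sqrt2.ambiguous_squarefree[OF th(2)])
    obtain s u where su: "s \<in> ?k" "s \<noteq> 0" "u \<in> ring_of_integers ?k" "inverse u \<in> ring_of_integers ?k"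
      "u \<noteq> 0" "d = u * s\<^sup>2" using us[OF gd(2) dv] unfolding unit_square_def by blast
    have "scl g J = scl s (ring_of_integers ?k)" by (rule sqrt2.ambiguous_principal[OF am su])
    hence "J = scl (inverse g * s) (ring_of_integers ?k)" using gd(1) by (rule scl_eq_sclD)
    thus ?thesis using gd(1) su(2) by (intro exI[of _ "inverse g * s"]) auto
  qed
  show "\<exists>\<omega>. \<omega> \<in> ring_of_integers ?k \<and> inverse \<omega> \<in> ring_of_integers ?k \<and> \<omega> \<noteq> 0 \<and> sqrt2.nm \<omega> = sqrt2.nm \<beta>"
    if be: "\<beta> \<in> ?k" "sqrt2.nm \<beta> \<in> {1, -1, \<i>, -\<i>}" for \<beta>
  proof -
    define z where "z = (1 + \<i>) / sqrt2.\<eta>"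
    have one: "1 + \<i> \<in> gauss_rat" "1 + \<i> \<noteq> 0" by (auto simp: complex_eq_iff)
    have zk: "z \<in> ?k" "z \<noteq> 0" using one sqrt2.eta_k sqrt2.eta_nonzero sqrt2.gauss_rat_k
      by (auto simp: z_def intro: sqrt2.k_divide)
    have zz: "z\<^sup>2 = \<i>"
      unfolding z_def power_divide one_plus_ii_powers by (simp add: power2_eq_square sqrt2.eta_sq)
    have zR: "z \<in> ring_of_integers ?k" "inverse z \<in> ring_of_integers ?k"
    proof -
      have "algebraic_int (z\<^sup>2)" "algebraic_int ((inverse z)\<^sup>2)" unfolding power_inverse zz by simp_all
      thus "z \<in> ring_of_integers ?k" "inverse z \<in> ring_of_integers ?k"
        using zk(1) sqrt2.k_inverse[OF zk(1)] algebraic_int_of_square by (simp_all add: ring_of_integers_def)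
    qed
    have nz: "sqrt2.nm z = -\<i>"
    proof -
      have "sqrt2.nm sqrt2.\<eta> = - 2" unfolding sqrt2.nm_def sqrt2.sigma_eta by (simp add: sqrt2.eta_sq)
      thus ?thesis unfolding z_def sqrt2.nm_divide[OF sqrt2.gauss_rat_k[OF one(1)] sqrt2.eta_k]
          sqrt2.nm_gauss_rat[OF one(1)] one_plus_ii_powers by simp
    qed
    have n1: "sqrt2.nm 1 = 1" "sqrt2.nm \<i> = -1" by (simp_all add: sqrt2.nm_gauss_rat)
    have niz: "sqrt2.nm (\<i> * z) = \<i>"
      using sqrt2.nm_mult[OF sqrt2.ii_k zk(1)] nz n1 by simp
    have iz: "\<i> * z \<in> ring_of_integers ?k" "inverse (\<i> * z) \<in> ring_of_integers ?k"
    proof -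
      have i: "\<i> \<in> ring_of_integers ?k" "inverse \<i> \<in> ring_of_integers ?k"
        using sqrt2.gauss_unit_R[of \<i>] by blast+
      show "\<i> * z \<in> ring_of_integers ?k" by (rule sqrt2.R_mult[OF i(1) zR(1)])
      show "inverse (\<i> * z) \<in> ring_of_integers ?k"
        unfolding inverse_mult_distrib by (rule sqrt2.R_mult[OF i(2) zR(2)])
    qed
    consider "sqrt2.nm \<beta> = 1" | "sqrt2.nm \<beta> = -1" | "sqrt2.nm \<beta> = \<i>" | "sqrt2.nm \<beta> = -\<i>"
      using be(2) by blast
    thus ?thesis
    proof cases
      case 1
      thus ?thesis using sqrt2.gauss_unit_R[of 1] n1 by (intro exI[of _ 1]) auto
    next
      case 2
      thus ?thesis using sqrt2.gauss_unit_R[of \<i>] n1 by (intro exI[of _ \<i>]) auto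
    next
      case 3
      thus ?thesis using iz niz zk by (intro exI[of _ "\<i> * z"]) auto
    next
      case 4
      thus ?thesis using zR nz zk by (intro exI[of _ z]) auto
    qed
  qed
qed

theorem mainTheorem13:
  fixes p1 p2 :: int
  assumes "prime p1" and "prime p2"
    and "[p1 = 1] (mod 4)" and "[p2 = 1] (mod 4)"
    and "(Legendre p1 p2 = -1 \<and> Legendre 2 p1 = -1) \<or>
         (Legendre p1 p2 = -1 \<and> Legendre 2 p2 = -1) \<or>
         (Legendre 2 p1 = -1 \<and> Legendre 2 p2 = -1)"
  defines "k \<equiv> gen_field {complex_of_real (sqrt (real_of_int (2 * p1 * p2))), \<i>}"
    and "kstar \<equiv> gen_field {complex_of_real (sqrt 2), complex_of_real (sqrt (real_of_int p1)),
                              complex_of_real (sqrt (real_of_int p2)), \<i>}"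
  shows "capitulation_kernel k kstar = class_group_2 (ring_of_integers k)"
proof -
  have K: "subfield_C kstar" unfolding kstar_def by (rule subfield_gen_field)
  have gens: "complex_of_real (sqrt 2) \<in> kstar" "complex_of_real (sqrt (of_int p1)) \<in> kstar"
    "complex_of_real (sqrt (of_int p2)) \<in> kstar" "\<i> \<in> kstar"
    unfolding kstar_def by (rule subsetD[OF gen_field_base], simp)+
  show ?thesis
  proof (cases "p1 = p2")
    case False
    then interpret symbol_primes p1 p2 using assms(1-5) by unfold_locales
    interpret F: quad_field "2 * p1 * p2" by (rule quad_field_2pq)
    have "k = F.k" by (simp only: k_def F.k_def F.\<eta>_def)
    thus ?thesis using capitulation_distinct[OF K gens(4,1,2,3)] by simp
  next
    case True
    have p: "p1 > 0" using assms(1) prime_gt_0_int by blast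
    have eta: "sqrt2.\<eta> = complex_of_real (sqrt 2)" by (simp add: sqrt2.\<eta>_def)
    have e: "complex_of_real (sqrt (real_of_int (2 * p1 * p2))) = sqrt2.\<eta> * of_int p1"
    proof -
      have "2 * p1 * p2 = 2 * p1\<^sup>2" by (simp add: True power2_eq_square)
      hence "sqrt (real_of_int (2 * p1 * p2)) = sqrt (real_of_int (2 * p1\<^sup>2))" by (simp only:)
      also have "\<dots> = sqrt 2 * of_int p1" using p by (simp add: real_sqrt_mult)
      finally show ?thesis unfolding eta by simp
    qed
    have kf: "subfield_C k" unfolding k_def by (rule subfield_gen_field)
    have "k = sqrt2.k"
    proof
      show "k \<subseteq> sqrt2.k" unfolding k_def e
        using sqrt2.k_mult[OF sqrt2.eta_k sqrt2.k_of_int] sqrt2.ii_k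
        by (intro gen_field_least[OF sqrt2.subfield_k]) simp
      have "sqrt2.\<eta> * of_int p1 \<in> k" unfolding k_def e using gen_field_base by blast
      hence "sqrt2.\<eta> * of_int p1 / of_int p1 \<in> k"
        by (rule subfield_divide[OF kf _ subfield_of_int[OF kf]])
      hence "sqrt2.\<eta> \<in> k" using p by simp
      moreover have "\<i> \<in> k" unfolding k_def using gen_field_base by blast
      ultimately show "sqrt2.k \<subseteq> k" unfolding sqrt2.k_def by (intro gen_field_least[OF kf]) simp
    qed
    moreover have "sqrt2.k \<subseteq> kstar" unfolding sqrt2.k_def eta
      using gens by (intro gen_field_least[OF K]) simp
    ultimately show ?thesis using capitulation_sqrt2[OF K] by simp
  qed
qed

end
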